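(* Let $\mathcal X_l=\{X_1,\dots,X_l\}$ be an i.i.d. sample from $P_0=P_{\theta_0}$, $\theta_0\in\Theta$, let $\Pi$ be a prior on $\Theta$, and let $k$ be a characteristic kernel on $\Theta\times\Theta$. Let $d$ be the Hellinger distance $d(\theta_1,\theta_2)=h(P_{\theta_1},P_{\theta_2})$ or, in the parametric case $\Theta\subseteq\mathbb R^p$, the Euclidean distance. Assume that $\varepsilon_l>0$ and $\Theta_l\subset\Theta$ are such that for some constant $C>0$: (1) $\log M(\varepsilon_l,\Theta_l,d)\le l\varepsilon_l^2$; (2) $\Pi(\Theta\setminus\Theta_l)\le\exp(-l\varepsilon_l^2(C+4))$; (3) $\Pi\left(\theta:\ -P_0\left(\log\frac{p_\theta}{p_0}\right)\le\varepsilon_l^2,\ P_0\left(\log\frac{p_\theta}{p_0}\right)^2\le\varepsilon_l^2\right)\ge\exp(-Cl\varepsilon_l^2)$. Assume moreover that there exist $\gamma>0$, $r(\theta_0)>0$ and $\tilde C(\theta_0)>0$ such that $$d(\theta,\theta_0)\ge\tilde C(\theta_0)\rho_k^\gamma(\theta,\theta_0)\quad\text{whenever } d(\theta,\theta_0)\le r(\theta_0),$$ and, when $d$ is the Euclidean distance, that the test condition (T) stated in the context holds. In addition, let the prior $\Pi$ be such that $$D_k^W:=\int_\Theta\rho_k^W(\theta,\theta_0)\,d\Pi(\theta)<\infty$$ for a sufficiently large $W$ (how large depending only on $C$ and on the absolute constant $\tilde K$ below). Then there exist a sufficiently large $R=R(\theta_0,\gamma)>0$ and an absolute constant $\tilde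 K>0$ such that $$\Pr\left(\left\|\delta_0-\Pi_l(\cdot|\mathcal X_l)\right\|_{\mathcal F_k}\ge R\varepsilon_l^{1/\gamma}+D_ke^{-\tilde Kl\varepsilon_l^2/2}\right)\le\frac1{l\varepsilon_l^2}+4e^{-\tilde Kl\varepsilon_l^2}.$$
   Context: $\{P_\theta,\theta\in\Theta\}$ is a family of probability distributions on $\mathbb R^D$ with Lebesgue densities $p_\theta$; $p_0:=p_{\theta_0}$; $\delta_0:=\delta_{\theta_0}$ is the Dirac measure. $h(P,Q)=\sqrt{\frac12\int(\sqrt p-\sqrt q)^2dx}$ is the Hellinger distance; $\Theta$ with the metric $h(P_{\theta_1},P_{\theta_2})$ is assumed to be a separable metric space and $\Pi$ is defined on its Borel $\sigma$-algebra. $P_0f:=\int f\,dP_0$ and $P_0(\log\frac{p_\theta}{p_0})^2=\int(\log\frac{p_\theta}{p_0})^2dP_0$. The posterior is $\Pi_l(B|\mathcal X_l)=\frac{\int_B\prod_{i=1}^lp_\theta(X_i)d\Pi(\theta)}{\int_\Theta\prod_{i=1}^lp_\theta(X_i)d\Pi(\theta)}$. $M(\varepsilon,\mathbb Y,d)$ is the maximal number of disjoint $d$-balls of radius $\varepsilon$ contained in $(\mathbb Y,d)$. For a kernel (symmetric positive definite function) $k$ with reproducing kernel Hilbert space $\mathbb H$: $\rho_k(\theta_1,\theta_2)=\|k(\cdot,\theta_1)-k(\cdot,\theta_2)\|_{\mathbb H}$ ($(\Theta,\rho_k)$ is assumed separable); $\mathcal F_k=\{f\in\mathbb H:\|f\|_{\mathbb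 H}\le1\}$; $\|P-Q\|_{\mathcal F_k}=\sup_{f\in\mathcal F_k}|\int f\,d(P-Q)|$; $k$ is characteristic if $\|P-Q\|_{\mathcal F_k}=0$ iff $P=Q$ (for probability measures integrating $\sqrt{k(\theta,\theta)}$). $D_k$ denotes $\left(\int_\Theta\rho_k^W(\theta,\theta_0)d\Pi(\theta)\right)^{1/W}$. Test condition (T) (assumed only when $d$ is Euclidean): for a universal constant $K>0$, for every $n$ and every pair $\theta_1,\theta_2\in\Theta$ there exists a test $\phi_n=\phi_n(X_1,\dots,X_n)$ such that $\mathbb E_{P_{\theta_1}}\phi_n\le e^{-Knd^2(\theta_1,\theta_2)}$ and $\sup_{d(\theta,\theta_2)<d(\theta_1,\theta_2)/2}\mathbb E_{P_\theta}(1-\phi_n)\le e^{-Knd^2(\theta_1,\theta_2)}$. The constants $C,\tilde C(\theta_0),r(\theta_0)$ and the kernel $k$ are regarded as fixed; $R$ does not depend on $l$.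
   Formalization: For arbitrary ε_l the claim fails, since the comparison of d and ρ_k is only local. Proved: the bound for each l with Rε_l ≤ r(θ0), R not depending on prior or l; and, if ε_l→0, for all l with one R not depending on l but possibly on the prior and the sequences. *)

theory Defs
  imports "HOL-Probability.Probability"
begin

section \<open>The statistical model\<close>

text \<open>
  The sample space \<open>\<real>\<^sup>D\<close> carries its dimension as a number (coordinates indexed by \<open>{..<D}\<close>),
  not as a type, so that a constant can be chosen before the dimension is.
\<close>

definition leb :: "nat \<Rightarrow> (nat \<Rightarrow> real) measure" where
  "leb D = (\<Pi>\<^sub>M i\<in>{..<D}. lborel)"

definition law :: "nat \<Rightarrow> ('a \<Rightarrow> (nat \<Rightarrow> real) \<Rightarrow> real) \<Rightarrow> 'a \<Rightarrow> (nat \<Rightarrow> real) measure" where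
  "law D p \<theta> = density (leb D) (\<lambda>x. ennreal (p \<theta> x))"

text \<open>The law of an i.i.d. sample \<open>X\<^sub>0, \<dots>, X\<^sub>n\<^sub>-\<^sub>1\<close>; the sample is the coordinate process.\<close>

definition sample_law :: "nat \<Rightarrow> (nat \<Rightarrow> real) measure \<Rightarrow> (nat \<Rightarrow> nat \<Rightarrow> real) measure" where
  "sample_law n P = (\<Pi>\<^sub>M i\<in>{..<n}. P)"

definition hellinger :: "nat \<Rightarrow> ('a \<Rightarrow> (nat \<Rightarrow> real) \<Rightarrow> real) \<Rightarrow> 'a \<Rightarrow> 'a \<Rightarrow> real" where
  "hellinger D p \<theta>\<^sub>1 \<theta>\<^sub>2 = sqrt (1/2 * (\<integral>x. (sqrt (p \<theta>\<^sub>1 x) - sqrt (p \<theta>\<^sub>2 x))\<^sup>2 \<partial>(leb D)))"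

definition hellinger_topology ::
    "nat \<Rightarrow> 'a set \<Rightarrow> ('a \<Rightarrow> (nat \<Rightarrow> real) \<Rightarrow> real) \<Rightarrow> 'a topology" where
  "hellinger_topology D \<Theta> p = Metric_space.mtopology \<Theta> (hellinger D p)"

definition param_borel ::
    "nat \<Rightarrow> 'a set \<Rightarrow> ('a \<Rightarrow> (nat \<Rightarrow> real) \<Rightarrow> real) \<Rightarrow> 'a measure" where
  "param_borel D \<Theta> p = sigma \<Theta> {U. openin (hellinger_topology D \<Theta> p) U}"

text \<open>
  Joint measurability of \<open>(\<theta>, x) \<mapsto> p\<^sub>\<theta>(x)\<close> is the usual convention behind
  writing \<open>\<integral> \<Prod>\<^sub>i p\<^sub>\<theta>(X\<^sub>i) d\<pi>(\<theta>)\<close>.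
\<close>

definition statistical_model ::
    "nat \<Rightarrow> 'a set \<Rightarrow> ('a \<Rightarrow> (nat \<Rightarrow> real) \<Rightarrow> real) \<Rightarrow> bool" where
  "statistical_model D \<Theta> p \<longleftrightarrow>
     D \<ge> 1 \<and>
     (\<forall>\<theta>\<in>\<Theta>. p \<theta> \<in> borel_measurable (leb D) \<and> (\<forall>x\<in>space (leb D). 0 \<le> p \<theta> x) \<and>
            prob_space (law D p \<theta>)) \<and>
     Metric_space \<Theta> (hellinger D p) \<and>
     separable_space (hellinger_topology D \<Theta> p) \<and>
     (\<lambda>(\<theta>, x). p \<theta> x) \<in> borel_measurable (param_borel D \<Theta> p \<Otimes>\<^sub>M leb D)"

section \<open>Distances on the parameter set\<close>

text \<open>
  The parametric case \<open>\<Theta> \<subseteq> \<real>\<^sup>q\<close>: a parameter is identified with its coordinate vector through an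
  injection \<open>c\<close> (take \<open>c = id\<close> if parameters already are coordinate vectors).
\<close>

definition euclidean_coords :: "nat \<Rightarrow> 'a set \<Rightarrow> ('a \<Rightarrow> nat \<Rightarrow> real) \<Rightarrow> bool" where
  "euclidean_coords q \<Theta> c \<longleftrightarrow> q \<ge> 1 \<and> inj_on c \<Theta> \<and> c ` \<Theta> \<subseteq> (\<Pi>\<^sub>E i\<in>{..<q}. UNIV)"

definition euclidean_distance :: "nat \<Rightarrow> ('a \<Rightarrow> nat \<Rightarrow> real) \<Rightarrow> 'a \<Rightarrow> 'a \<Rightarrow> real" where
  "euclidean_distance q c \<theta>\<^sub>1 \<theta>\<^sub>2 = L2_set (\<lambda>i. c \<theta>\<^sub>1 i - c \<theta>\<^sub>2 i) {..<q}"

definition packing_number :: "real \<Rightarrow> 'a set \<Rightarrow> ('a \<Rightarrow> 'a \<Rightarrow> real) \<Rightarrow> enat" where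
  "packing_number \<epsilon> Y d =
     (SUP S \<in> {S. finite S \<and> S \<subseteq> Y \<and> disjoint_family_on (\<lambda>x. Metric_space.mball Y d x \<epsilon>) S}.
        enat (card S))"

definition test_condition ::
    "real \<Rightarrow> nat \<Rightarrow> 'a set \<Rightarrow> ('a \<Rightarrow> (nat \<Rightarrow> real) \<Rightarrow> real) \<Rightarrow> ('a \<Rightarrow> 'a \<Rightarrow> real) \<Rightarrow> bool" where
  "test_condition K D \<Theta> p d \<longleftrightarrow>
     (\<forall>n. \<forall>\<theta>\<^sub>1\<in>\<Theta>. \<forall>\<theta>\<^sub>2\<in>\<Theta>.
        \<exists>\<phi> :: (nat \<Rightarrow> nat \<Rightarrow> real) \<Rightarrow> real.
          \<phi> \<in> borel_measurable (sample_law n (leb D)) \<and>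
          (\<forall>x\<in>space (sample_law n (leb D)). 0 \<le> \<phi> x \<and> \<phi> x \<le> 1) \<and>
          (\<integral>x. \<phi> x \<partial>(sample_law n (law D p \<theta>\<^sub>1))) \<le> exp (- K * real n * (d \<theta>\<^sub>1 \<theta>\<^sub>2)\<^sup>2) \<and>
          (\<forall>\<theta>\<in>\<Theta>. d \<theta> \<theta>\<^sub>2 < d \<theta>\<^sub>1 \<theta>\<^sub>2 / 2 \<longrightarrow>
             (\<integral>x. (1 - \<phi> x) \<partial>(sample_law n (law D p \<theta>)))
               \<le> exp (- K * real n * (d \<theta>\<^sub>1 \<theta>\<^sub>2)\<^sup>2)))"

section \<open>Kernels\<close>

definition kernel_on :: "'a set \<Rightarrow> ('a \<Rightarrow> 'a \<Rightarrow> real) \<Rightarrow> bool" where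
  "kernel_on \<Theta> k \<longleftrightarrow>
     (\<forall>s\<in>\<Theta>. \<forall>t\<in>\<Theta>. k s t = k t s) \<and>
     (\<forall>S a. finite S \<and> S \<subseteq> \<Theta> \<longrightarrow> 0 \<le> (\<Sum>s\<in>S. \<Sum>t\<in>S. a s * a t * k s t))"

text \<open>Functions on \<open>\<Theta>\<close> are represented by functions on the type that vanish off \<open>\<Theta>\<close>.\<close>

definition kernel_section :: "'a set \<Rightarrow> ('a \<Rightarrow> 'a \<Rightarrow> real) \<Rightarrow> 'a \<Rightarrow> 'a \<Rightarrow> real" where
  "kernel_section \<Theta> k \<theta> = (\<lambda>x. if x \<in> \<Theta> then k x \<theta> else 0)"

definition ip_norm :: "(('a \<Rightarrow> real) \<Rightarrow> ('a \<Rightarrow> real) \<Rightarrow> real) \<Rightarrow> ('a \<Rightarrow> real) \<Rightarrow> real" where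
  "ip_norm ip f = sqrt (ip f f)"

text \<open>
  The reproducing kernel Hilbert space of \<open>k\<close>: a Hilbert space \<open>H\<close> of functions on \<open>\<Theta>\<close>, with inner
  product \<open>ip\<close>, that contains the sections \<open>k(\<cdot>, \<theta>)\<close> and in which they represent evaluation.
  \<open>H\<close>, and \<open>ip\<close> on \<open>H\<close>, are determined by \<open>k\<close>.
\<close>

definition is_rkhs ::
    "'a set \<Rightarrow> ('a \<Rightarrow> 'a \<Rightarrow> real) \<Rightarrow> ('a \<Rightarrow> real) set \<Rightarrow>
     (('a \<Rightarrow> real) \<Rightarrow> ('a \<Rightarrow> real) \<Rightarrow> real) \<Rightarrow> bool" where
  "is_rkhs \<Theta> k H ip \<longleftrightarrow>
     (\<forall>f\<in>H. \<forall>x. x \<notin> \<Theta> \<longrightarrow> f x = 0) \<and>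
     (\<lambda>x. 0) \<in> H \<and>
     (\<forall>f\<in>H. \<forall>g\<in>H. (\<lambda>x. f x + g x) \<in> H) \<and>
     (\<forall>c. \<forall>f\<in>H. (\<lambda>x. c * f x) \<in> H) \<and>
     (\<forall>f\<in>H. \<forall>g\<in>H. ip f g = ip g f) \<and>
     (\<forall>f\<in>H. \<forall>g\<in>H. \<forall>h\<in>H. ip (\<lambda>x. f x + g x) h = ip f h + ip g h) \<and>
     (\<forall>c. \<forall>f\<in>H. \<forall>g\<in>H. ip (\<lambda>x. c * f x) g = c * ip f g) \<and>
     (\<forall>f\<in>H. 0 \<le> ip f f \<and> (ip f f = 0 \<longrightarrow> f = (\<lambda>x. 0))) \<and>
     (\<forall>F :: nat \<Rightarrow> 'a \<Rightarrow> real.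
        (\<forall>n. F n \<in> H) \<and>
        (\<forall>e>0. \<exists>N. \<forall>m\<ge>N. \<forall>n\<ge>N. ip_norm ip (\<lambda>x. F m x - F n x) < e) \<longrightarrow>
        (\<exists>g\<in>H. (\<lambda>n. ip_norm ip (\<lambda>x. F n x - g x)) \<longlonglongrightarrow> 0)) \<and>
     (\<forall>\<theta>\<in>\<Theta>. kernel_section \<Theta> k \<theta> \<in> H) \<and>
     (\<forall>\<theta>\<in>\<Theta>. \<forall>f\<in>H. ip f (kernel_section \<Theta> k \<theta>) = f \<theta>)"

definition kernel_distance ::
    "'a set \<Rightarrow> ('a \<Rightarrow> 'a \<Rightarrow> real) \<Rightarrow> (('a \<Rightarrow> real) \<Rightarrow> ('a \<Rightarrow> real) \<Rightarrow> real) \<Rightarrow> 'a \<Rightarrow> 'a \<Rightarrow> real" where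
  "kernel_distance \<Theta> k ip \<theta>\<^sub>1 \<theta>\<^sub>2 =
     ip_norm ip (\<lambda>x. kernel_section \<Theta> k \<theta>\<^sub>1 x - kernel_section \<Theta> k \<theta>\<^sub>2 x)"

definition unit_ball ::
    "('a \<Rightarrow> real) set \<Rightarrow> (('a \<Rightarrow> real) \<Rightarrow> ('a \<Rightarrow> real) \<Rightarrow> real) \<Rightarrow> ('a \<Rightarrow> real) set" where
  "unit_ball H ip = {f\<in>H. ip_norm ip f \<le> 1}"

text \<open>\<open>\<parallel>P - Q\<parallel>\<^sub>\<F>\<close>; the value \<open>\<infinity>\<close> is allowed.\<close>

definition ipm :: "('a \<Rightarrow> real) set \<Rightarrow> 'a measure \<Rightarrow> 'a measure \<Rightarrow> ennreal" where
  "ipm \<F> P Q = (SUP f\<in>\<F>. ennreal \<bar>(\<integral>\<theta>. f \<theta> \<partial>P) - (\<integral>\<theta>. f \<theta> \<partial>Q)\<bar>)"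

text \<open>\<open>B\<close> is the Borel \<open>\<sigma>\<close>-algebra of \<open>\<Theta>\<close>, given as a measure space whose measure is irrelevant.\<close>

definition characteristic ::
    "'a measure \<Rightarrow> ('a \<Rightarrow> 'a \<Rightarrow> real) \<Rightarrow> ('a \<Rightarrow> real) set \<Rightarrow>
     (('a \<Rightarrow> real) \<Rightarrow> ('a \<Rightarrow> real) \<Rightarrow> real) \<Rightarrow> bool" where
  "characteristic B k H ip \<longleftrightarrow>
     (\<forall>P Q. prob_space P \<and> prob_space Q \<and> sets P = sets B \<and> sets Q = sets B \<and>
            integrable P (\<lambda>\<theta>. sqrt (k \<theta> \<theta>)) \<and> integrable Q (\<lambda>\<theta>. sqrt (k \<theta> \<theta>)) \<longrightarrow>
            (ipm (unit_ball H ip) P Q = 0 \<longleftrightarrow> P = Q))"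

text \<open>
  A characteristic kernel with its RKHS \<open>(H, ip)\<close>. Measurability of the sections is what the
  integrals of elements of \<open>H\<close> presuppose.
\<close>

definition characteristic_kernel ::
    "'a measure \<Rightarrow> ('a \<Rightarrow> 'a \<Rightarrow> real) \<Rightarrow> ('a \<Rightarrow> real) set \<Rightarrow>
     (('a \<Rightarrow> real) \<Rightarrow> ('a \<Rightarrow> real) \<Rightarrow> real) \<Rightarrow> bool" where
  "characteristic_kernel B k H ip \<longleftrightarrow>
     kernel_on (space B) k \<and>
     is_rkhs (space B) k H ip \<and>
     (\<forall>\<theta>\<in>space B. (\<lambda>x. k x \<theta>) \<in> borel_measurable B) \<and>
     (\<exists>S. countable S \<and> S \<subseteq> space B \<and>
        (\<forall>\<theta>\<in>space B. \<forall>e>0. \<exists>s\<in>S. kernel_distance (space B) k ip \<theta> s < e)) \<and>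
     characteristic B k H ip"

section \<open>Prior and posterior\<close>

definition prior :: "'a measure \<Rightarrow> 'a measure \<Rightarrow> bool" where
  "prior B \<pi> \<longleftrightarrow> prob_space \<pi> \<and> sets \<pi> = sets B"

definition posterior ::
    "('a \<Rightarrow> (nat \<Rightarrow> real) \<Rightarrow> real) \<Rightarrow> 'a measure \<Rightarrow> nat \<Rightarrow> (nat \<Rightarrow> nat \<Rightarrow> real) \<Rightarrow> 'a measure" where
  "posterior p \<pi> l X =
     density \<pi> (\<lambda>\<theta>. ennreal (\<Prod>i<l. p \<theta> (X i)) / (\<integral>\<^sup>+\<theta>'. ennreal (\<Prod>i<l. p \<theta>' (X i)) \<partial>\<pi>))"

text \<open>
  The parameters with \<open>-P\<^sub>0 log (p\<^sub>\<theta>/p\<^sub>0) \<le> \<epsilon>\<^sup>2\<close> and \<open>P\<^sub>0 (log (p\<^sub>\<theta>/p\<^sub>0))\<^sup>2 \<le> \<epsilon>\<^sup>2\<close>. The first two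
  conjuncts spell out that these quantities are finite; they guard against \<open>ln 0 = 0\<close> and against
  the value 0 of the integral of a non-integrable function.
\<close>

definition kl_neighbourhood ::
    "nat \<Rightarrow> 'a set \<Rightarrow> ('a \<Rightarrow> (nat \<Rightarrow> real) \<Rightarrow> real) \<Rightarrow> 'a \<Rightarrow> real \<Rightarrow> 'a set" where
  "kl_neighbourhood D \<Theta> p \<theta>\<^sub>0 \<epsilon> =
     {\<theta>\<in>\<Theta>. (AE x in law D p \<theta>\<^sub>0. 0 < p \<theta> x) \<and>
        integrable (law D p \<theta>\<^sub>0) (\<lambda>x. (ln (p \<theta> x / p \<theta>\<^sub>0 x))\<^sup>2) \<and>
        - (\<integral>x. ln (p \<theta> x / p \<theta>\<^sub>0 x) \<partial>(law D p \<theta>\<^sub>0)) \<le> \<epsilon>\<^sup>2 \<and>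
        (\<integral>x. (ln (p \<theta> x / p \<theta>\<^sub>0 x))\<^sup>2 \<partial>(law D p \<theta>\<^sub>0)) \<le> \<epsilon>\<^sup>2}"

definition rate_conditions ::
    "real \<Rightarrow> nat \<Rightarrow> 'a set \<Rightarrow> ('a \<Rightarrow> (nat \<Rightarrow> real) \<Rightarrow> real) \<Rightarrow> 'a \<Rightarrow> ('a \<Rightarrow> 'a \<Rightarrow> real) \<Rightarrow>
     'a measure \<Rightarrow> nat \<Rightarrow> real \<Rightarrow> 'a set \<Rightarrow> bool" where
  "rate_conditions C D \<Theta> p \<theta>\<^sub>0 d \<pi> l \<epsilon> \<Theta>\<^sub>l \<longleftrightarrow>
     0 < \<epsilon> \<and> \<Theta>\<^sub>l \<in> sets \<pi> \<and>
     packing_number \<epsilon> \<Theta>\<^sub>l d \<noteq> \<infinity> \<and>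
     ln (real (the_enat (packing_number \<epsilon> \<Theta>\<^sub>l d))) \<le> real l * \<epsilon>\<^sup>2 \<and>
     measure \<pi> (\<Theta> - \<Theta>\<^sub>l) \<le> exp (- real l * \<epsilon>\<^sup>2 * (C + 4)) \<and>
     measure \<pi> (kl_neighbourhood D \<Theta> p \<theta>\<^sub>0 \<epsilon>) \<ge> exp (- C * real l * \<epsilon>\<^sup>2)"

text \<open>
  The probability, under the i.i.d. law of the sample, that
  \<open>\<parallel>\<delta>\<^sub>0 - \<pi>\<^sub>l(\<cdot> | X)\<parallel>\<^sub>\<F> \<ge> b\<close>. It is taken as an outer probability because the event may fail to be
  measurable on the null set where the posterior does not integrate \<open>\<F>\<close>.
\<close>

definition deviation_prob ::
    "nat \<Rightarrow> 'a set \<Rightarrow> ('a \<Rightarrow> (nat \<Rightarrow> real) \<Rightarrow> real) \<Rightarrow> 'a \<Rightarrow> ('a \<Rightarrow> real) set \<Rightarrow>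
     'a measure \<Rightarrow> nat \<Rightarrow> real \<Rightarrow> ennreal" where
  "deviation_prob D \<Theta> p \<theta>\<^sub>0 \<F> \<pi> l b =
     (let S = sample_law l (law D p \<theta>\<^sub>0)
      in outer_measure_of S
           {X\<in>space S. ipm \<F> (return (param_borel D \<Theta> p) \<theta>\<^sub>0) (posterior p \<pi> l X) \<ge> ennreal b})"

end

theory Submission
  imports Defs
begin

text \<open>
  Write \<open>\<rho> = \<rho>\<^sub>k(\<cdot>, \<theta>\<^sub>0)\<close> and \<open>x = l\<epsilon>\<^sub>l\<^sup>2\<close>. Elements of the unit ball of the RKHS are 1-Lipschitz for
  \<open>\<rho>\<^sub>k\<close>, so the distance of the posterior to \<open>\<delta>\<^sub>0\<close> is at most the posterior integral of \<open>\<rho>\<close>. Up to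
  probability \<open>1/x\<close> the evidence is at least \<open>e\<^bsup>-(C+2)x\<^esup>\<close> relative to the likelihood at \<open>\<theta>\<^sub>0\<close> (Jensen
  and Chebyshev on the Kullback-Leibler neighbourhood). Tests, which for the Hellinger distance
  come from bounded ratios of square roots of densities, and the sieve condition bound the unnormalised
  posterior mass away from \<open>\<theta>\<^sub>0\<close> by \<open>e\<^bsup>-(C+3)x\<^esup>\<close>, and Markov's inequality bounds the unnormalised
  \<open>W\<close>-th moment of \<open>\<rho>\<close> by \<open>e\<^bsup>x\<^esup>\<integral>\<rho>\<^sup>W d\<pi>\<close>; the failure probabilities add up to \<open>4e\<^bsup>-x\<^esup>\<close>. Hoelder's
  inequality then controls the far part for \<open>W \<ge> 2C + 8\<close>, and on the near part \<open>\<rho>\<close> is at most a multiple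
  of \<open>\<epsilon>\<^sub>l\<^bsup>1/\<gamma>\<^esup>\<close>. When \<open>\<epsilon>\<^sub>l \<rightarrow> 0\<close> only finitely many \<open>l\<close> violate \<open>R\<epsilon>\<^sub>l \<le> r\<close>; these are absorbed into the
  constant because the posterior integral of \<open>\<rho>\<close> is finite almost surely.
\<close>

section \<open>Reproducing kernel Hilbert spaces\<close>

text \<open>Each posterior quantity is estimated before normalisation and relative to the likelihood
  at \<open>\<theta>\<^sub>0\<close>. That likelihood is the density of the sample, so the
  expectation of such a ratio reduces by Fubini to an integral over the prior, and the random
  normaliser enters only through the evidence bound. The exponents are staggered by 1: error of the
  second kind and sieve give C + 4, Markov's inequality keeps C + 3, the evidence costs C + 2, and a
  relative factor \<open>exp (- x)\<close> is left on the far set. \<open>Kt\<close> can be 1 for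
  every \<open>K\<close>, since the exponent of the tests grows like \<kappa> (R - 2)^2 and a small
  \<kappa> is paid for in R. The obstacles lie in measurability: only the sections of
  \<open>k\<close> are assumed measurable, the Euclidean distance is unrelated to the Hellinger
  Borel sets, and the deviation event has only an outer probability. Elements of \<open>H\<close>,
  the function \<rho> and the far set therefore need a measurable substitute or an argument of their
  own.\<close>

context
  fixes \<Theta> :: "'a set" and k H ip
  assumes rkhs: "is_rkhs \<Theta> k H ip"
begin

lemma rkhs_zero: "(\<lambda>x. 0) \<in> H"
  by (rule rkhs[unfolded is_rkhs_def, THEN conjunct2, THEN conjunct1, rule_format])

lemma rkhs_add: "f \<in> H \<Longrightarrow> g \<in> H \<Longrightarrow> (\<lambda>x. f x + g x) \<in> H"
  by (rule rkhs[unfolded is_rkhs_def, THEN conjunct2, THEN conjunct2, THEN conjunct1, rule_format])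

lemma rkhs_scale: "f \<in> H \<Longrightarrow> (\<lambda>x. c * f x) \<in> H"
  by (rule rkhs[unfolded is_rkhs_def, THEN conjunct2, THEN conjunct2, THEN conjunct2, THEN conjunct1, rule_format])

lemma rkhs_ip_commute: "f \<in> H \<Longrightarrow> g \<in> H \<Longrightarrow> ip f g = ip g f"
  by (rule rkhs[unfolded is_rkhs_def, THEN conjunct2, THEN conjunct2, THEN conjunct2, THEN conjunct2, THEN conjunct1, rule_format])

lemma rkhs_ip_add: "f \<in> H \<Longrightarrow> g \<in> H \<Longrightarrow> h \<in> H \<Longrightarrow> ip (\<lambda>x. f x + g x) h = ip f h + ip g h"
  by (rule rkhs[unfolded is_rkhs_def, THEN conjunct2, THEN conjunct2, THEN conjunct2, THEN conjunct2, THEN conjunct2, THEN conjunct1, rule_format])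

lemma rkhs_ip_scale: "f \<in> H \<Longrightarrow> g \<in> H \<Longrightarrow> ip (\<lambda>x. c * f x) g = c * ip f g"
  by (rule rkhs[unfolded is_rkhs_def, THEN conjunct2, THEN conjunct2, THEN conjunct2, THEN conjunct2, THEN conjunct2, THEN conjunct2, THEN conjunct1, rule_format])

lemma rkhs_ip_pos: "f \<in> H \<Longrightarrow> 0 \<le> ip f f \<and> (ip f f = 0 \<longrightarrow> f = (\<lambda>x. 0))"
  by (rule rkhs[unfolded is_rkhs_def, THEN conjunct2, THEN conjunct2, THEN conjunct2, THEN conjunct2, THEN conjunct2, THEN conjunct2, THEN conjunct2, THEN conjunct1, rule_format])

lemma rkhs_section: "\<theta> \<in> \<Theta> \<Longrightarrow> kernel_section \<Theta> k \<theta> \<in> H"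
  by (rule rkhs[unfolded is_rkhs_def, THEN conjunct2, THEN conjunct2, THEN conjunct2, THEN conjunct2, THEN conjunct2, THEN conjunct2, THEN conjunct2, THEN conjunct2, THEN conjunct2, THEN conjunct1, rule_format])

lemma rkhs_reproducing: "\<theta> \<in> \<Theta> \<Longrightarrow> f \<in> H \<Longrightarrow> ip f (kernel_section \<Theta> k \<theta>) = f \<theta>"
  by (rule rkhs[unfolded is_rkhs_def, THEN conjunct2, THEN conjunct2, THEN conjunct2, THEN conjunct2, THEN conjunct2, THEN conjunct2, THEN conjunct2, THEN conjunct2, THEN conjunct2, THEN conjunct2, rule_format])

lemma rkhs_ip_nonneg: "f \<in> H \<Longrightarrow> 0 \<le> ip f f"
  using rkhs_ip_pos by blast

lemma rkhs_ip_eq_0: "f \<in> H \<Longrightarrow> ip f f = 0 \<Longrightarrow> f = (\<lambda>x. 0)"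
  using rkhs_ip_pos by blast

lemma rkhs_diff:
  assumes "f \<in> H" "g \<in> H"
  shows "(\<lambda>x. f x - g x) \<in> H"
  using rkhs_add[OF assms(1) rkhs_scale[OF assms(2), of "-1"]] by simp

lemma rkhs_ip_diff:
  assumes "f \<in> H" "g \<in> H" "h \<in> H"
  shows "ip (\<lambda>x. f x - g x) h = ip f h - ip g h"
  using rkhs_ip_add[OF assms(1) rkhs_scale[OF assms(2), of "-1"] assms(3)]
    rkhs_ip_scale[OF assms(2,3), of "-1"] by simp

text \<open>As a quadratic in \<open>c\<close> this drives both the Cauchy-Schwarz inequality and
  the variational argument for measurability.\<close>

lemma rkhs_ip_square_add:
  assumes f: "f \<in> H" and g: "g \<in> H"
  shows "ip (\<lambda>x. f x + c * g x) (\<lambda>x. f x + c * g x) = ip f f + 2 * c * ip f g + c\<^sup>2 * ip g g"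
proof -
  let ?s = "\<lambda>x. f x + c * g x"
  have cg: "(\<lambda>x. c * g x) \<in> H" and s: "?s \<in> H"
    using f g rkhs_scale rkhs_add by auto
  have "ip ?s ?s = ip f ?s + c * ip g ?s"
    using rkhs_ip_add[OF f cg s] rkhs_ip_scale[OF g s, of c] by simp
  moreover have "ip f ?s = ip f f + c * ip g f"
    using rkhs_ip_commute[OF f s] rkhs_ip_add[OF f cg f] rkhs_ip_scale[OF g f, of c] by simp
  moreover have "ip g ?s = ip f g + c * ip g g"
    using rkhs_ip_commute[OF g s] rkhs_ip_add[OF f cg g] rkhs_ip_scale[OF g g, of c] by simp
  ultimately show ?thesis
    using rkhs_ip_commute[OF f g] by (simp add: algebra_simps power2_eq_square)
qed

lemma kernel_distance_nonneg:
  assumes "s \<in> \<Theta>" "t \<in> \<Theta>"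
  shows "0 \<le> kernel_distance \<Theta> k ip s t"
  unfolding kernel_distance_def ip_norm_def
  by (intro real_sqrt_ge_zero rkhs_ip_nonneg rkhs_diff rkhs_section assms)

lemma rkhs_Cauchy_Schwarz:
  assumes f: "f \<in> H" and g: "g \<in> H"
  shows "\<bar>ip f g\<bar> \<le> ip_norm ip f * ip_norm ip g"
proof -
  have "(ip f g)\<^sup>2 \<le> ip f f * ip g g"
  proof (cases "ip g g = 0")
    case True
    then have "g = (\<lambda>x. 0)"
      using rkhs_ip_eq_0[OF g] by simp
    then have "ip g f = 0"
      using rkhs_ip_scale[OF g f, of 0] by simp
    then show ?thesis
      using True rkhs_ip_commute[OF f g] by simp
  next
    case False
    then have pos: "ip g g > 0"
      using rkhs_ip_nonneg[OF g] by simp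
    \<comment> \<open>The minimiser of the quadratic in \<open>c\<close>; the minimum is the
      Cauchy-Schwarz defect divided by \<open>ip g g\<close>.\<close>
    let ?c = "- ip f g / ip g g"
    have "0 \<le> ip (\<lambda>x. f x + ?c * g x) (\<lambda>x. f x + ?c * g x)"
      by (intro rkhs_ip_nonneg rkhs_add rkhs_scale f g)
    also have "\<dots> = ip f f - (ip f g)\<^sup>2 / ip g g"
      unfolding rkhs_ip_square_add[OF f g] using pos by (simp add: field_simps power2_eq_square)
    finally show ?thesis
      using pos by (simp add: field_simps)
  qed
  then have "sqrt ((ip f g)\<^sup>2) \<le> sqrt (ip f f * ip g g)"
    by (rule real_sqrt_le_mono)
  then show ?thesis
    by (simp add: ip_norm_def real_sqrt_mult)
qed

text \<open>The reproducing property writes \<open>f s - f t\<close> as the inner product of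
  \<open>f\<close> with the difference of two sections, whose norm is by definition the kernel
  distance.\<close>

lemma rkhs_Lipschitz:
  assumes f: "f \<in> H" and s: "s \<in> \<Theta>" and t: "t \<in> \<Theta>"
  shows "\<bar>f s - f t\<bar> \<le> ip_norm ip f * kernel_distance \<Theta> k ip s t"
proof -
  let ?d = "\<lambda>x. kernel_section \<Theta> k s x - kernel_section \<Theta> k t x"
  have d: "?d \<in> H"
    by (intro rkhs_diff rkhs_section s t)
  have "ip f ?d = ip ?d f"
    using rkhs_ip_commute f d by blast
  also have "\<dots> = ip (kernel_section \<Theta> k s) f - ip (kernel_section \<Theta> k t) f"
    by (intro rkhs_ip_diff rkhs_section s t f)
  also have "\<dots> = f s - f t"
    using rkhs_ip_commute[OF f rkhs_section] rkhs_reproducing[OF _ f] s t by simp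
  finally show ?thesis
    using rkhs_Cauchy_Schwarz[OF f d] by (simp add: kernel_distance_def)
qed

text \<open>
  A sequence of measurable elements of \<open>H\<close> whose distances to \<open>f\<close> approach the infimum is
  asymptotically orthogonal to every section \<open>k(\<cdot>, \<theta>)\<close> after subtraction of \<open>f\<close>, hence
  converges to \<open>f\<close> pointwise.
\<close>

lemma rkhs_measurable:
  assumes f: "f \<in> H" and B: "space B = \<Theta>"
    and sections: "\<And>\<theta>. \<theta> \<in> \<Theta> \<Longrightarrow> (\<lambda>x. k x \<theta>) \<in> borel_measurable B"
  shows "f \<in> borel_measurable B"
proof -
  define V where "V = {g\<in>H. g \<in> borel_measurable B}"
  define q where "q g = ip (\<lambda>x. f x - g x) (\<lambda>x. f x - g x)" for g
  define m where "m = Inf (q ` V)"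
  have "(\<lambda>x. 0) \<in> V"
    by (simp add: V_def rkhs_zero)
  then have ne: "q ` V \<noteq> {}"
    by blast
  have bdd: "bdd_below (q ` V)"
    by (rule bdd_belowI[of _ 0]) (auto simp: q_def V_def intro!: rkhs_ip_nonneg rkhs_diff f)
  have "\<exists>v\<in>V. q v < m + 1 / real (Suc n)" for n
    using cInf_lessD[OF ne, of "m + 1 / real (Suc n)"] unfolding m_def by auto
  then obtain v where v: "\<And>n. v n \<in> V" and qv: "\<And>n. q (v n) < m + 1 / real (Suc n)"
    by metis
  have lim: "(\<lambda>n. v n \<theta>) \<longlonglongrightarrow> f \<theta>" if \<theta>: "\<theta> \<in> \<Theta>" for \<theta>
  proof -
    let ?s = "kernel_section \<Theta> k \<theta>"
    let ?K = "ip ?s ?s"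
    have s: "?s \<in> H"
      by (rule rkhs_section[OF \<theta>])
    have K: "0 \<le> ?K"
      by (rule rkhs_ip_nonneg[OF s])
    have "?s \<in> borel_measurable B"
      using sections[OF \<theta>] unfolding kernel_section_def
      by (rule measurable_cong[THEN iffD1, rotated]) (simp add: B)
    then have sV: "?s \<in> V"
      using s by (simp add: V_def)
    have est: "(f \<theta> - v n \<theta>)\<^sup>2 \<le> (?K + 1) * (1 / real (Suc n))" for n
    proof -
      define e where "e = f \<theta> - v n \<theta>"
      \<comment> \<open>A near-optimal step along the section. The exact minimiser
        \<open>e / ?K\<close> would divide by zero for a vanishing section; the added 1 only worsens
        the constant.\<close>
      define c where "c = e / (?K + 1)"
      have vn: "v n \<in> H"
        using v V_def by auto
      have "(\<lambda>x. v n x + c * ?s x) \<in> V"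
        using v[of n] sV by (auto simp: V_def intro!: rkhs_add rkhs_scale)
      then have "m \<le> q (\<lambda>x. v n x + c * ?s x)"
        unfolding m_def by (intro cInf_lower bdd imageI)
      also have "(\<lambda>x. f x - (v n x + c * ?s x)) = (\<lambda>x. (f x - v n x) + (- c) * ?s x)"
        by auto
      then have "q (\<lambda>x. v n x + c * ?s x) = q (v n) + 2 * (- c) * ip (\<lambda>x. f x - v n x) ?s + (- c)\<^sup>2 * ?K"
        unfolding q_def using rkhs_ip_square_add[OF rkhs_diff[OF f vn] s, of "- c"] by simp
      also have "ip (\<lambda>x. f x - v n x) ?s = e"
        unfolding e_def by (rule rkhs_reproducing[OF \<theta> rkhs_diff[OF f vn]])
      finally have "2 * c * e - c\<^sup>2 * ?K \<le> 1 / real (Suc n)"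
        using qv[of n] by simp
      moreover have "c * e \<le> 2 * c * e - c\<^sup>2 * ?K"
      proof -
        have "c\<^sup>2 * ?K \<le> c\<^sup>2 * (?K + 1)"
          by (simp add: algebra_simps)
        also have "\<dots> = c * e"
          unfolding c_def using K by (simp add: power2_eq_square)
        finally show ?thesis by simp
      qed
      ultimately have "e\<^sup>2 / (?K + 1) \<le> 1 / real (Suc n)"
        by (simp add: c_def power2_eq_square)
      then show ?thesis
        using K by (simp add: e_def field_simps)
    qed
    have lim0: "(\<lambda>n. (?K + 1) * (1 / real (Suc n))) \<longlonglongrightarrow> 0"
      using tendsto_mult_right_zero[OF LIMSEQ_Suc[OF lim_1_over_n], of "?K + 1"] by simp
    have "(\<lambda>n. (f \<theta> - v n \<theta>)\<^sup>2) \<longlonglongrightarrow> 0"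
      by (rule tendsto_sandwich[OF _ _ tendsto_const lim0]) (use est in \<open>simp_all del: of_nat_Suc\<close>)
    then have "(\<lambda>n. sqrt ((f \<theta> - v n \<theta>)\<^sup>2)) \<longlonglongrightarrow> sqrt 0"
      by (rule tendsto_real_sqrt)
    then have "(\<lambda>n. f \<theta> - v n \<theta>) \<longlonglongrightarrow> 0"
      by (simp add: tendsto_rabs_zero_iff)
    then have "(\<lambda>n. f \<theta> - (f \<theta> - v n \<theta>)) \<longlonglongrightarrow> f \<theta> - 0"
      by (intro tendsto_diff tendsto_const)
    then show ?thesis by simp
  qed
  show ?thesis
    by (rule borel_measurable_LIMSEQ_real[where u = v]) (use v lim B in \<open>auto simp: V_def\<close>)
qed

lemma ipm_return_le:
  assumes B: "space B = \<Theta>"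
    and sections: "\<And>\<theta>. \<theta> \<in> \<Theta> \<Longrightarrow> (\<lambda>x. k x \<theta>) \<in> borel_measurable B"
    and t: "t \<in> \<Theta>" and Q: "prob_space Q" "sets Q = sets B"
  shows "ipm (unit_ball H ip) (return B t) Q \<le> (\<integral>\<^sup>+\<theta>. ennreal (kernel_distance \<Theta> k ip \<theta> t) \<partial>Q)"
    (is "_ \<le> ?I")
  unfolding ipm_def
proof (rule SUP_least)
  fix f assume "f \<in> unit_ball H ip"
  then have f: "f \<in> H" and nf: "ip_norm ip f \<le> 1"
    by (auto simp: unit_ball_def)
  interpret Q: prob_space Q by fact
  have spQ: "space Q = \<Theta>"
    using Q(2) B sets_eq_imp_space_eq by blast
  have mB: "f \<in> borel_measurable B"
    by (rule rkhs_measurable[OF f B sections])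
  then have [measurable]: "f \<in> borel_measurable Q"
    by (simp cong: measurable_cong_sets add: Q(2))
  have le: "(\<integral>\<^sup>+\<theta>. ennreal (norm (f t - f \<theta>)) \<partial>Q) \<le> ?I"
  proof (rule nn_integral_mono)
    fix \<theta> assume \<theta>: "\<theta> \<in> space Q"
    have "norm (f t - f \<theta>) = \<bar>f \<theta> - f t\<bar>"
      by simp
    also have "\<dots> \<le> ip_norm ip f * kernel_distance \<Theta> k ip \<theta> t"
      using rkhs_Lipschitz[OF f _ t] \<theta> spQ by auto
    also have "\<dots> \<le> 1 * kernel_distance \<Theta> k ip \<theta> t"
      using \<theta> spQ t nf by (intro mult_right_mono kernel_distance_nonneg) auto
    finally show "ennreal (norm (f t - f \<theta>)) \<le> ennreal (kernel_distance \<Theta> k ip \<theta> t)"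
      by (simp add: ennreal_leI)
  qed
  show "ennreal \<bar>(\<integral>\<theta>. f \<theta> \<partial>return B t) - (\<integral>\<theta>. f \<theta> \<partial>Q)\<bar> \<le> ?I"
  \<comment> \<open>A finite right side makes \<open>f\<close> integrable under \<open>Q\<close>;
    without this the Bochner integral would take its default value 0 and the difference could not be
    put under one integral.\<close>
  proof (cases "?I = \<infinity>")
    case False
    have int: "integrable Q (\<lambda>\<theta>. f t - f \<theta>)"
      using le False by (intro integrableI_bounded) (auto simp: less_top[symmetric] top_unique)
    have "integrable Q (\<lambda>\<theta>. f t - (f t - f \<theta>))"
      by (rule Bochner_Integration.integrable_diff[OF _ int]) simp
    then have "integrable Q f" by simp
    then have "(\<integral>\<theta>. f t - f \<theta> \<partial>Q) = f t - (\<integral>\<theta>. f \<theta> \<partial>Q)"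
      by (simp add: Q.prob_space)
    moreover have "(\<integral>\<theta>. f \<theta> \<partial>return B t) = f t"
      by (rule integral_return) (use B t mB in auto)
    ultimately show ?thesis
      using integral_norm_bound_ennreal[OF int] le by simp
  qed simp
qed

end

section \<open>Laws of samples\<close>

lemma sets_sample_law_density [simp]: "sets (sample_law n (density M f)) = sets (sample_law n M)"
  unfolding sample_law_def by (intro sets_PiM_cong) auto

lemma space_sample_law_density [simp]: "space (sample_law n (density M f)) = space (sample_law n M)"
  by (rule sets_eq_imp_space_eq) simp

lemma product_sigma_finite_const:
  "sigma_finite_measure M \<Longrightarrow> product_sigma_finite (\<lambda>_. M)"
  by (simp add: product_sigma_finite_def)

lemma sigma_finite_sample_law:
  assumes "sigma_finite_measure M"
  shows "sigma_finite_measure (sample_law n M)"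
  unfolding sample_law_def
  by (intro product_sigma_finite.sigma_finite product_sigma_finite_const assms) simp

lemma prob_space_sample_law: "prob_space P \<Longrightarrow> prob_space (sample_law n P)"
  unfolding sample_law_def by (rule prob_space_PiM)

lemma measurable_sample_coordinate [measurable]:
  "i < n \<Longrightarrow> (\<lambda>X. X i) \<in> measurable (sample_law n M) M"
  unfolding sample_law_def by simp

lemma space_sample_law_coordinate: "X \<in> space (sample_law n M) \<Longrightarrow> i < n \<Longrightarrow> X i \<in> space M"
  by (auto simp: sample_law_def space_PiM)

text \<open>Puts the sample laws of all parameters over one dominating measure, which is what makes
  Fubini between parameter and sample possible. Both sides agree on rectangles.\<close>

lemma sample_law_density:
  assumes M: "sigma_finite_measure M" and f [measurable]: "f \<in> borel_measurable M"
    and nn: "\<And>x. x \<in> space M \<Longrightarrow> 0 \<le> f x"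
    and P: "prob_space (density M (\<lambda>x. ennreal (f x)))"
  shows "sample_law n (density M (\<lambda>x. ennreal (f x))) =
    density (sample_law n M) (\<lambda>X. ennreal (\<Prod>i<n. f (X i)))"
proof -
  let ?P = "density M (\<lambda>x. ennreal (f x))"
  interpret M: product_sigma_finite "\<lambda>_ :: nat. M"
    by (rule product_sigma_finite_const[OF M])
  interpret P: product_sigma_finite "\<lambda>_ :: nat. ?P"
    by (rule product_sigma_finite_const[OF prob_space_imp_sigma_finite[OF P]])
  have "density (sample_law n M) (\<lambda>X. ennreal (\<Prod>i<n. f (X i))) = (\<Pi>\<^sub>M i\<in>{..<n}. ?P)"
  proof (rule P.PiM_eqI)
    show "sets (density (sample_law n M) (\<lambda>X. ennreal (\<Prod>i<n. f (X i)))) = sets (\<Pi>\<^sub>M i\<in>{..<n}. ?P)"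
      unfolding sets_density sample_law_def by (intro sets_PiM_cong) auto
  next
    fix A assume "\<And>i. i \<in> {..<n} \<Longrightarrow> A i \<in> sets ?P"
    then have A [measurable]: "\<And>i. i \<in> {..<n} \<Longrightarrow> A i \<in> sets M"
      by simp
    have PA: "Pi\<^sub>E {..<n} A \<in> sets (sample_law n M)"
      unfolding sample_law_def by (intro sets_PiM_I_finite A) auto
    have "emeasure (density (sample_law n M) (\<lambda>X. ennreal (\<Prod>i<n. f (X i)))) (Pi\<^sub>E {..<n} A) =
        (\<integral>\<^sup>+X. ennreal (\<Prod>i<n. f (X i)) * indicator (Pi\<^sub>E {..<n} A) X \<partial>sample_law n M)"
      by (intro emeasure_density PA) measurable
    also have "\<dots> = (\<integral>\<^sup>+X. (\<Prod>i<n. ennreal (f (X i)) * indicator (A i) (X i)) \<partial>sample_law n M)"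
    proof (rule nn_integral_cong)
      fix X assume X: "X \<in> space (sample_law n M)"
      \<comment> \<open>Membership in a rectangle also demands extensionality; it holds on the
        product space, and only there does the indicator factor.\<close>
      then have ext: "X \<in> extensional {..<n}"
        by (simp add: sample_law_def space_PiM PiE_def)
      have "indicator (Pi\<^sub>E {..<n} A) X = (\<Prod>i<n. indicator (A i) (X i) :: ennreal)"
      proof (cases "X \<in> Pi\<^sub>E {..<n} A")
        case True
        then have "\<And>i. i < n \<Longrightarrow> X i \<in> A i"
          by (auto simp: PiE_iff)
        then show ?thesis
          using True by simp
      next
        case False
        with ext obtain i where "i < n" "X i \<notin> A i"
          by (auto simp: PiE_iff)
        then have "(\<Prod>i<n. indicator (A i) (X i) :: ennreal) = 0"
          by (intro prod_zero bexI[of _ i]) auto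
        then show ?thesis
          using False by simp
      qed
      moreover have "ennreal (\<Prod>i<n. f (X i)) = (\<Prod>i<n. ennreal (f (X i)))"
        using X nn by (intro prod_ennreal[symmetric]) (auto dest: space_sample_law_coordinate)
      ultimately show "ennreal (\<Prod>i<n. f (X i)) * indicator (Pi\<^sub>E {..<n} A) X =
          (\<Prod>i<n. ennreal (f (X i)) * indicator (A i) (X i))"
        by (simp add: prod.distrib)
    qed
    also have "\<dots> = (\<Prod>i<n. \<integral>\<^sup>+x. ennreal (f x) * indicator (A i) x \<partial>M)"
      unfolding sample_law_def using A by (intro M.product_nn_integral_prod) auto
    also have "\<dots> = (\<Prod>i<n. emeasure ?P (A i))"
      using A by (intro prod.cong) (auto simp: emeasure_density)
    finally show "emeasure (density (sample_law n M) (\<lambda>X. ennreal (\<Prod>i<n. f (X i)))) (Pi\<^sub>E {..<n} A) =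
        (\<Prod>i\<in>{..<n}. emeasure ?P (A i))" .
  qed simp
  then show ?thesis
    by (simp add: sample_law_def)
qed

lemma sample_law_sum_second_moment:
  assumes P: "prob_space P" and g [measurable]: "g \<in> borel_measurable P"
    and g2: "integrable P (\<lambda>x. (g x)\<^sup>2)" and g0: "(\<integral>x. g x \<partial>P) = (0::real)"
  shows "integrable (sample_law n P) (\<lambda>X. (\<Sum>i<n. g (X i))\<^sup>2)"
    and "(\<integral>X. (\<Sum>i<n. g (X i))\<^sup>2 \<partial>sample_law n P) = real n * (\<integral>x. (g x)\<^sup>2 \<partial>P)"
proof -
  interpret P: prob_space P by fact
  interpret PP: product_sigma_finite "\<lambda>_ :: nat. P"
    by (rule product_sigma_finite_const[OF prob_space_imp_sigma_finite[OF P]])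
  have g1: "integrable P g"
    by (rule P.square_integrable_imp_integrable[OF g g2])
  have *: "integrable (sample_law n P) (\<lambda>X. g (X i) * g (X j)) \<and>
      (\<integral>X. g (X i) * g (X j) \<partial>sample_law n P) = (if i = j then \<integral>x. (g x)\<^sup>2 \<partial>P else 0)"
    if i: "i < n" and j: "j < n" for i j
  proof -
    \<comment> \<open>Padding with factors 1 turns \<open>g (X i) * g (X j)\<close> into a product
      over all coordinates, so one product formula covers both the diagonal and the mixed
      terms.\<close>
    define h where "h m x = (if m = i then g x else 1) * (if m = j then g x else 1)" for m x
    have eq: "(\<lambda>X. g (X i) * g (X j)) = (\<lambda>X. \<Prod>m<n. h m (X m))"
      using i j by (simp add: h_def prod.distrib prod.delta fun_eq_iff)
    have int: "integrable P (h m)" for m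
      using g1 g2 by (cases "m = i"; cases "m = j") (simp_all add: h_def[abs_def] power2_eq_square)
    have "(\<integral>X. g (X i) * g (X j) \<partial>sample_law n P) = (\<Prod>m<n. \<integral>x. h m x \<partial>P)"
      unfolding eq sample_law_def by (intro PP.product_integral_prod int) simp
    also have "\<dots> = (if i = j then \<integral>x. (g x)\<^sup>2 \<partial>P else 0)"
    proof (cases "i = j")
      case True
      then have "(\<Prod>m<n. \<integral>x. h m x \<partial>P) = (\<Prod>m<n. if m = i then \<integral>x. (g x)\<^sup>2 \<partial>P else 1)"
        by (intro prod.cong) (auto simp: h_def P.prob_space power2_eq_square)
      then show ?thesis
        using True i by (simp add: prod.delta)
    next
      case False
      then have "(\<integral>x. h i x \<partial>P) = 0"
        by (simp add: h_def g0)
      then show ?thesis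
        using False i by (auto simp: prod_zero_iff)
    qed
    finally show ?thesis
      unfolding eq sample_law_def by (auto intro!: PP.product_integrable_prod int)
  qed
  have eq: "(\<lambda>X. (\<Sum>i<n. g (X i))\<^sup>2) = (\<lambda>X. \<Sum>i<n. \<Sum>j<n. g (X i) * g (X j))"
    by (simp add: power2_eq_square sum_product)
  show "integrable (sample_law n P) (\<lambda>X. (\<Sum>i<n. g (X i))\<^sup>2)"
    unfolding eq using * by (intro Bochner_Integration.integrable_sum) auto
  have "(\<integral>X. (\<Sum>i<n. g (X i))\<^sup>2 \<partial>sample_law n P) =
      (\<Sum>i<n. \<Sum>j<n. \<integral>X. g (X i) * g (X j) \<partial>sample_law n P)"
    unfolding eq using *
    by (subst Bochner_Integration.integral_sum)
      (auto intro!: Bochner_Integration.integrable_sum sum.cong Bochner_Integration.integral_sum)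
  also have "\<dots> = (\<Sum>i<n. \<integral>x. (g x)\<^sup>2 \<partial>P)"
    using * by (intro sum.cong) (auto simp: sum.delta)
  finally show "(\<integral>X. (\<Sum>i<n. g (X i))\<^sup>2 \<partial>sample_law n P) = real n * (\<integral>x. (g x)\<^sup>2 \<partial>P)"
    by simp
qed

text \<open>The variance is replaced by the raw second moment because that is what the
  Kullback-Leibler neighbourhood controls.\<close>

lemma sample_law_Chebyshev:
  assumes P: "prob_space P" and f [measurable]: "f \<in> borel_measurable P"
    and f2: "integrable P (\<lambda>x. (f x)\<^sup>2)" and a: "a > 0"
  shows "measure (sample_law n P)
      {X\<in>space (sample_law n P). a \<le> \<bar>\<Sum>i<n. f (X i) - (\<integral>x. f x \<partial>P)\<bar>}
    \<le> real n * (\<integral>x. (f x)\<^sup>2 \<partial>P) / a\<^sup>2"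
proof -
  interpret P: prob_space P by fact
  interpret S: prob_space "sample_law n P"
    by (rule prob_space_sample_law[OF P])
  let ?\<mu> = "\<integral>x. f x \<partial>P"
  have f1: "integrable P f"
    by (rule P.square_integrable_imp_integrable[OF f f2])
  have g2: "integrable P (\<lambda>x. (f x - ?\<mu>)\<^sup>2)"
    using f1 f2 by (simp add: power2_diff)
  have g0: "(\<integral>x. f x - ?\<mu> \<partial>P) = 0"
    using f1 by (simp add: P.prob_space)
  note sm = sample_law_sum_second_moment[OF P _ g2 g0, of n]
  have "measure (sample_law n P)
      {X\<in>space (sample_law n P). a \<le> \<bar>\<Sum>i<n. f (X i) - ?\<mu>\<bar>} \<le>
      (\<integral>X. (\<Sum>i<n. f (X i) - ?\<mu>)\<^sup>2 \<partial>sample_law n P) / a\<^sup>2"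
    by (rule S.second_moment_method[OF _ sm(1) a]) measurable
  also have "\<dots> = real n * (\<integral>x. (f x - ?\<mu>)\<^sup>2 \<partial>P) / a\<^sup>2"
    using sm(2) by simp
  also have "\<dots> \<le> real n * (\<integral>x. (f x)\<^sup>2 \<partial>P) / a\<^sup>2"
    using P.variance_eq[OF f1 f2] by (intro divide_right_mono mult_left_mono) auto
  finally show ?thesis .
qed

section \<open>Tests\<close>

text \<open>The common form of (T) and of the Hellinger tests. The relative radius \<open>c\<close>
  is a parameter because (T) supplies 1/2 and the Hellinger construction only 1/10.\<close>

definition separation_tests ::
    "real \<Rightarrow> real \<Rightarrow> (nat \<Rightarrow> real) measure \<Rightarrow> 'a set \<Rightarrow> ('a \<Rightarrow> (nat \<Rightarrow> real) \<Rightarrow> real) \<Rightarrow>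
     ('a \<Rightarrow> 'a \<Rightarrow> real) \<Rightarrow> bool" where
  "separation_tests \<kappa> c M \<Theta> p d \<longleftrightarrow>
     (\<forall>n. \<forall>s\<in>\<Theta>. \<forall>t\<in>\<Theta>. \<exists>\<phi>\<in>borel_measurable (sample_law n M).
        (\<forall>X\<in>space (sample_law n M). 0 \<le> \<phi> X \<and> \<phi> X \<le> 1) \<and>
        (\<integral>X. \<phi> X \<partial>(sample_law n (density M (\<lambda>x. ennreal (p s x)))))
          \<le> exp (- \<kappa> * real n * (d s t)\<^sup>2) \<and>
        (\<forall>u\<in>\<Theta>. d u t < c * d s t \<longrightarrow>
           (\<integral>X. 1 - \<phi> X \<partial>(sample_law n (density M (\<lambda>x. ennreal (p u x)))))
             \<le> exp (- \<kappa> * real n * (d s t)\<^sup>2)))"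

lemma separation_tests_mono:
  assumes tests: "separation_tests \<kappa>' c M \<Theta> p d" and \<kappa>: "\<kappa> \<le> \<kappa>'"
  shows "separation_tests \<kappa> c M \<Theta> p d"
  unfolding separation_tests_def
proof (intro allI ballI)
  fix n s t assume "s \<in> \<Theta>" "t \<in> \<Theta>"
  then obtain \<phi> where \<phi>: "\<phi> \<in> borel_measurable (sample_law n M)"
    "\<forall>X\<in>space (sample_law n M). 0 \<le> \<phi> X \<and> \<phi> X \<le> 1"
    "(\<integral>X. \<phi> X \<partial>(sample_law n (density M (\<lambda>x. ennreal (p s x))))) \<le> exp (- \<kappa>' * real n * (d s t)\<^sup>2)"
    "\<And>u. u \<in> \<Theta> \<Longrightarrow> d u t < c * d s t \<Longrightarrow>
       (\<integral>X. 1 - \<phi> X \<partial>(sample_law n (density M (\<lambda>x. ennreal (p u x))))) \<le> exp (- \<kappa>' * real n * (d s t)\<^sup>2)"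
    using tests unfolding separation_tests_def by metis
  have "\<kappa> * (real n * (d s t)\<^sup>2) \<le> \<kappa>' * (real n * (d s t)\<^sup>2)"
    by (intro mult_right_mono \<kappa>) auto
  then have le: "exp (- \<kappa>' * real n * (d s t)\<^sup>2) \<le> exp (- \<kappa> * real n * (d s t)\<^sup>2)"
    by (simp add: mult.assoc)
  show "\<exists>\<phi>\<in>borel_measurable (sample_law n M).
        (\<forall>X\<in>space (sample_law n M). 0 \<le> \<phi> X \<and> \<phi> X \<le> 1) \<and>
        (\<integral>X. \<phi> X \<partial>(sample_law n (density M (\<lambda>x. ennreal (p s x)))))
          \<le> exp (- \<kappa> * real n * (d s t)\<^sup>2) \<and>
        (\<forall>u\<in>\<Theta>. d u t < c * d s t \<longrightarrow>
           (\<integral>X. 1 - \<phi> X \<partial>(sample_law n (density M (\<lambda>x. ennreal (p u x)))))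
             \<le> exp (- \<kappa> * real n * (d s t)\<^sup>2))"
    by (intro bexI[of _ \<phi>] conjI ballI impI)
      (use \<phi>(1-3) order.trans[OF \<phi>(4) le] order.trans[OF \<phi>(3) le] in auto)
qed

lemma test_condition_imp_separation_tests:
  assumes tc: "test_condition K D \<Theta> p d" and c: "c \<le> 1/2" and d: "\<And>s t. 0 \<le> d s t"
  shows "separation_tests K c (leb D) \<Theta> p d"
proof -
  have ball: "d u t < d s t / 2" if "d u t < c * d s t" for s t u
    using that mult_right_mono[OF c d[of s t]] by simp
  show ?thesis
    using tc ball unfolding separation_tests_def test_condition_def law_def Bex_def by meson
qed

section \<open>Hellinger tests from bounded likelihood ratios\<close>

lemma integrable_sqrt_diff_square:
  assumes [measurable]: "f \<in> borel_measurable M" "g \<in> borel_measurable M"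
    and "integrable M f" "integrable M g"
    and "\<And>x. x \<in> space M \<Longrightarrow> 0 \<le> f x" "\<And>x. x \<in> space M \<Longrightarrow> 0 \<le> g x"
  shows "integrable M (\<lambda>x. (sqrt (f x) - sqrt (g x))\<^sup>2 :: real)"
proof (rule Bochner_Integration.integrable_bound)
  show "integrable M (\<lambda>x. f x + g x)"
    using assms by simp
  show "AE x in M. norm ((sqrt (f x) - sqrt (g x))\<^sup>2) \<le> norm (f x + g x)"
  proof (rule AE_I2)
    fix x assume "x \<in> space M"
    then have "0 \<le> f x" "0 \<le> g x"
      using assms by auto
    then have "(sqrt (f x) - sqrt (g x))\<^sup>2 \<le> f x + g x"
      by (simp add: power2_diff)
    then show "norm ((sqrt (f x) - sqrt (g x))\<^sup>2) \<le> norm (f x + g x)"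
      by simp
  qed
qed measurable

text \<open>The reciprocal identity exchanges the two hypotheses, and the bound 2 gives
  integrability under every density of the model. At \<open>a = b = 0\<close> division by zero makes
  both factors 1, so no exceptional set arises.\<close>

lemma likelihood_ratio:
  fixes a b :: real
  assumes "0 \<le> a" "0 \<le> b"
  shows "(1 + (b - a) / (2 * a + b)) * (1 + (a - b) / (2 * b + a)) = 1" (is ?inv)
    and "0 < 1 + (b - a) / (2 * a + b)" (is ?pos)
    and "1 + (b - a) / (2 * a + b) \<le> 2" (is ?le)
proof -
  have "?inv \<and> ?pos \<and> ?le"
  proof (cases "a = 0 \<and> b = 0")
    case False
    then have pos: "2 * a + b > 0" "2 * b + a > 0"
      using assms by auto
    then have "1 + (b - a) / (2 * a + b) = (2 * b + a) / (2 * a + b)"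
      "1 + (a - b) / (2 * b + a) = (2 * a + b) / (2 * b + a)"
      by (simp_all add: field_simps)
    then show ?thesis
      using pos assms by (simp add: divide_le_eq)
  qed simp
  then show ?inv ?pos ?le
    by blast+
qed

text \<open>After clearing denominators the sides differ by \<open>a * (b - a)\<^sup>2\<close>. For
  roots of two densities the integral of \<open>a * (b - a)\<close> is minus the squared Hellinger
  distance, which is the gain of the test.\<close>

lemma likelihood_ratio_bound:
  fixes a b :: real
  assumes "0 \<le> a" "0 \<le> b"
  shows "a\<^sup>2 * ((b - a) / (2 * a + b)) \<le> a * (b - a) / 3"
proof (cases "2 * a + b = 0")
  case True
  then show ?thesis using assms by (auto simp: add_nonneg_eq_0_iff)
next
  case False
  then have pos: "2 * a + b > 0" using assms by auto
  have "a\<^sup>2 * (b - a) * 3 \<le> a * (b - a) * (2 * a + b)"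
  proof -
    have "a * (b - a) * (2 * a + b) - a\<^sup>2 * (b - a) * 3 = a * (b - a)\<^sup>2"
      by (simp add: algebra_simps power2_eq_square)
    moreover have "0 \<le> a * (b - a)\<^sup>2"
      using assms by simp
    ultimately show ?thesis by linarith
  qed
  then show ?thesis using pos by (simp add: field_simps)
qed

text \<open>The sample may follow a density near the first hypothesis, with root \<open>t\<close>
  instead of \<open>a\<close>. In the expansion about \<open>a\<close> the linear term is controlled
  because 2a times the quotient is at most \<open>\<bar>b - a\<bar>\<close> in modulus, the
  quadratic one because the quotient is at most 1.\<close>

lemma likelihood_ratio_bound_perturbed:
  fixes a b t :: real
  assumes a: "0 \<le> a" and b: "0 \<le> b"
  shows "t\<^sup>2 * ((b - a) / (2 * a + b)) \<le> a * (b - a) / 3 + (b - a)\<^sup>2 / 20 + 6 * (t - a)\<^sup>2"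
proof -
  define q where "q = (b - a) / (2 * a + b)"
  define u where "u = t - a"
  have "\<bar>b - a\<bar> \<le> 1 * \<bar>2 * a + b\<bar>"
    using a b by auto
  then have q1: "\<bar>q\<bar> \<le> 1"
    unfolding q_def abs_divide by (cases "2 * a + b = 0") (simp_all add: divide_le_eq_1)
  have q2: "\<bar>2 * a * q\<bar> \<le> \<bar>b - a\<bar>"
  proof (cases "2 * a + b = 0")
    case False
    then have "\<bar>2 * a * q\<bar> = 2 * a / (2 * a + b) * \<bar>b - a\<bar>"
      unfolding q_def using a b by (simp add: abs_mult abs_divide)
    also have "\<dots> \<le> 1 * \<bar>b - a\<bar>"
      using False a b by (intro mult_right_mono) (auto simp: divide_le_eq_1)
    finally show ?thesis by simp
  qed (simp add: q_def)
  have "t\<^sup>2 * q = a\<^sup>2 * q + (2 * a * q) * u + u\<^sup>2 * q"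
    by (simp add: u_def algebra_simps power2_eq_square)
  moreover have "a\<^sup>2 * q \<le> a * (b - a) / 3"
    unfolding q_def by (rule likelihood_ratio_bound[OF a b])
  moreover have "(2 * a * q) * u \<le> (b - a)\<^sup>2 / 20 + 5 * u\<^sup>2"
  proof -
    have "(2 * a * q) * u \<le> \<bar>2 * a * q\<bar> * \<bar>u\<bar>"
      by (metis abs_ge_self abs_mult)
    also have "\<dots> \<le> \<bar>b - a\<bar> * \<bar>u\<bar>"
      by (intro mult_right_mono q2) auto
    also have "\<dots> \<le> (b - a)\<^sup>2 / 20 + 5 * u\<^sup>2"
    proof -
      \<comment> \<open>The weight 10 spends only 1/20 of \<open>(b - a)\<^sup>2\<close>; the
        resulting 5 and the 1 from the quadratic term make up the constant 6.\<close>
      have "0 \<le> (\<bar>b - a\<bar> - 10 * \<bar>u\<bar>)\<^sup>2" by simp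
      also have "\<dots> = \<bar>b - a\<bar>\<^sup>2 + 100 * \<bar>u\<bar>\<^sup>2 - 20 * (\<bar>b - a\<bar> * \<bar>u\<bar>)"
        by (simp only: power2_diff[of "\<bar>b - a\<bar>"] power_mult_distrib) simp
      finally show ?thesis by (simp only: power2_abs)
    qed
    finally show ?thesis .
  qed
  moreover have "u\<^sup>2 * q \<le> u\<^sup>2 * 1"
    using q1 by (intro mult_left_mono) auto
  ultimately show ?thesis
    unfolding q_def u_def by simp
qed

text \<open>A Chernoff bound: the product dominates the indicator of \<open>A\<close>, and by
  independence its mean is a power of the mean of one factor.\<close>

lemma sample_law_prod_le:
  assumes P: "prob_space P" and f: "integrable P f" and E: "(\<integral>x. f x \<partial>P) \<le> exp (- a)"
    and nn: "\<And>x. x \<in> space P \<Longrightarrow> 0 \<le> (f x :: real)"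
    and A: "A \<in> sets (sample_law n P)" and le: "\<And>X. X \<in> A \<Longrightarrow> 1 \<le> (\<Prod>i<n. f (X i))"
  shows "measure (sample_law n P) A \<le> exp (- (real n * a))"
proof -
  interpret P: prob_space P by fact
  interpret PP: product_sigma_finite "\<lambda>_ :: nat. P"
    by (rule product_sigma_finite_const[OF prob_space_imp_sigma_finite[OF P]])
  interpret S: prob_space "sample_law n P"
    by (rule prob_space_sample_law[OF P])
  have int: "integrable (sample_law n P) (\<lambda>X. \<Prod>i<n. f (X i))"
    unfolding sample_law_def by (intro PP.product_integrable_prod f) simp
  have "measure (sample_law n P) A = (\<integral>X. indicator A X \<partial>sample_law n P)"
    using A by simp
  also have "\<dots> \<le> (\<integral>X. (\<Prod>i<n. f (X i)) \<partial>sample_law n P)"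
  proof (rule integral_mono[OF _ int])
    show "integrable (sample_law n P) (indicator A :: _ \<Rightarrow> real)"
      using A by (simp add: S.emeasure_eq_measure)
    show "indicator A X \<le> (\<Prod>i<n. f (X i))" if "X \<in> space (sample_law n P)" for X
      using le that nn by (cases "X \<in> A") (auto intro!: prod_nonneg dest: space_sample_law_coordinate)
  qed
  also have "\<dots> = (\<integral>x. f x \<partial>P) ^ n"
    unfolding sample_law_def by (subst PP.product_integral_prod) (auto intro: f)
  also have "\<dots> \<le> exp (- a) ^ n"
    using nn by (intro power_mono E Bochner_Integration.integral_nonneg) auto
  also have "\<dots> = exp (- (real n * a))"
    by (simp add: exp_of_nat_mult[symmetric])
  finally show ?thesis .
qed

text \<open>
  With \<open>a = \<surd>p\<^sub>s\<close> and \<open>b = \<surd>p\<^sub>t\<close> the test rejects when the product of the bounded ratios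
  \<open>(a + 2b)/(2a + b) = 1 + (b - a)/(2a + b)\<close> is at least 1. The latter form has the value 1 at
  \<open>a = b = 0\<close>.
\<close>

lemma hellinger_separation_tests:
  fixes M :: "(nat \<Rightarrow> real) measure"
  assumes M: "sigma_finite_measure M"
    and p [measurable]: "\<And>s. s \<in> \<Theta> \<Longrightarrow> p s \<in> borel_measurable M"
    and nn: "\<And>s x. s \<in> \<Theta> \<Longrightarrow> x \<in> space M \<Longrightarrow> 0 \<le> p s x"
    and P: "\<And>s. s \<in> \<Theta> \<Longrightarrow> prob_space (density M (\<lambda>x. ennreal (p s x)))"
  shows "separation_tests (1/10) (1/10) M \<Theta> p
    (\<lambda>s t. sqrt (1/2 * (\<integral>x. (sqrt (p s x) - sqrt (p t x))\<^sup>2 \<partial>M)))"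
proof -
  define d where "d s t = sqrt (1/2 * (\<integral>x. (sqrt (p s x) - sqrt (p t x))\<^sup>2 \<partial>M))" for s t
  have nnint: "(\<integral>\<^sup>+x. ennreal (p s x) \<partial>M) = 1" if s: "s \<in> \<Theta>" for s
  proof -
    have "emeasure (density M (\<lambda>x. ennreal (p s x))) (space M) = 1"
      using prob_space.emeasure_space_1[OF P[OF s]] by simp
    then show ?thesis
      using s by (simp add: emeasure_density cong: nn_integral_cong)
  qed
  have int: "integrable M (p s)" if "s \<in> \<Theta>" for s
    using that nn nnint by (intro integrableI_nn_integral_finite[where x = 1]) auto
  have int1: "(\<integral>x. p s x \<partial>M) = 1" if "s \<in> \<Theta>" for s
    using that nn nnint by (subst integral_eq_nn_integral) auto
  have int_sq: "integrable M (\<lambda>x. (sqrt (p s x) - sqrt (p t x))\<^sup>2)" if "s \<in> \<Theta>" "t \<in> \<Theta>" for s t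
    using that by (intro integrable_sqrt_diff_square int nn) auto
  have d2: "(\<integral>x. (sqrt (p s x) - sqrt (p t x))\<^sup>2 \<partial>M) = 2 * (d s t)\<^sup>2" for s t
    unfolding d_def by (simp add: real_sqrt_pow2)
  have d2': "(\<integral>x. (sqrt (p s x) - sqrt (p t x))\<^sup>2 \<partial>M) = 2 * (d t s)\<^sup>2" for s t
    using d2[of t s] by (simp add: power2_commute[of "sqrt (p s _)"])
  define T where "T s t x = 1 + (sqrt (p t x) - sqrt (p s x)) / (2 * sqrt (p s x) + sqrt (p t x))"
    for s t x
  have [measurable]: "T s t \<in> borel_measurable M" if "s \<in> \<Theta>" "t \<in> \<Theta>" for s t
    using that unfolding T_def[abs_def] by measurable
  have T_inv: "T s t x * T t s x = 1" and T_pos: "0 < T s t x" and T_le: "T s t x \<le> 2"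
    if "s \<in> \<Theta>" "t \<in> \<Theta>" "x \<in> space M" for s t x
  proof -
    have ab: "0 \<le> sqrt (p s x)" "0 \<le> sqrt (p t x)"
      using that nn by auto
    show "T s t x * T t s x = 1" "0 < T s t x" "T s t x \<le> 2"
      unfolding T_def using likelihood_ratio[OF ab] likelihood_ratio(1)[OF ab(2,1)] by auto
  qed
  have int_T: "integrable M (\<lambda>x. p u x * T s t x)" if "s \<in> \<Theta>" "t \<in> \<Theta>" "u \<in> \<Theta>" for s t u
  proof (rule Bochner_Integration.integrable_bound)
    show "integrable M (\<lambda>x. 2 * p u x)"
      using int that by simp
    show "AE x in M. norm (p u x * T s t x) \<le> norm (2 * p u x)"
    proof (rule AE_I2)
      fix x assume x: "x \<in> space M"
      have "p u x * T s t x \<le> p u x * 2"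
        by (intro mult_left_mono T_le nn that x)
      then show "norm (p u x * T s t x) \<le> norm (2 * p u x)"
        using T_pos[OF that(1,2) x] nn[OF that(3) x] by (simp add: abs_mult)
    qed
  qed (use that in measurable)
  have E_T: "(\<integral>x. p u x * T s t x \<partial>M) \<le> exp (- ((d s t)\<^sup>2 / 10))"
    if s: "s \<in> \<Theta>" and t: "t \<in> \<Theta>" and u: "u \<in> \<Theta>" and us: "(d u s)\<^sup>2 \<le> (d s t)\<^sup>2 / 100" for s t u
  proof -
    have "(\<integral>x. p u x * T s t x \<partial>M) \<le> (\<integral>x. p u x + ((p t x - p s x - (sqrt (p s x) - sqrt (p t x))\<^sup>2) / 6
        + (sqrt (p s x) - sqrt (p t x))\<^sup>2 / 20 + 6 * (sqrt (p u x) - sqrt (p s x))\<^sup>2) \<partial>M)"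
    proof (rule integral_mono)
      show "integrable M (\<lambda>x. p u x + ((p t x - p s x - (sqrt (p s x) - sqrt (p t x))\<^sup>2) / 6
        + (sqrt (p s x) - sqrt (p t x))\<^sup>2 / 20 + 6 * (sqrt (p u x) - sqrt (p s x))\<^sup>2))"
        using int int_sq s t u by auto
      fix x assume x: "x \<in> space M"
      let ?a = "sqrt (p s x)" and ?b = "sqrt (p t x)" and ?t = "sqrt (p u x)"
      have sq: "?a\<^sup>2 = p s x" "?b\<^sup>2 = p t x" "?t\<^sup>2 = p u x"
        using nn x s t u by auto
      have "?t\<^sup>2 * ((?b - ?a) / (2 * ?a + ?b)) \<le> ?a * (?b - ?a) / 3 + (?b - ?a)\<^sup>2 / 20 + 6 * (?t - ?a)\<^sup>2"
        using nn x s t by (intro likelihood_ratio_bound_perturbed) auto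
      also have "?a * (?b - ?a) = (?b\<^sup>2 - ?a\<^sup>2 - (?a - ?b)\<^sup>2) / 2"
        by (simp add: algebra_simps power2_eq_square)
      finally have "?t\<^sup>2 * T s t x \<le> ?t\<^sup>2 + ((?b\<^sup>2 - ?a\<^sup>2 - (?a - ?b)\<^sup>2) / 6 + (?a - ?b)\<^sup>2 / 20 + 6 * (?t - ?a)\<^sup>2)"
        by (simp add: T_def distrib_left power2_commute[of ?b ?a])
      then show "p u x * T s t x \<le> p u x + ((p t x - p s x - (?a - ?b)\<^sup>2) / 6
          + (?a - ?b)\<^sup>2 / 20 + 6 * (?t - ?a)\<^sup>2)"
        unfolding sq .
    qed (rule int_T[OF s t u])
    also have "\<dots> = 1 + ((1 - 1 - 2 * (d s t)\<^sup>2) / 6 + 2 * (d s t)\<^sup>2 / 20 + 6 * (2 * (d u s)\<^sup>2))"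
      using int int_sq s t u by (simp add: int1 d2)
    \<comment> \<open>In units of \<open>(d s t)\<^sup>2\<close> the coefficients are -1/3 + 1/10 +
      12/100, which is below -1/10. This is the origin of the relative radius 1/10 and of the rate
      1/10.\<close>
    also have "\<dots> \<le> 1 + - ((d s t)\<^sup>2 / 10)"
    proof -
      have "1 + ((1 - 1 - 2 * a) / 6 + 2 * a / 20 + 6 * (2 * e)) \<le> 1 + - (a / 10)"
        if "0 \<le> a" "e \<le> a / 100" for a e :: real
        using that by (simp add: field_simps)
      from this[OF zero_le_power2 us] show ?thesis .
    qed
    also have "\<dots> \<le> exp (- ((d s t)\<^sup>2 / 10))"
      by (rule exp_ge_add_one_self)
    finally show ?thesis .
  qed
  have "separation_tests (1/10) (1/10) M \<Theta> p d"
    unfolding separation_tests_def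
  proof (intro allI ballI)
    fix n s t assume s: "s \<in> \<Theta>" and t: "t \<in> \<Theta>"
    define A where "A = {X\<in>space (sample_law n M). 1 \<le> (\<Prod>i<n. T s t (X i))}"
    have A [measurable]: "A \<in> sets (sample_law n M)"
      using s t unfolding A_def by measurable
    let ?P = "\<lambda>u. density M (\<lambda>x. ennreal (p u x))"
    have E: "integrable (?P u) (T s' t') \<and> (\<integral>x. T s' t' x \<partial>?P u) \<le> exp (- ((d s' t')\<^sup>2 / 10))"
      if "s' \<in> \<Theta>" "t' \<in> \<Theta>" "u \<in> \<Theta>" "(d u s')\<^sup>2 \<le> (d s' t')\<^sup>2 / 100" for s' t' u
    proof -
      have "AE x in M. 0 \<le> p u x"
        using nn that(3) by auto
      then show ?thesis
        using int_T[OF that(1-3)] E_T[OF that] that(1-3)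
        by (simp add: integrable_density integral_density)
    qed
    \<comment> \<open>Here \<open>u = s\<close>, so the perturbation is zero.\<close>
    have first: "measure (sample_law n (?P s)) A \<le> exp (- (real n * ((d s t)\<^sup>2 / 10)))"
    proof (rule sample_law_prod_le[OF P[OF s]])
      show "integrable (?P s) (T s t)" "(\<integral>x. T s t x \<partial>?P s) \<le> exp (- ((d s t)\<^sup>2 / 10))"
        using E[OF s t s] by (auto simp: d_def)
      show "0 \<le> T s t x" if "x \<in> space (?P s)" for x
        using T_pos[OF s t] that by (simp add: less_imp_le)
    qed (auto simp: A_def[symmetric], simp add: A_def)
    \<comment> \<open>Off \<open>A\<close> the reciprocal product exceeds 1, so this is the error of
      the first kind of the test with \<open>s\<close> and \<open>t\<close> exchanged, under a
      density near \<open>t\<close>.\<close>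
    have second: "measure (sample_law n (?P u)) (space (sample_law n M) - A)
        \<le> exp (- (real n * ((d s t)\<^sup>2 / 10)))"
      if u: "u \<in> \<Theta>" and ut: "d u t < 1/10 * d s t" for u
    proof (rule sample_law_prod_le[OF P[OF u]])
      have "(d u t)\<^sup>2 \<le> (1/10 * d s t)\<^sup>2"
        using ut by (intro power_mono) (auto simp: d_def)
      then have "(d u t)\<^sup>2 \<le> (d t s)\<^sup>2 / 100"
        using d2[of s t] d2'[of s t] by (simp add: power_mult_distrib power2_eq_square)
      then show "integrable (?P u) (T t s)" "(\<integral>x. T t s x \<partial>?P u) \<le> exp (- ((d s t)\<^sup>2 / 10))"
        using E[OF t s u] d2[of s t] d2'[of s t] by auto
      show "0 \<le> T t s x" if "x \<in> space (?P u)" for x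
        using T_pos[OF t s] that by (simp add: less_imp_le)
      show "space (sample_law n M) - A \<in> sets (sample_law n (?P u))"
        unfolding sets_sample_law_density by measurable
      fix X assume "X \<in> space (sample_law n M) - A"
      then have X: "X \<in> space (sample_law n M)" and lt: "(\<Prod>i<n. T s t (X i)) < 1"
        by (auto simp: A_def)
      have "(\<Prod>i<n. T s t (X i)) * (\<Prod>i<n. T t s (X i)) = 1"
        unfolding prod.distrib[symmetric]
        using X T_inv[OF s t] by (intro prod.neutral) (auto dest: space_sample_law_coordinate)
      moreover have "0 < (\<Prod>i<n. T t s (X i))"
        using X T_pos[OF t s] by (intro prod_pos) (auto dest: space_sample_law_coordinate)
      ultimately show "1 \<le> (\<Prod>i<n. T t s (X i))"
        using lt mult_right_mono[of "\<Prod>i<n. T s t (X i)" 1 "\<Prod>i<n. T t s (X i)"] by simp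
    qed
    show "\<exists>\<phi>\<in>borel_measurable (sample_law n M).
        (\<forall>X\<in>space (sample_law n M). 0 \<le> \<phi> X \<and> \<phi> X \<le> 1) \<and>
        (\<integral>X. \<phi> X \<partial>(sample_law n (?P s))) \<le> exp (- (1/10) * real n * (d s t)\<^sup>2) \<and>
        (\<forall>u\<in>\<Theta>. d u t < 1/10 * d s t \<longrightarrow>
           (\<integral>X. 1 - \<phi> X \<partial>(sample_law n (?P u))) \<le> exp (- (1/10) * real n * (d s t)\<^sup>2))"
    proof (intro bexI[of _ "indicator A"] conjI ballI impI)
      show "(\<integral>X. indicator A X \<partial>(sample_law n (?P s))) \<le> exp (- (1/10) * real n * (d s t)\<^sup>2)"
        using first by (simp add: field_simps)
      fix u assume u: "u \<in> \<Theta>" "d u t < 1/10 * d s t"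
      have "(\<integral>X. 1 - indicator A X \<partial>(sample_law n (?P u))) =
          (\<integral>X. indicator (space (sample_law n M) - A) X \<partial>(sample_law n (?P u)) :: real)"
        by (intro Bochner_Integration.integral_cong) (auto simp: indicator_def)
      then show "(\<integral>X. 1 - indicator A X \<partial>(sample_law n (?P u))) \<le> exp (- (1/10) * real n * (d s t)\<^sup>2)"
        using second[OF u] by (simp add: field_simps)
    qed (auto simp: indicator_def)
  qed
  then show ?thesis
    unfolding d_def .
qed

section \<open>Likelihoods and the evidence lower bound\<close>

text \<open>Averaging over \<theta> keeps both bounds, by Jensen's inequality for the square and
  Fubini for the mean. The averaged log ratio is then one function of a single observation, to which
  Chebyshev's inequality applies.\<close>

lemma averaged_moments:
  fixes r :: "'a \<Rightarrow> 'b \<Rightarrow> real"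
  assumes P: "prob_space P" and \<nu>: "prob_space \<nu>"
    and r [measurable]: "(\<lambda>(x, \<theta>). r \<theta> x) \<in> borel_measurable (P \<Otimes>\<^sub>M \<nu>)"
    and mom: "AE \<theta> in \<nu>. integrable P (\<lambda>x. (r \<theta> x)\<^sup>2) \<and> (\<integral>x. (r \<theta> x)\<^sup>2 \<partial>P) \<le> b \<and> a \<le> (\<integral>x. r \<theta> x \<partial>P)"
  shows "AE x in P. integrable \<nu> (\<lambda>\<theta>. r \<theta> x)"
    and "(\<lambda>x. \<integral>\<theta>. r \<theta> x \<partial>\<nu>) \<in> borel_measurable P"
    and "integrable P (\<lambda>x. (\<integral>\<theta>. r \<theta> x \<partial>\<nu>)\<^sup>2)"
    and "(\<integral>x. (\<integral>\<theta>. r \<theta> x \<partial>\<nu>)\<^sup>2 \<partial>P) \<le> b"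
    and "a \<le> (\<integral>x. (\<integral>\<theta>. r \<theta> x \<partial>\<nu>) \<partial>P)"
proof -
  interpret P: prob_space P by fact
  interpret \<nu>: prob_space \<nu> by fact
  interpret PN: pair_prob_space P \<nu> ..
  have "(\<integral>\<^sup>+z. ennreal ((case z of (x, \<theta>) \<Rightarrow> r \<theta> x)\<^sup>2) \<partial>(P \<Otimes>\<^sub>M \<nu>)) =
      (\<integral>\<^sup>+\<theta>. \<integral>\<^sup>+x. ennreal ((r \<theta> x)\<^sup>2) \<partial>P \<partial>\<nu>)"
    by (subst PN.nn_integral_snd[symmetric]) auto
  also have "\<dots> \<le> (\<integral>\<^sup>+\<theta>. ennreal b \<partial>\<nu>)"
  proof (rule nn_integral_mono_AE)
    show "AE \<theta> in \<nu>. (\<integral>\<^sup>+x. ennreal ((r \<theta> x)\<^sup>2) \<partial>P) \<le> ennreal b"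
      using mom by eventually_elim (simp add: nn_integral_eq_integral ennreal_leI)
  qed
  finally have sq: "(\<integral>\<^sup>+z. ennreal ((case z of (x, \<theta>) \<Rightarrow> r \<theta> x)\<^sup>2) \<partial>(P \<Otimes>\<^sub>M \<nu>)) \<le> ennreal b"
    by (simp add: \<nu>.emeasure_space_1)
  have int2: "integrable (P \<Otimes>\<^sub>M \<nu>) (\<lambda>z. (case z of (x, \<theta>) \<Rightarrow> r \<theta> x)\<^sup>2)"
    using sq by (intro integrableI_bounded) (auto intro: le_less_trans)
  have int1: "integrable (P \<Otimes>\<^sub>M \<nu>) (\<lambda>z. case z of (x, \<theta>) \<Rightarrow> r \<theta> x)"
    by (rule PN.P.square_integrable_imp_integrable[OF r int2])
  show ae: "AE x in P. integrable \<nu> (\<lambda>\<theta>. r \<theta> x)"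
    using PN.AE_integrable_fst'[OF int1] by simp
  have ae2: "AE x in P. integrable \<nu> (\<lambda>\<theta>. (r \<theta> x)\<^sup>2)"
    using PN.AE_integrable_fst'[OF int2] by simp
  show [measurable]: "(\<lambda>x. \<integral>\<theta>. r \<theta> x \<partial>\<nu>) \<in> borel_measurable P"
    by measurable
  have le: "AE x in P. (\<integral>\<theta>. r \<theta> x \<partial>\<nu>)\<^sup>2 \<le> (\<integral>\<theta>. (r \<theta> x)\<^sup>2 \<partial>\<nu>)"
    using ae ae2
  proof eventually_elim
    case (elim x)
    then show ?case
      using \<nu>.variance_eq[of "\<lambda>\<theta>. r \<theta> x"] \<nu>.variance_positive[of "\<lambda>\<theta>. r \<theta> x"] by simp
  qed
  have int_sq: "integrable P (\<lambda>x. \<integral>\<theta>. (r \<theta> x)\<^sup>2 \<partial>\<nu>)"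
    using PN.integrable_fst'[OF int2] by simp
  show m2: "integrable P (\<lambda>x. (\<integral>\<theta>. r \<theta> x \<partial>\<nu>)\<^sup>2)"
    by (rule Bochner_Integration.integrable_bound[OF int_sq])
      (use le in \<open>auto elim!: eventually_mono\<close>)
  have "(\<integral>x. (\<integral>\<theta>. r \<theta> x \<partial>\<nu>)\<^sup>2 \<partial>P) \<le> (\<integral>x. (\<integral>\<theta>. (r \<theta> x)\<^sup>2 \<partial>\<nu>) \<partial>P)"
    by (rule integral_mono_AE[OF m2 int_sq le])
  also have "\<dots> = (\<integral>z. (case z of (x, \<theta>) \<Rightarrow> r \<theta> x)\<^sup>2 \<partial>(P \<Otimes>\<^sub>M \<nu>))"
    using PN.integral_fst'[OF int2] by simp
  also have "\<dots> \<le> b"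
  proof -
    \<comment> \<open>\<open>ennreal\<close> truncates negative reals, so \<open>0 \<le> b\<close>
      must be known before \<open>sq\<close> can be read as a real inequality.\<close>
    have "\<exists>\<theta>. (\<integral>x. (r \<theta> x)\<^sup>2 \<partial>P) \<le> b"
    proof (rule ccontr)
      assume neg: "\<nexists>\<theta>. (\<integral>x. (r \<theta> x)\<^sup>2 \<partial>P) \<le> b"
      have "AE \<theta> in \<nu>. False"
        using mom by eventually_elim (use neg in blast)
      then show False
        by simp
    qed
    then obtain \<theta> where "(\<integral>x. (r \<theta> x)\<^sup>2 \<partial>P) \<le> b"
      by blast
    then have "0 \<le> b"
      by (rule order.trans[rotated]) simp
    then show ?thesis
      using sq int2 by (simp add: nn_integral_eq_integral)
  qed
  finally show "(\<integral>x. (\<integral>\<theta>. r \<theta> x \<partial>\<nu>)\<^sup>2 \<partial>P) \<le> b" .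
  interpret NP: pair_sigma_finite \<nu> P ..
  have int1': "integrable (\<nu> \<Otimes>\<^sub>M P) (\<lambda>(\<theta>, x). r \<theta> x)"
    using PN.integrable_product_swap[OF int1] by (simp add: split_beta')
  have "(\<integral>x. (\<integral>\<theta>. r \<theta> x \<partial>\<nu>) \<partial>P) = (\<integral>\<theta>. (\<integral>x. r \<theta> x \<partial>P) \<partial>\<nu>)"
    using PN.Fubini_integral[of "\<lambda>x \<theta>. r \<theta> x"] int1 by simp
  moreover have "(\<integral>\<theta>. a \<partial>\<nu>) \<le> (\<integral>\<theta>. (\<integral>x. r \<theta> x \<partial>P) \<partial>\<nu>)"
    using mom NP.integrable_fst'[OF int1'] by (intro integral_mono_AE) auto
  ultimately show "a \<le> (\<integral>x. (\<integral>\<theta>. r \<theta> x \<partial>\<nu>) \<partial>P)"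
    by (simp add: \<nu>.prob_space)
qed

lemma (in prob_space) exp_integral_le_nn_integral_exp:
  assumes g: "integrable M g"
  shows "ennreal (exp (\<integral>x. g x \<partial>M)) \<le> (\<integral>\<^sup>+x. ennreal (exp (g x)) \<partial>M)"
proof (cases "(\<integral>\<^sup>+x. ennreal (exp (g x)) \<partial>M) = \<infinity>")
  case False
  let ?e = "\<integral>x. g x \<partial>M"
  have [measurable]: "g \<in> borel_measurable M"
    using g by auto
  have int: "integrable M (\<lambda>x. exp (g x))"
    using False by (intro integrableI_bounded) (auto simp: less_top[symmetric])
  have "(\<integral>x. exp ?e * (1 + (g x - ?e)) \<partial>M) \<le> (\<integral>x. exp (g x) \<partial>M)"
  proof (rule integral_mono[OF _ int])
    show "integrable M (\<lambda>x. exp ?e * (1 + (g x - ?e)))"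
      using g by simp
    show "exp ?e * (1 + (g x - ?e)) \<le> exp (g x)" for x
      using mult_left_mono[OF exp_ge_add_one_self[of "g x - ?e"], of "exp ?e"]
      by (simp add: exp_add[symmetric])
  qed
  also have "(\<integral>x. exp ?e * (1 + (g x - ?e)) \<partial>M) = exp ?e"
    using g by (simp add: prob_space)
  finally show ?thesis
    using int by (simp add: nn_integral_eq_integral ennreal_leI)
qed simp

section \<open>Mixtures of likelihoods over the prior in a dominated model\<close>

definition likelihood :: "('a \<Rightarrow> (nat \<Rightarrow> real) \<Rightarrow> real) \<Rightarrow> nat \<Rightarrow> 'a \<Rightarrow> (nat \<Rightarrow> nat \<Rightarrow> real) \<Rightarrow> real" where
  "likelihood p n \<theta> X = (\<Prod>i<n. p \<theta> (X i))"

text \<open>Gathers what Fubini over prior and sample requires, detached from the metric that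
  generates the \<sigma>-algebra of the prior.\<close>

locale dominated_model = M: sigma_finite_measure M + prior: prob_space \<pi>
  for M :: "(nat \<Rightarrow> real) measure" and \<pi> :: "'a measure" +
  fixes p :: "'a \<Rightarrow> (nat \<Rightarrow> real) \<Rightarrow> real"
  assumes p_measurable [measurable]: "(\<lambda>(\<theta>, x). p \<theta> x) \<in> borel_measurable (\<pi> \<Otimes>\<^sub>M M)"
    and p_nonneg: "\<And>\<theta> x. \<theta> \<in> space \<pi> \<Longrightarrow> x \<in> space M \<Longrightarrow> 0 \<le> p \<theta> x"
    and prob_density: "\<And>\<theta>. \<theta> \<in> space \<pi> \<Longrightarrow> prob_space (density M (\<lambda>x. ennreal (p \<theta> x)))"
begin

definition sampling :: "nat \<Rightarrow> 'a \<Rightarrow> (nat \<Rightarrow> nat \<Rightarrow> real) measure" where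
  "sampling n \<theta> = sample_law n (density M (\<lambda>x. ennreal (p \<theta> x)))"

lemma p_measurable1 [measurable]: "\<theta> \<in> space \<pi> \<Longrightarrow> p \<theta> \<in> borel_measurable M"
  by measurable

lemma sets_sampling [simp, measurable_cong]: "sets (sampling n \<theta>) = sets (sample_law n M)"
  by (simp add: sampling_def)

lemma space_sampling [simp]: "space (sampling n \<theta>) = space (sample_law n M)"
  by (simp add: sampling_def)

lemma prob_space_sampling: "\<theta> \<in> space \<pi> \<Longrightarrow> prob_space (sampling n \<theta>)"
  unfolding sampling_def by (intro prob_space_sample_law prob_density)

lemma sigma_finite_sample: "sigma_finite_measure (sample_law n M)"
  by (rule sigma_finite_sample_law) unfold_locales

lemma pair_sigma_finite_prior_sample: "pair_sigma_finite \<pi> (sample_law n M)"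
  by (intro pair_sigma_finite.intro sigma_finite_sample) unfold_locales

lemma likelihood_measurable [measurable]:
  "(\<lambda>(\<theta>, X). likelihood p n \<theta> X) \<in> borel_measurable (\<pi> \<Otimes>\<^sub>M sample_law n M)"
  unfolding likelihood_def split_beta'
proof (rule borel_measurable_prod)
  fix i assume "i \<in> {..<n}"
  then have [measurable]: "(\<lambda>X. X i) \<in> measurable (sample_law n M) M"
    by (intro measurable_sample_coordinate) simp
  show "(\<lambda>z. p (fst z) (snd z i)) \<in> borel_measurable (\<pi> \<Otimes>\<^sub>M sample_law n M)"
    by measurable
qed

lemma likelihood_measurable1 [measurable]:
  "\<theta> \<in> space \<pi> \<Longrightarrow> likelihood p n \<theta> \<in> borel_measurable (sample_law n M)"
  by measurable

lemma likelihood_measurable2 [measurable]: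
  "X \<in> space (sample_law n M) \<Longrightarrow> (\<lambda>\<theta>. likelihood p n \<theta> X) \<in> borel_measurable \<pi>"
  by measurable

lemma likelihood_nonneg:
  "\<theta> \<in> space \<pi> \<Longrightarrow> X \<in> space (sample_law n M) \<Longrightarrow> 0 \<le> likelihood p n \<theta> X"
  unfolding likelihood_def by (intro prod_nonneg p_nonneg) (auto dest: space_sample_law_coordinate)

lemma sampling_eq_density:
  "\<theta> \<in> space \<pi> \<Longrightarrow> sampling n \<theta> = density (sample_law n M) (\<lambda>X. ennreal (likelihood p n \<theta> X))"
  unfolding sampling_def likelihood_def
  by (intro sample_law_density p_measurable1 p_nonneg prob_density) unfold_locales

lemma nn_integral_sampling:
  assumes "\<theta> \<in> space \<pi>" and [measurable]: "f \<in> borel_measurable (sample_law n M)"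
  shows "(\<integral>\<^sup>+X. f X \<partial>sampling n \<theta>) = (\<integral>\<^sup>+X. ennreal (likelihood p n \<theta> X) * f X \<partial>sample_law n M)"
  using assms by (simp add: sampling_eq_density nn_integral_density)

lemma nn_integral_sampling_measurable:
  assumes [measurable]: "f \<in> borel_measurable (sample_law n M)"
  shows "(\<lambda>\<theta>. \<integral>\<^sup>+X. f X \<partial>sampling n \<theta>) \<in> borel_measurable \<pi>"
proof -
  interpret S: sigma_finite_measure "sample_law n M"
    by (rule sigma_finite_sample)
  have "(\<lambda>\<theta>. \<integral>\<^sup>+X. ennreal (likelihood p n \<theta> X) * f X \<partial>sample_law n M) \<in> borel_measurable \<pi>"
    by measurable
  then show ?thesis
    by (rule measurable_cong[THEN iffD1, rotated]) (simp add: nn_integral_sampling)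
qed

text \<open>The unnormalised posterior integral of \<open>g\<close>; \<open>g = 1\<close> gives the
  evidence. Values in \<open>ennreal\<close> admit moments of \<rho> before they are known to be
  finite.\<close>

definition mixture :: "nat \<Rightarrow> ('a \<Rightarrow> ennreal) \<Rightarrow> (nat \<Rightarrow> nat \<Rightarrow> real) \<Rightarrow> ennreal" where
  "mixture n g X = (\<integral>\<^sup>+\<theta>. g \<theta> * ennreal (likelihood p n \<theta> X) \<partial>\<pi>)"

lemma mixture_measurable [measurable]:
  assumes [measurable]: "g \<in> borel_measurable \<pi>"
  shows "mixture n g \<in> borel_measurable (sample_law n M)"
  unfolding mixture_def[abs_def] by measurable

lemma nn_integral_mixture:
  assumes [measurable]: "g \<in> borel_measurable \<pi>" "\<psi> \<in> borel_measurable (sample_law n M)"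
  shows "(\<integral>\<^sup>+X. \<psi> X * mixture n g X \<partial>sample_law n M) = (\<integral>\<^sup>+\<theta>. g \<theta> * (\<integral>\<^sup>+X. \<psi> X \<partial>sampling n \<theta>) \<partial>\<pi>)"
proof -
  interpret pair_sigma_finite \<pi> "sample_law n M"
    by (rule pair_sigma_finite_prior_sample)
  have "(\<integral>\<^sup>+X. \<psi> X * mixture n g X \<partial>sample_law n M) =
      (\<integral>\<^sup>+X. (\<integral>\<^sup>+\<theta>. \<psi> X * (g \<theta> * ennreal (likelihood p n \<theta> X)) \<partial>\<pi>) \<partial>sample_law n M)"
    unfolding mixture_def by (intro nn_integral_cong nn_integral_cmult[symmetric]) measurable
  also have "\<dots> = (\<integral>\<^sup>+\<theta>. (\<integral>\<^sup>+X. \<psi> X * (g \<theta> * ennreal (likelihood p n \<theta> X)) \<partial>sample_law n M) \<partial>\<pi>)"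
    by (rule Fubini') measurable
  also have "\<dots> = (\<integral>\<^sup>+\<theta>. g \<theta> * (\<integral>\<^sup>+X. \<psi> X \<partial>sampling n \<theta>) \<partial>\<pi>)"
  proof (intro nn_integral_cong)
    fix \<theta> assume \<theta>: "\<theta> \<in> space \<pi>"
    have "(\<integral>\<^sup>+X. \<psi> X * (g \<theta> * ennreal (likelihood p n \<theta> X)) \<partial>sample_law n M) =
        (\<integral>\<^sup>+X. g \<theta> * (ennreal (likelihood p n \<theta> X) * \<psi> X) \<partial>sample_law n M)"
      by (intro nn_integral_cong) (simp add: ac_simps)
    also have "\<dots> = g \<theta> * (\<integral>\<^sup>+X. \<psi> X \<partial>sampling n \<theta>)"
      using \<theta> by (subst nn_integral_cmult) (auto simp: nn_integral_sampling)
    finally show "(\<integral>\<^sup>+X. \<psi> X * (g \<theta> * ennreal (likelihood p n \<theta> X)) \<partial>sample_law n M) =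
        g \<theta> * (\<integral>\<^sup>+X. \<psi> X \<partial>sampling n \<theta>)" .
  qed
  finally show ?thesis .
qed

lemma AE_sampling_likelihood_pos:
  assumes "\<theta> \<in> space \<pi>"
  shows "AE X in sampling n \<theta>. 0 < likelihood p n \<theta> X"
  by (subst sampling_eq_density[OF assms], subst AE_density) (use assms in auto)

lemma AE_sampling_mixture_finite:
  assumes \<theta>: "\<theta> \<in> space \<pi>" and [measurable]: "g \<in> borel_measurable \<pi>"
    and fin: "(\<integral>\<^sup>+\<theta>. g \<theta> \<partial>\<pi>) < \<infinity>"
  shows "AE X in sampling n \<theta>. mixture n g X < \<infinity>"
proof -
  have "(\<integral>\<^sup>+X. 1 * mixture n g X \<partial>sample_law n M) = (\<integral>\<^sup>+\<theta>. g \<theta> * (\<integral>\<^sup>+X. 1 \<partial>sampling n \<theta>) \<partial>\<pi>)"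
    by (rule nn_integral_mixture) auto
  also have "\<dots> = (\<integral>\<^sup>+\<theta>. g \<theta> \<partial>\<pi>)"
    using prob_space.emeasure_space_1[OF prob_space_sampling] by (intro nn_integral_cong) simp
  finally have "AE X in sample_law n M. mixture n g X \<noteq> \<infinity>"
    using fin by (intro nn_integral_PInf_AE) auto
  then show ?thesis
    by (subst sampling_eq_density[OF \<theta>], subst AE_density)
      (use \<theta> in \<open>auto simp: less_top elim: eventually_mono\<close>)
qed

text \<open>Split the likelihood at \<open>t\<close> with the weights \<phi> and 1 - \<phi>. The
  first part costs the level of the test; in the second the likelihood is at most
  \<open>mixture n g X / c\<close> on the event, and Fubini turns this into the averaged error of
  the second kind. For \<phi> = 0 it is the plain Markov inequality.\<close>

lemma mixture_Markov:
  assumes t: "t \<in> space \<pi>" and c: "0 < c"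
    and [measurable]: "g \<in> borel_measurable \<pi>" "\<phi> \<in> borel_measurable (sample_law n M)"
    and \<phi>: "\<And>X. X \<in> space (sample_law n M) \<Longrightarrow> 0 \<le> \<phi> X \<and> \<phi> X \<le> 1"
  shows "emeasure (sampling n t)
      {X\<in>space (sample_law n M). ennreal (c * likelihood p n t X) \<le> mixture n g X}
    \<le> (\<integral>\<^sup>+X. ennreal (\<phi> X) \<partial>sampling n t) +
      ennreal (1 / c) * (\<integral>\<^sup>+\<theta>. g \<theta> * (\<integral>\<^sup>+X. ennreal (1 - \<phi> X) \<partial>sampling n \<theta>) \<partial>\<pi>)"
    (is "emeasure _ ?A \<le> _")
proof -
  let ?Q = "\<lambda>X. ennreal (likelihood p n t X)"
  have [measurable]: "likelihood p n t \<in> borel_measurable (sample_law n M)"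
    by (rule likelihood_measurable1[OF t])
  have A [measurable]: "?A \<in> sets (sample_law n M)"
    by measurable
  have "emeasure (sampling n t) ?A = (\<integral>\<^sup>+X. ?Q X * indicator ?A X \<partial>sample_law n M)"
    using A by (simp add: sampling_eq_density[OF t] emeasure_density)
  also have "\<dots> \<le> (\<integral>\<^sup>+X. ?Q X * ennreal (\<phi> X) + ennreal (1 / c) * (ennreal (1 - \<phi> X) * mixture n g X) \<partial>sample_law n M)"
  proof (rule nn_integral_mono)
    fix X assume X: "X \<in> space (sample_law n M)"
    show "?Q X * indicator ?A X \<le> ?Q X * ennreal (\<phi> X) + ennreal (1 / c) * (ennreal (1 - \<phi> X) * mixture n g X)"
    proof (cases "X \<in> ?A")
      case True
      have Q: "0 \<le> likelihood p n t X"
        by (rule likelihood_nonneg[OF t X])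
      have "?Q X = ?Q X * ennreal (\<phi> X + (1 - \<phi> X))"
        by simp
      also have "\<dots> = ?Q X * ennreal (\<phi> X) + ennreal (1 - \<phi> X) * ?Q X"
        using \<phi>[OF X] by (subst ennreal_plus) (auto simp: distrib_left mult.commute)
      also have "?Q X = ennreal (1 / c) * ennreal (c * likelihood p n t X)"
        using c Q by (subst ennreal_mult[symmetric]) auto
      also have "ennreal (1 - \<phi> X) * (ennreal (1 / c) * ennreal (c * likelihood p n t X)) \<le>
          ennreal (1 - \<phi> X) * (ennreal (1 / c) * mixture n g X)"
        using True by (intro mult_left_mono) auto
      finally have "?Q X \<le> ?Q X * ennreal (\<phi> X) + ennreal (1 - \<phi> X) * (ennreal (1 / c) * mixture n g X)"
        using c Q by (simp add: ennreal_mult[symmetric])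
      then show ?thesis
        using True by (simp add: ac_simps)
    qed simp
  qed
  also have "\<dots> = (\<integral>\<^sup>+X. ?Q X * ennreal (\<phi> X) \<partial>sample_law n M) +
      ennreal (1 / c) * (\<integral>\<^sup>+X. ennreal (1 - \<phi> X) * mixture n g X \<partial>sample_law n M)"
    by (subst nn_integral_add) (auto simp: nn_integral_cmult)
  also have "(\<integral>\<^sup>+X. ennreal (1 - \<phi> X) * mixture n g X \<partial>sample_law n M) =
      (\<integral>\<^sup>+\<theta>. g \<theta> * (\<integral>\<^sup>+X. ennreal (1 - \<phi> X) \<partial>sampling n \<theta>) \<partial>\<pi>)"
    by (rule nn_integral_mixture) auto
  also have "(\<integral>\<^sup>+X. ?Q X * ennreal (\<phi> X) \<partial>sample_law n M) = (\<integral>\<^sup>+X. ennreal (\<phi> X) \<partial>sampling n t)"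
    by (rule nn_integral_sampling[OF t, symmetric]) auto
  finally show ?thesis .
qed

text \<open>\<open>Y\<close> is the log-likelihood ratio averaged over \<open>B\<close>, a sum of
  i.i.d. terms. It is returned instead of a good event because the lower bound through
  \<open>Y\<close> holds almost surely, which later also yields a positive evidence outside the
  range of the rate argument.\<close>

lemma evidence_lower_bound:
  fixes b :: real
  assumes t: "t \<in> space \<pi>" and B [measurable]: "B \<in> sets \<pi>" and mB: "0 < measure \<pi> B"
    and pos: "\<And>\<theta>. \<theta> \<in> B \<Longrightarrow> AE x in density M (\<lambda>x. ennreal (p t x)). 0 < p \<theta> x"
    and sq_int: "\<And>\<theta>. \<theta> \<in> B \<Longrightarrow>
      integrable (density M (\<lambda>x. ennreal (p t x))) (\<lambda>x. (ln (p \<theta> x / p t x))\<^sup>2)"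
    and kl: "\<And>\<theta>. \<theta> \<in> B \<Longrightarrow> - (\<integral>x. ln (p \<theta> x / p t x) \<partial>density M (\<lambda>x. ennreal (p t x))) \<le> b"
    and sq: "\<And>\<theta>. \<theta> \<in> B \<Longrightarrow> (\<integral>x. (ln (p \<theta> x / p t x))\<^sup>2 \<partial>density M (\<lambda>x. ennreal (p t x))) \<le> b"
    and n: "0 < n" and b: "0 < b"
  shows "\<exists>Y\<in>borel_measurable (sample_law n M).
    measure (sampling n t) {X\<in>space (sample_law n M). Y X \<le> - 2 * real n * b} \<le> 1 / (real n * b) \<and>
    (AE X in sampling n t.
       ennreal (measure \<pi> B * exp (Y X) * likelihood p n t X) \<le> mixture n (\<lambda>_. 1) X)"
proof -
  define P where "P = density M (\<lambda>x. ennreal (p t x))"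
  define \<nu> where "\<nu> = uniform_measure \<pi> B"
  define r where "r \<theta> x = ln (p \<theta> x / p t x)" for \<theta> x
  have eB: "emeasure \<pi> B \<noteq> 0" "emeasure \<pi> B < \<infinity>"
    using mB by (auto simp: prior.emeasure_eq_measure)
  have P: "prob_space P"
    unfolding P_def by (rule prob_density[OF t])
  have \<nu>: "prob_space \<nu>"
    unfolding \<nu>_def using eB by (intro prob_space_uniform_measure) auto
  have setsP [measurable_cong]: "sets P = sets M" and sets\<nu> [measurable_cong]: "sets \<nu> = sets \<pi>"
    by (auto simp: P_def \<nu>_def)
  interpret P: prob_space P by fact
  interpret \<nu>: prob_space \<nu> by fact
  interpret PN: pair_prob_space P \<nu> ..
  have [measurable]: "p t \<in> borel_measurable M"
    by (rule p_measurable1[OF t])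
  have rm [measurable]: "(\<lambda>(x, \<theta>). r \<theta> x) \<in> borel_measurable (P \<Otimes>\<^sub>M \<nu>)"
    unfolding r_def by measurable
  have AE_\<nu>: "AE \<theta> in \<nu>. \<theta> \<in> B"
    unfolding \<nu>_def by (rule AE_uniform_measureI) auto
  have mom: "AE \<theta> in \<nu>. integrable P (\<lambda>x. (r \<theta> x)\<^sup>2) \<and> (\<integral>x. (r \<theta> x)\<^sup>2 \<partial>P) \<le> b \<and> - b \<le> (\<integral>x. r \<theta> x \<partial>P)"
    using AE_\<nu>
  proof eventually_elim
    case (elim \<theta>)
    then show ?case
      using sq_int[of \<theta>] sq[of \<theta>] kl[of \<theta>] unfolding P_def r_def by auto
  qed
  define m where "m x = (\<integral>\<theta>. r \<theta> x \<partial>\<nu>)" for x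
  note av = averaged_moments[OF P \<nu> rm mom, folded m_def]
  have [measurable]: "m \<in> borel_measurable M"
    using av(2) by (simp add: measurable_cong_sets[OF setsP refl])
  define Y where "Y X = (\<Sum>i<n. m (X i))" for X
  have Ym [measurable]: "Y \<in> borel_measurable (sample_law n M)"
    unfolding Y_def[abs_def] by measurable
  have samp: "sampling n t = sample_law n P"
    by (simp add: sampling_def P_def)
  interpret S: prob_space "sampling n t"
    by (rule prob_space_sampling[OF t])
  have nb: "0 < real n * b"
    using n b by simp
  \<comment> \<open>The mean of \<open>Y\<close> is at least \<open>- (real n * b)\<close>, so a
    fall to twice that level requires a deviation of \<open>real n * b\<close>.\<close>
  have "measure (sampling n t) {X\<in>space (sample_law n M). Y X \<le> - 2 * real n * b} \<le>
      measure (sampling n t) {X\<in>space (sampling n t). real n * b \<le> \<bar>\<Sum>i<n. m (X i) - (\<integral>x. m x \<partial>P)\<bar>}"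
  proof (rule S.finite_measure_mono)
    show "{X\<in>space (sample_law n M). Y X \<le> - 2 * real n * b} \<subseteq>
        {X\<in>space (sampling n t). real n * b \<le> \<bar>\<Sum>i<n. m (X i) - (\<integral>x. m x \<partial>P)\<bar>}"
    proof safe
      fix X assume "Y X \<le> - 2 * real n * b"
      moreover have "real n * (- b) \<le> real n * (\<integral>x. m x \<partial>P)"
        by (intro mult_left_mono av(5)) auto
      ultimately show "real n * b \<le> \<bar>\<Sum>i<n. m (X i) - (\<integral>x. m x \<partial>P)\<bar>"
        by (simp add: sum_subtractf Y_def)
    qed simp
  qed measurable
  also have "\<dots> \<le> real n * (\<integral>x. (m x)\<^sup>2 \<partial>P) / (real n * b)\<^sup>2"
    unfolding samp by (rule sample_law_Chebyshev[OF P av(2,3) nb])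
  also have "\<dots> \<le> real n * b / (real n * b)\<^sup>2"
    by (intro divide_right_mono mult_left_mono av(4)) auto
  also have "\<dots> = 1 / (real n * b)"
    using nb by (simp add: power2_eq_square)
  finally have prob: "measure (sampling n t) {X\<in>space (sample_law n M). Y X \<le> - 2 * real n * b} \<le> 1 / (real n * b)" .

  \<comment> \<open>Positivity is given for each \<theta> and almost every observation, but
    \<open>exp\<close> of the log ratio must recover the likelihood for a fixed sample and almost
    every \<theta>; Fubini for null sets exchanges the order.\<close>
  have ae_pos: "AE x in P. AE \<theta> in \<nu>. 0 < p \<theta> x"
  proof -
    interpret NP: pair_sigma_finite \<nu> P ..
    have "AE \<theta> in \<nu>. AE x in P. 0 < p \<theta> x"
      using AE_\<nu> pos unfolding P_def by (auto elim!: eventually_mono)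
    then show ?thesis
      by (subst (asm) NP.AE_commute) auto
  qed
  have ae_t: "AE x in P. 0 < p t x"
    unfolding P_def by (subst AE_density) auto
  have comp: "AE X in sampling n t. \<forall>i<n. Q (X i)" if "AE x in P. Q x" for Q
  proof -
    have "AE X in sampling n t. Q (X i)" if "i < n" for i
      unfolding samp sample_law_def
      using that P \<open>AE x in P. Q x\<close> by (intro AE_PiM_component) auto
    then show ?thesis
      by (simp add: AE_all_countable)
  qed
  have "AE X in sampling n t.
      ennreal (measure \<pi> B * exp (Y X) * likelihood p n t X) \<le> mixture n (\<lambda>_. 1) X"
    using comp[OF ae_pos] comp[OF ae_t] comp[OF av(1)] AE_space[of "sampling n t"]
  proof eventually_elim
    case (elim X)
    then have X: "X \<in> space (sample_law n M)"
      by simp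
    let ?q = "likelihood p n t X"
    have q: "0 < ?q"
      using elim by (auto simp: likelihood_def intro!: prod_pos)
    have int: "integrable \<nu> (\<lambda>\<theta>. \<Sum>i<n. r \<theta> (X i))"
      using elim by (intro Bochner_Integration.integrable_sum) auto
    have "Y X = (\<integral>\<theta>. (\<Sum>i<n. r \<theta> (X i)) \<partial>\<nu>)"
      unfolding Y_def m_def using elim by (subst Bochner_Integration.integral_sum) auto
    then have "ennreal (exp (Y X)) \<le> (\<integral>\<^sup>+\<theta>. ennreal (exp (\<Sum>i<n. r \<theta> (X i))) \<partial>\<nu>)"
      using \<nu>.exp_integral_le_nn_integral_exp[OF int] by simp
    also have "\<dots> = (\<integral>\<^sup>+\<theta>. ennreal (1 / ?q) * ennreal (likelihood p n \<theta> X) \<partial>\<nu>)"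
    proof (rule nn_integral_cong_AE)
      have "AE \<theta> in \<nu>. \<forall>i\<in>{..<n}. 0 < p \<theta> (X i)"
        using elim(1) by (subst AE_ball_countable) auto
      then show "AE \<theta> in \<nu>. ennreal (exp (\<Sum>i<n. r \<theta> (X i))) = ennreal (1 / ?q) * ennreal (likelihood p n \<theta> X)"
      proof eventually_elim
        case (elim \<theta>)
        have "exp (\<Sum>i<n. r \<theta> (X i)) = (\<Prod>i<n. p \<theta> (X i) / p t (X i))"
          using elim \<open>\<forall>i<n. 0 < p t (X i)\<close> by (simp add: exp_sum r_def)
        also have "\<dots> = 1 / ?q * likelihood p n \<theta> X"
          by (simp add: likelihood_def prod_dividef)
        finally have "exp (\<Sum>i<n. r \<theta> (X i)) = 1 / ?q * likelihood p n \<theta> X" .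
        moreover have "0 < likelihood p n \<theta> X"
          unfolding likelihood_def using elim by (intro prod_pos) auto
        ultimately show ?case
          using q by (simp add: ennreal_mult[symmetric])
      qed
    qed
    also have "\<dots> = ennreal (1 / ?q) * (\<integral>\<^sup>+\<theta>. ennreal (likelihood p n \<theta> X) \<partial>\<nu>)"
      using X by (intro nn_integral_cmult) measurable
    also have "(\<integral>\<^sup>+\<theta>. ennreal (likelihood p n \<theta> X) \<partial>\<nu>) =
        (\<integral>\<^sup>+\<theta>. ennreal (likelihood p n \<theta> X) * indicator B \<theta> \<partial>\<pi>) / emeasure \<pi> B"
      unfolding \<nu>_def using X by (intro nn_integral_uniform_measure) measurable
    also have "\<dots> \<le> mixture n (\<lambda>_. 1) X / emeasure \<pi> B"
      unfolding mixture_def by (intro divide_right_mono_ennreal nn_integral_mono) (auto simp: indicator_def)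
    also have "\<dots> = mixture n (\<lambda>_. 1) X * ennreal (1 / measure \<pi> B)"
      using mB by (simp add: prior.emeasure_eq_measure divide_ennreal_def inverse_ennreal inverse_eq_divide)
    finally have le: "ennreal (exp (Y X)) \<le>
        ennreal (1 / ?q) * (mixture n (\<lambda>_. 1) X * ennreal (1 / measure \<pi> B))"
      by (simp add: mult_left_mono)
    have "ennreal (measure \<pi> B * exp (Y X) * ?q) = ennreal (measure \<pi> B * ?q) * ennreal (exp (Y X))"
      using mB q by (simp add: ennreal_mult[symmetric] ac_simps)
    also have "\<dots> \<le> ennreal (measure \<pi> B * ?q) *
        (ennreal (1 / ?q) * (mixture n (\<lambda>_. 1) X * ennreal (1 / measure \<pi> B)))"
      by (intro mult_left_mono le) auto
    also have "\<dots> = ennreal (measure \<pi> B * ?q) * ennreal (1 / ?q) * ennreal (1 / measure \<pi> B) *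
        mixture n (\<lambda>_. 1) X"
      by (simp add: ac_simps)
    also have "ennreal (measure \<pi> B * ?q) * ennreal (1 / ?q) * ennreal (1 / measure \<pi> B) = 1"
      using mB q by (simp add: ennreal_mult[symmetric])
    finally show ?case
      by simp
  qed
  with prob Ym show ?thesis
    by blast
qed

end

section \<open>From packings to a test of the whole complement\<close>

text \<open>A packing of greatest cardinality is a net of radius \<open>2 * e\<close>: the ball
  around any further centre meets a chosen ball.\<close>

lemma packing_cover:
  assumes met: "Metric_space Y d" and e: "0 < e" and fin: "packing_number e Y d \<noteq> \<infinity>"
  shows "\<exists>S. finite S \<and> S \<subseteq> Y \<and> card S \<le> the_enat (packing_number e Y d) \<and>
    (\<forall>y\<in>Y. \<exists>s\<in>S. d y s < 2 * e)"
proof -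
  interpret Metric_space Y d by fact
  let ?P = "\<lambda>S. finite S \<and> S \<subseteq> Y \<and> disjoint_family_on (\<lambda>x. mball x e) S"
  let ?N = "the_enat (packing_number e Y d)"
  have N: "packing_number e Y d = enat ?N"
    using fin by auto
  have card: "card S \<le> ?N" if "?P S" for S
  proof -
    have "enat (card S) \<le> packing_number e Y d"
      unfolding packing_number_def using that by (intro SUP_upper) auto
    then show ?thesis
      by (metis N enat_ord_simps(1))
  qed
  have "\<exists>S. ?P S \<and> (\<forall>S'. ?P S' \<longrightarrow> card S' \<le> card S)"
  proof (rule ex_has_greatest_nat[where b = "Suc ?N"])
    show "?P {}"
      by (simp add: disjoint_family_on_def)
    show "\<forall>S. ?P S \<longrightarrow> card S < Suc ?N"
      using card by (meson le_imp_less_Suc)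
  qed
  then obtain S where S: "?P S" and max: "\<And>S'. ?P S' \<Longrightarrow> card S' \<le> card S"
    by blast
  have "\<exists>s\<in>S. d y s < 2 * e" if y: "y \<in> Y" for y
  proof (cases "y \<in> S")
    case True
    then show ?thesis
      using e y by (intro bexI[of _ y]) auto
  next
    case False
    then have "\<not> ?P (insert y S)"
      using max[of "insert y S"] S by auto
    then have "mball y e \<inter> (\<Union>s\<in>S. mball s e) \<noteq> {}"
      using S y disjoint_family_on_insert[OF False, of "\<lambda>x. mball x e"] by blast
    then obtain s z where s: "s \<in> S" and z: "z \<in> mball y e" "z \<in> mball s e"
      by blast
    have "d y s \<le> d y z + d z s"
      using z by (intro triangle) auto
    also have "\<dots> < 2 * e"
      using z commute[of z s] by auto
    finally show ?thesis
      using s by blast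
  qed
  with S card show ?thesis
    by blast
qed

lemma euclidean_Metric_space:
  assumes "euclidean_coords q \<Theta> c"
  shows "Metric_space \<Theta> (euclidean_distance q c)"
proof
  fix x y z
  show "0 \<le> euclidean_distance q c x y"
    by (simp add: euclidean_distance_def)
  show "euclidean_distance q c x y = euclidean_distance q c y x"
    by (simp add: euclidean_distance_def L2_set_def power2_commute)
  show "euclidean_distance q c x z \<le> euclidean_distance q c x y + euclidean_distance q c y z"
    unfolding euclidean_distance_def
    using L2_set_triangle_ineq[of "\<lambda>i. c x i - c y i" "\<lambda>i. c y i - c z i" "{..<q}"] by simp
  assume xy: "x \<in> \<Theta>" "y \<in> \<Theta>"
  have inj: "inj_on c \<Theta>" and ext: "c x \<in> (\<Pi>\<^sub>E i\<in>{..<q}. UNIV)" "c y \<in> (\<Pi>\<^sub>E i\<in>{..<q}. UNIV)"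
    using assms xy by (auto simp: euclidean_coords_def)
  show "euclidean_distance q c x y = 0 \<longleftrightarrow> x = y"
  proof
    assume "euclidean_distance q c x y = 0"
    then have "\<And>i. i \<in> {..<q} \<Longrightarrow> c x i = c y i"
      by (simp add: euclidean_distance_def L2_set_eq_0_iff)
    then have "c x = c y"
      by (rule PiE_ext[OF ext])
    then show "x = y"
      using inj xy by (simp add: inj_on_eq_iff)
  qed (simp add: euclidean_distance_def L2_set_eq_0_iff)
qed

section \<open>Combining the tests over a net\<close>

lemma prod_one_minus_ge:
  fixes f :: "'i \<Rightarrow> real"
  assumes "finite S" "\<And>s. s \<in> S \<Longrightarrow> 0 \<le> f s \<and> f s \<le> 1"
  shows "1 - (\<Sum>s\<in>S. f s) \<le> (\<Prod>s\<in>S. 1 - f s)"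
  using assms
proof (induction S)
  case (insert s S)
  have "f s * (\<Prod>s\<in>S. 1 - f s) \<le> f s * 1"
    using insert.prems by (intro mult_left_mono prod_le_1) auto
  then show ?case
    using insert by (simp add: algebra_simps)
qed simp

context dominated_model
begin

lemma nn_integral_sampling_unit_interval:
  assumes \<theta>: "\<theta> \<in> space \<pi>" and [measurable]: "f \<in> borel_measurable (sample_law n M)"
    and f: "\<And>X. X \<in> space (sample_law n M) \<Longrightarrow> 0 \<le> f X \<and> f X \<le> 1"
  shows "(\<integral>\<^sup>+X. ennreal (f X) \<partial>sampling n \<theta>) = ennreal (\<integral>X. f X \<partial>sampling n \<theta>)"
proof -
  interpret S: prob_space "sampling n \<theta>"
    by (rule prob_space_sampling[OF \<theta>])
  have "integrable (sampling n \<theta>) f"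
    using f by (intro S.integrable_const_bound[where B = 1]) auto
  then show ?thesis
    using f by (intro nn_integral_eq_integral) auto
qed

text \<open>
  The tests against the balls around the points of a finite net are combined as
  \<open>\<phi> = 1 - \<Prod>\<^sub>s (1 - \<phi>\<^sub>s)\<close>, so that \<open>\<phi> \<le> \<Sum>\<^sub>s \<phi>\<^sub>s\<close> and \<open>1 - \<phi> \<le> 1 - \<phi>\<^sub>s\<close>. The radius
  \<open>R \<ge> 22\<close> makes \<open>2\<epsilon>\<close>-balls around the net points fit into the balls of relative radius
  1/10 on which the tests are uniformly good.
\<close>

lemma combined_test:
  assumes tests: "separation_tests \<kappa> (1/10) M (space \<pi>) p d" and met: "Metric_space (space \<pi>) d"
    and t: "t \<in> space \<pi>" and Y: "Y \<subseteq> space \<pi>" and e: "0 < e" and \<kappa>: "0 < \<kappa>"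
    and fin: "packing_number e Y d \<noteq> \<infinity>"
    and entropy: "ln (real (the_enat (packing_number e Y d))) \<le> real n * e\<^sup>2"
    and R: "22 \<le> R" "L \<le> \<kappa> * (R - 2)\<^sup>2"
  shows "\<exists>\<phi>\<in>borel_measurable (sample_law n M).
    (\<forall>X\<in>space (sample_law n M). 0 \<le> \<phi> X \<and> \<phi> X \<le> 1) \<and>
    (\<integral>\<^sup>+X. ennreal (\<phi> X) \<partial>sampling n t) \<le> ennreal (exp ((1 - L) * (real n * e\<^sup>2))) \<and>
    (\<forall>\<theta>\<in>Y. R * e \<le> d \<theta> t \<longrightarrow>
       (\<integral>\<^sup>+X. ennreal (1 - \<phi> X) \<partial>sampling n \<theta>) \<le> ennreal (exp (- L * (real n * e\<^sup>2))))"
proof -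
  interpret Metric_space "space \<pi>" d by fact
  let ?x = "real n * e\<^sup>2"
  obtain S where S: "finite S" "S \<subseteq> Y" "card S \<le> the_enat (packing_number e Y d)"
    and net: "\<And>y. y \<in> Y \<Longrightarrow> \<exists>s\<in>S. d y s < 2 * e"
    using packing_cover[OF subspace[OF Y] e fin] by blast
  have cardS: "real (card S) \<le> exp ?x"
  \<comment> \<open>\<open>ln 0 = 0\<close> carries no information about an empty net, so only a
    positive packing number is exponentiated.\<close>
  proof (cases "card S = 0")
    case False
    then have "0 < real (the_enat (packing_number e Y d))"
      using S(3) by simp
    then have "real (the_enat (packing_number e Y d)) \<le> exp ?x"
      using entropy ln_le_cancel_iff[of _ "exp ?x"] by simp
    then show ?thesis
      using S(3) by linarith
  qed simp
  \<comment> \<open>Net points close to \<open>t\<close> are dropped: tests against them have a poor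
    exponent, and no point of \<open>Y\<close> at distance at least \<open>R * e\<close> from
    \<open>t\<close> relies on them.\<close>
  define S' where "S' = {s\<in>S. (R - 2) * e \<le> d t s}"
  have S': "finite S'" "\<And>s. s \<in> S' \<Longrightarrow> s \<in> space \<pi>"
    using S Y by (auto simp: S'_def)
  have "\<forall>s\<in>S'. \<exists>\<phi>. \<phi>\<in>borel_measurable (sample_law n M) \<and>
        (\<forall>X\<in>space (sample_law n M). 0 \<le> \<phi> X \<and> \<phi> X \<le> 1) \<and>
        (\<integral>X. \<phi> X \<partial>(sampling n t)) \<le> exp (- \<kappa> * real n * (d t s)\<^sup>2) \<and>
        (\<forall>u\<in>space \<pi>. d u s < 1/10 * d t s \<longrightarrow>
           (\<integral>X. 1 - \<phi> X \<partial>(sampling n u)) \<le> exp (- \<kappa> * real n * (d t s)\<^sup>2))"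
    (is "\<forall>s\<in>S'. ?tests s")
  proof
    fix s assume "s \<in> S'"
    then have "s \<in> space \<pi>"
      by (rule S'(2))
    from tests[unfolded separation_tests_def, THEN spec, THEN bspec, OF t, THEN bspec, OF this, of n]
    show "?tests s"
      unfolding sampling_def Bex_def .
  qed
  from bchoice[OF this] obtain \<psi> where \<psi>: "\<forall>s\<in>S'. \<psi> s \<in> borel_measurable (sample_law n M) \<and>
        (\<forall>X\<in>space (sample_law n M). 0 \<le> \<psi> s X \<and> \<psi> s X \<le> 1) \<and>
        (\<integral>X. \<psi> s X \<partial>(sampling n t)) \<le> exp (- \<kappa> * real n * (d t s)\<^sup>2) \<and>
        (\<forall>u\<in>space \<pi>. d u s < 1/10 * d t s \<longrightarrow>
           (\<integral>X. 1 - \<psi> s X \<partial>(sampling n u)) \<le> exp (- \<kappa> * real n * (d t s)\<^sup>2))" ..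
  have m [measurable]: "\<And>s. s \<in> S' \<Longrightarrow> \<psi> s \<in> borel_measurable (sample_law n M)"
    and unit: "\<And>s X. s \<in> S' \<Longrightarrow> X \<in> space (sample_law n M) \<Longrightarrow> 0 \<le> \<psi> s X \<and> \<psi> s X \<le> 1"
    and level: "\<And>s. s \<in> S' \<Longrightarrow> (\<integral>X. \<psi> s X \<partial>sampling n t) \<le> exp (- \<kappa> * real n * (d t s)\<^sup>2)"
    and power: "\<And>s u. s \<in> S' \<Longrightarrow> u \<in> space \<pi> \<Longrightarrow> d u s < 1/10 * d t s \<Longrightarrow>
      (\<integral>X. 1 - \<psi> s X \<partial>sampling n u) \<le> exp (- \<kappa> * real n * (d t s)\<^sup>2)"
    using \<psi> by blast+
  \<comment> \<open>Distance buys exponent: a large \<open>R\<close> reaches any \<open>L\<close>,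
    however small the constant \<kappa> of the tests.\<close>
  have rate: "exp (- \<kappa> * real n * (d t s)\<^sup>2) \<le> exp (- L * ?x)" if "s \<in> S'" for s
  proof -
    have "L * ?x \<le> \<kappa> * (R - 2)\<^sup>2 * ?x"
      by (intro mult_right_mono R) auto
    also have "\<dots> = \<kappa> * real n * ((R - 2) * e)\<^sup>2"
      by (simp add: power_mult_distrib)
    also have "\<dots> \<le> \<kappa> * real n * (d t s)\<^sup>2"
      using that \<kappa> e R by (intro mult_left_mono power_mono) (auto simp: S'_def)
    finally show ?thesis
      by simp
  qed
  define \<phi> where "\<phi> X = 1 - (\<Prod>s\<in>S'. 1 - \<psi> s X)" for X
  have [measurable]: "\<phi> \<in> borel_measurable (sample_law n M)"
    unfolding \<phi>_def[abs_def] by measurable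
  have \<phi>_unit: "0 \<le> \<phi> X \<and> \<phi> X \<le> 1" if "X \<in> space (sample_law n M)" for X
    unfolding \<phi>_def using unit that by (auto intro!: prod_le_1 prod_nonneg)
  have "(\<integral>\<^sup>+X. ennreal (\<phi> X) \<partial>sampling n t) \<le> (\<integral>\<^sup>+X. (\<Sum>s\<in>S'. ennreal (\<psi> s X)) \<partial>sampling n t)"
  proof (rule nn_integral_mono)
    fix X assume "X \<in> space (sampling n t)"
    then have u: "\<And>s. s \<in> S' \<Longrightarrow> 0 \<le> \<psi> s X \<and> \<psi> s X \<le> 1"
      using unit by simp
    have "\<phi> X \<le> (\<Sum>s\<in>S'. \<psi> s X)"
      unfolding \<phi>_def using prod_one_minus_ge[where f = "\<lambda>s. \<psi> s X", OF S'(1) u] by simp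
    then show "ennreal (\<phi> X) \<le> (\<Sum>s\<in>S'. ennreal (\<psi> s X))"
      using u by (simp add: sum_ennreal ennreal_leI)
  qed
  also have "\<dots> = (\<Sum>s\<in>S'. \<integral>\<^sup>+X. ennreal (\<psi> s X) \<partial>sampling n t)"
    by (intro nn_integral_sum) measurable
  also have "\<dots> \<le> (\<Sum>s\<in>S'. ennreal (exp (- L * ?x)))"
  proof (rule sum_mono)
    fix s assume s: "s \<in> S'"
    have "(\<integral>\<^sup>+X. ennreal (\<psi> s X) \<partial>sampling n t) = ennreal (\<integral>X. \<psi> s X \<partial>sampling n t)"
      by (rule nn_integral_sampling_unit_interval[OF t m[OF s]]) (rule unit[OF s])
    also have "\<dots> \<le> ennreal (exp (- L * ?x))"
      by (intro ennreal_leI order.trans[OF level[OF s] rate[OF s]])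
    finally show "(\<integral>\<^sup>+X. ennreal (\<psi> s X) \<partial>sampling n t) \<le> ennreal (exp (- L * ?x))" .
  qed
  also have "\<dots> = ennreal (real (card S') * exp (- L * ?x))"
    by (simp add: ennreal_mult ennreal_of_nat_eq_real_of_nat)
  also have "\<dots> \<le> ennreal (exp ?x * exp (- L * ?x))"
  proof (intro ennreal_leI mult_right_mono)
    have "card S' \<le> card S"
      using S by (auto simp: S'_def intro: card_mono)
    then show "real (card S') \<le> exp ?x"
      using cardS by linarith
  qed simp
  also have "exp ?x * exp (- L * ?x) = exp ((1 - L) * ?x)"
    by (simp add: exp_add[symmetric] algebra_simps)
  finally have lev: "(\<integral>\<^sup>+X. ennreal (\<phi> X) \<partial>sampling n t) \<le> ennreal (exp ((1 - L) * ?x))" .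
  have pow: "(\<integral>\<^sup>+X. ennreal (1 - \<phi> X) \<partial>sampling n \<theta>) \<le> ennreal (exp (- L * ?x))"
    if \<theta>: "\<theta> \<in> Y" and far: "R * e \<le> d \<theta> t" for \<theta>
  proof -
    have \<theta>': "\<theta> \<in> space \<pi>"
      using \<theta> Y by auto
    obtain s where s: "s \<in> S" "d \<theta> s < 2 * e"
      using net[OF \<theta>] by blast
    have "s \<in> space \<pi>"
      using s S Y by auto
    then have "d \<theta> t \<le> d \<theta> s + d t s"
      using triangle[OF \<theta>' _ t, of s] commute[of s t] by simp
    then have ts: "(R - 2) * e \<le> d t s"
      using far s by (simp add: algebra_simps)
    then have sS': "s \<in> S'"
      using s by (simp add: S'_def)
    have "20 * e \<le> (R - 2) * e"
      using R e by (intro mult_right_mono) auto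
    then have close: "d \<theta> s < 1/10 * d t s"
      using ts s by simp
    have "(\<integral>\<^sup>+X. ennreal (1 - \<phi> X) \<partial>sampling n \<theta>) \<le> (\<integral>\<^sup>+X. ennreal (1 - \<psi> s X) \<partial>sampling n \<theta>)"
    proof (intro nn_integral_mono ennreal_leI)
      fix X assume X: "X \<in> space (sampling n \<theta>)"
      have "1 - \<phi> X = (1 - \<psi> s X) * (\<Prod>s\<in>S' - {s}. 1 - \<psi> s X)"
        unfolding \<phi>_def using prod.remove[OF S'(1) sS'] by simp
      also have "\<dots> \<le> (1 - \<psi> s X) * 1"
        using unit sS' X by (intro mult_left_mono prod_le_1) auto
      finally show "1 - \<phi> X \<le> 1 - \<psi> s X" by simp
    qed
    also have "\<dots> = ennreal (\<integral>X. 1 - \<psi> s X \<partial>sampling n \<theta>)"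
      using unit sS' by (intro nn_integral_sampling_unit_interval[OF \<theta>']) auto
    also have "\<dots> \<le> ennreal (exp (- L * ?x))"
      by (intro ennreal_leI order.trans[OF power[OF sS' \<theta>' close] rate[OF sS']])
    finally show ?thesis .
  qed
  show ?thesis
    by (intro bexI[of _ \<phi>] conjI ballI impI lev pow) (use \<phi>_unit in auto)
qed

section \<open>Concentration of the posterior\<close>

lemma posterior_eq:
  "posterior p \<pi> n X = density \<pi> (\<lambda>\<theta>. ennreal (likelihood p n \<theta> X) / mixture n (\<lambda>_. 1) X)"
  by (simp add: posterior_def likelihood_def mixture_def)

lemma nn_integral_posterior:
  assumes X: "X \<in> space (sample_law n M)" and [measurable]: "g \<in> borel_measurable \<pi>"
  shows "(\<integral>\<^sup>+\<theta>. g \<theta> \<partial>posterior p \<pi> n X) = mixture n g X / mixture n (\<lambda>_. 1) X"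
proof -
  have [measurable]: "(\<lambda>\<theta>. likelihood p n \<theta> X) \<in> borel_measurable \<pi>"
    by (rule likelihood_measurable2[OF X])
  have "(\<integral>\<^sup>+\<theta>. g \<theta> \<partial>posterior p \<pi> n X) =
      (\<integral>\<^sup>+\<theta>. ennreal (likelihood p n \<theta> X) / mixture n (\<lambda>_. 1) X * g \<theta> \<partial>\<pi>)"
    unfolding posterior_eq by (intro nn_integral_density) measurable
  also have "\<dots> = (\<integral>\<^sup>+\<theta>. g \<theta> * ennreal (likelihood p n \<theta> X) * inverse (mixture n (\<lambda>_. 1) X) \<partial>\<pi>)"
    by (simp add: divide_ennreal_def ac_simps)
  also have "\<dots> = mixture n g X / mixture n (\<lambda>_. 1) X"
    unfolding mixture_def[of n g] by (subst nn_integral_multc) (auto simp: divide_ennreal_def)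
  finally show ?thesis .
qed

lemma prob_space_posterior:
  assumes X: "X \<in> space (sample_law n M)"
    and pos: "0 < mixture n (\<lambda>_. 1) X" and fin: "mixture n (\<lambda>_. 1) X < \<infinity>"
  shows "prob_space (posterior p \<pi> n X)"
proof
  have "emeasure (posterior p \<pi> n X) (space (posterior p \<pi> n X)) = (\<integral>\<^sup>+\<theta>. 1 \<partial>posterior p \<pi> n X)"
    by simp
  also have "\<dots> = 1"
    using pos fin by (subst nn_integral_posterior[OF X]) auto
  finally show "emeasure (posterior p \<pi> n X) (space (posterior p \<pi> n X)) = 1" .
qed

end

text \<open>Young's inequality for \<open>(r / lam) * 1\<close>, multiplied by \<open>lam\<close>.
  Optimising the integrated form over \<open>lam\<close> would give Hoelder's inequality; a fixed
  scale keeps the bound pointwise.\<close>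

lemma Young_powr:
  fixes r lam W :: real
  assumes r: "0 \<le> r" and lam: "0 < lam" and W: "1 < W"
  shows "r \<le> (1 - 1 / W) * lam + lam / (W * lam powr W) * r powr W"
proof -
  have "(r / lam) * 1 \<le> (r / lam) powr W / W + 1 powr (W / (W - 1)) / (W / (W - 1))"
    using assms by (intro Youngs_inequality) (auto simp: field_simps)
  also have "1 powr (W / (W - 1)) / (W / (W - 1)) = 1 - 1 / W"
    using W by (simp add: field_simps)
  also have "(r / lam) powr W = r powr W / lam powr W"
    using r lam by (simp add: powr_divide)
  finally have "lam * (r / lam) \<le> lam * (r powr W / lam powr W / W + (1 - 1 / W))"
    using lam by (intro mult_left_mono) auto
  then show ?thesis
    using lam by (simp add: distrib_left ac_simps)
qed

context dominated_model
begin

text \<open>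
  Off the exceptional set the posterior integral of \<open>\<rho>\<close> splits into a part where \<open>\<rho> \<le> a\<close> and the
  part over \<open>F\<close>. The latter is bounded through Young's inequality with scale
  \<open>\<lambda> = \<Delta> exp (x / 2)\<close>, where \<open>\<Delta>\<^sup>W = \<integral> \<rho>\<^sup>W d\<pi>\<close>; it plays the role of Hoelder's inequality.
\<close>

lemma posterior_integral_bound:
  fixes \<rho> :: "'a \<Rightarrow> real"
  assumes X: "X \<in> space (sample_law n M)"
    and \<rho>m [measurable]: "\<rho> \<in> borel_measurable \<pi>" and F [measurable]: "F \<in> sets \<pi>"
    and \<rho>: "\<And>\<theta>. \<theta> \<in> space \<pi> \<Longrightarrow> 0 \<le> \<rho> \<theta>"
    and near: "\<And>\<theta>. \<theta> \<in> space \<pi> \<Longrightarrow> \<theta> \<notin> F \<Longrightarrow> \<rho> \<theta> \<le> a" and a: "0 \<le> a"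
    and \<Delta>: "0 < \<Delta>" and x: "0 \<le> x" and C: "0 \<le> C" and W: "2 * C + 8 \<le> W"
    and q: "0 < q" and fin: "mixture n (\<lambda>_. 1) X < \<infinity>"
    and evidence: "ennreal (exp (- (C + 2) * x) * q) \<le> mixture n (\<lambda>_. 1) X"
    and far: "mixture n (indicator F) X \<le> ennreal (exp (- (C + 3) * x) * q)"
    and moment: "mixture n (\<lambda>\<theta>. ennreal (\<rho> \<theta> powr W)) X \<le> ennreal (\<Delta> powr W * exp x * q)"
  shows "(\<integral>\<^sup>+\<theta>. ennreal (\<rho> \<theta>) \<partial>posterior p \<pi> n X) \<le> ennreal (a + \<Delta> * exp (- x / 2))"
proof -
  define lam where "lam = \<Delta> * exp (x / 2)"
  define c1 where "c1 = (1 - 1 / W) * lam"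
  define c2 where "c2 = lam / (W * lam powr W)"
  define Z where "Z = mixture n (\<lambda>_. 1) X"
  have W1: "1 < W" using W C by simp
  have lam: "0 < lam" using \<Delta> by (simp add: lam_def)
  have c: "0 \<le> c1" "0 \<le> c2" using W1 lam by (auto simp: c1_def c2_def)
  have m1 [measurable]: "(\<lambda>\<theta>. likelihood p n \<theta> X) \<in> borel_measurable \<pi>"
    by (rule likelihood_measurable2[OF X])
  obtain z where z: "Z = ennreal z" "0 \<le> z"
    using fin unfolding Z_def by (cases "mixture n (\<lambda>_. 1) X") auto
  let ?v = "exp (- (C + 2) * x) * q"
  have v: "0 < ?v" using q by simp
  have vz: "?v \<le> z"
    using evidence z v by (simp add: Z_def[symmetric])
  have ratio: "m / Z \<le> ennreal (u / ?v)" if "m \<le> ennreal u" "0 \<le> u" for m u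
  proof -
    have "m / Z \<le> ennreal u / Z"
      by (rule divide_right_mono_ennreal[OF that(1)])
    also have "\<dots> = ennreal (u / z)"
      using z v vz that by (simp add: divide_ennreal)
    also have "\<dots> \<le> ennreal (u / ?v)"
      using v vz that by (intro ennreal_leI divide_left_mono) auto
    finally show ?thesis .
  qed
  have "(\<integral>\<^sup>+\<theta>. ennreal (\<rho> \<theta>) \<partial>posterior p \<pi> n X) \<le>
      (\<integral>\<^sup>+\<theta>. ennreal a + ennreal c1 * indicator F \<theta> + ennreal c2 * ennreal (\<rho> \<theta> powr W) \<partial>posterior p \<pi> n X)"
  proof (rule nn_integral_mono)
    fix \<theta> assume "\<theta> \<in> space (posterior p \<pi> n X)"
    then have \<theta>: "\<theta> \<in> space \<pi>"
      by (simp add: posterior_def)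
    have "\<rho> \<theta> \<le> a + c1 * indicator F \<theta> + c2 * \<rho> \<theta> powr W"
    proof (cases "\<theta> \<in> F")
      case True
      then show ?thesis
        using Young_powr[OF \<rho>[OF \<theta>] lam W1] a by (simp add: c1_def c2_def)
    next
      case False
      have "0 \<le> c2 * \<rho> \<theta> powr W"
        using c by simp
      then show ?thesis
        using near[OF \<theta> False] False by simp
    qed
    then have "ennreal (\<rho> \<theta>) \<le> ennreal (a + c1 * indicator F \<theta> + c2 * \<rho> \<theta> powr W)"
      by (rule ennreal_leI)
    also have "\<dots> = ennreal a + ennreal c1 * indicator F \<theta> + ennreal c2 * ennreal (\<rho> \<theta> powr W)"
      using a c by (simp add: ennreal_plus ennreal_mult ennreal_indicator)
    finally show "ennreal (\<rho> \<theta>) \<le> ennreal a + ennreal c1 * indicator F \<theta> + ennreal c2 * ennreal (\<rho> \<theta> powr W)" .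
  qed
  also have "\<dots> = mixture n (\<lambda>\<theta>. ennreal a + ennreal c1 * indicator F \<theta> + ennreal c2 * ennreal (\<rho> \<theta> powr W)) X / Z"
    unfolding Z_def by (intro nn_integral_posterior[OF X]) measurable
  also have "mixture n (\<lambda>\<theta>. ennreal a + ennreal c1 * indicator F \<theta> + ennreal c2 * ennreal (\<rho> \<theta> powr W)) X =
      ennreal a * Z + ennreal c1 * mixture n (indicator F) X
        + ennreal c2 * mixture n (\<lambda>\<theta>. ennreal (\<rho> \<theta> powr W)) X"
    unfolding Z_def mixture_def
    by (simp add: distrib_right nn_integral_add nn_integral_cmult mult.assoc)
  also have "(ennreal a * Z + ennreal c1 * mixture n (indicator F) X
        + ennreal c2 * mixture n (\<lambda>\<theta>. ennreal (\<rho> \<theta> powr W)) X) / Z =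
      ennreal a * Z / Z + ennreal c1 * (mixture n (indicator F) X / Z)
        + ennreal c2 * (mixture n (\<lambda>\<theta>. ennreal (\<rho> \<theta> powr W)) X / Z)"
    by (simp add: divide_ennreal_def distrib_right mult.assoc)
  also have "\<dots> \<le> ennreal a + ennreal c1 * ennreal (exp (- (C + 3) * x) * q / ?v)
        + ennreal c2 * ennreal (\<Delta> powr W * exp x * q / ?v)"
  proof (intro add_mono mult_left_mono ratio far moment)
    show "ennreal a * Z / Z \<le> ennreal a"
      using z v vz by (simp add: ennreal_mult_divide_eq)
  qed (use q in auto)
  also have "\<dots> = ennreal (a + c1 * (exp (- (C + 3) * x) * q / ?v) + c2 * (\<Delta> powr W * exp x * q / ?v))"
    using a c q by (simp add: ennreal_plus ennreal_mult[symmetric])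
  also have "\<dots> \<le> ennreal (a + \<Delta> * exp (- x / 2))"
  proof (rule ennreal_leI)
    have e1: "exp (- (C + 3) * x) * q / ?v = exp (- x)"
      using q by (simp add: exp_diff[symmetric] algebra_simps)
    have e2: "exp x * q / ?v = exp ((C + 3) * x)"
      using q by (simp add: exp_diff[symmetric] algebra_simps)
    \<comment> \<open>At the scale \<open>lam\<close> both Young terms are at most \<Delta>
      \<open>exp (- x / 2)\<close>, with weights 1 - 1/W and 1/W. The weights sum to 1, so \<Delta>
      carries no extra constant.\<close>
    have "c1 * exp (- x) = (1 - 1 / W) * (\<Delta> * exp (- x / 2))"
      by (simp add: c1_def lam_def exp_add[symmetric])
    moreover have "c2 * (\<Delta> powr W * exp ((C + 3) * x)) \<le> 1 / W * (\<Delta> * exp (- x / 2))"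
    proof -
      have "lam powr W = \<Delta> powr W * exp (W * x / 2)"
        using \<Delta> by (simp add: lam_def powr_mult exp_powr_real mult.commute)
      then have "c2 * (\<Delta> powr W * exp ((C + 3) * x)) = 1 / W * (\<Delta> * exp (x / 2 - W * x / 2 + (C + 3) * x))"
        using \<Delta> by (simp add: c2_def lam_def exp_add exp_diff)
      \<comment> \<open>For x > 0 the exponent is at most -x/2 exactly when
        \<open>2 * C + 8 \<le> W\<close>, the origin of the threshold on \<open>W\<close>.\<close>
      also have "\<dots> \<le> 1 / W * (\<Delta> * exp (- x / 2))"
      proof (intro mult_left_mono)
        have "(2 * C + 8) * x \<le> W * x"
          by (intro mult_right_mono W x)
        then show "exp (x / 2 - W * x / 2 + (C + 3) * x) \<le> exp (- x / 2)"
          by (simp add: algebra_simps)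
      qed (use \<Delta> W1 in auto)
      finally show ?thesis .
    qed
    moreover have "(1 - 1 / W) * (\<Delta> * exp (- x / 2)) + 1 / W * (\<Delta> * exp (- x / 2)) = \<Delta> * exp (- x / 2)"
      by (simp add: algebra_simps)
    moreover have e3: "\<Delta> powr W * exp x * q / ?v = \<Delta> powr W * exp ((C + 3) * x)"
      unfolding e2[symmetric] by simp
    ultimately show "a + c1 * (exp (- (C + 3) * x) * q / ?v) + c2 * (\<Delta> powr W * exp x * q / ?v) \<le>
        a + \<Delta> * exp (- x / 2)"
      unfolding e1 e3 by linarith
  qed
  finally show ?thesis .
qed

text \<open>The failure probability is spent as \<open>1 / x\<close> on the evidence,
  \<open>3 * exp (- x)\<close> on the far mass and \<open>exp (- x)\<close> on the moment. Of the 3,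
  one is the level of the test and two are \<open>power\<close> after multiplication by
  \<open>exp ((C + 3) * x)\<close> in Markov's inequality.\<close>

lemma posterior_concentration:
  fixes \<rho> :: "'a \<Rightarrow> real"
  assumes t: "t \<in> space \<pi>"
    and \<rho>m [measurable]: "\<rho> \<in> borel_measurable \<pi>" and \<rho>: "\<And>\<theta>. \<theta> \<in> space \<pi> \<Longrightarrow> 0 \<le> \<rho> \<theta>"
    and \<rho>W: "integrable \<pi> (\<lambda>\<theta>. \<rho> \<theta> powr W)"
    and \<Delta>: "\<Delta> = (\<integral>\<theta>. \<rho> \<theta> powr W \<partial>\<pi>) powr (1 / W)"
    and F [measurable]: "F \<in> sets \<pi>"
    and near: "\<And>\<theta>. \<theta> \<in> space \<pi> \<Longrightarrow> \<theta> \<notin> F \<Longrightarrow> \<rho> \<theta> \<le> a" and a: "0 \<le> a"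
    and x: "0 < x" and C: "0 \<le> C" and W: "2 * C + 8 \<le> W"
    and Y [measurable]: "Y \<in> borel_measurable (sample_law n M)"
    and Y_prob: "measure (sampling n t) {X\<in>space (sample_law n M). Y X \<le> - 2 * x} \<le> 1 / x"
    and b: "exp (- C * x) \<le> b"
    and evidence: "AE X in sampling n t. ennreal (b * exp (Y X) * likelihood p n t X) \<le> mixture n (\<lambda>_. 1) X"
    and \<phi>m [measurable]: "\<phi> \<in> borel_measurable (sample_law n M)"
    and \<phi>: "\<And>X. X \<in> space (sample_law n M) \<Longrightarrow> 0 \<le> \<phi> X \<and> \<phi> X \<le> 1"
    and level: "(\<integral>\<^sup>+X. ennreal (\<phi> X) \<partial>sampling n t) \<le> ennreal (exp (- x))"
    and power: "(\<integral>\<^sup>+\<theta>. indicator F \<theta> * (\<integral>\<^sup>+X. ennreal (1 - \<phi> X) \<partial>sampling n \<theta>) \<partial>\<pi>)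
      \<le> ennreal (2 * exp (- (C + 4) * x))"
  shows "\<exists>N\<in>sets (sampling n t). emeasure (sampling n t) N \<le> ennreal (1 / x + 4 * exp (- x)) \<and>
    (\<forall>X\<in>space (sampling n t) - N. prob_space (posterior p \<pi> n X) \<and>
      (\<integral>\<^sup>+\<theta>. ennreal (\<rho> \<theta>) \<partial>posterior p \<pi> n X) \<le> ennreal (a + \<Delta> * exp (- x / 2)))"
proof -
  interpret S: prob_space "sampling n t"
    by (rule prob_space_sampling[OF t])
  have [measurable]: "likelihood p n t \<in> borel_measurable (sample_law n M)"
    by (rule likelihood_measurable1[OF t])
  have W0: "0 < W" using W C by simp
  define J where "J = (\<integral>\<theta>. \<rho> \<theta> powr W \<partial>\<pi>)"
  have J: "0 \<le> J" unfolding J_def by simp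
  have \<Delta>J: "\<Delta> powr W = J" and \<Delta>0: "0 \<le> \<Delta>"
    using J W0 by (auto simp: \<Delta> J_def[symmetric] powr_powr)
  let ?P = "\<lambda>X. 0 < likelihood p n t X \<and> mixture n (\<lambda>_. 1) X < \<infinity> \<and>
      ennreal (b * exp (Y X) * likelihood p n t X) \<le> mixture n (\<lambda>_. 1) X"
  have "AE X in sampling n t. mixture n (\<lambda>_. 1) X < \<infinity>"
    by (rule AE_sampling_mixture_finite[OF t borel_measurable_const]) (simp add: prior.emeasure_space_1)
  then have "AE X in sampling n t. ?P X"
    using AE_sampling_likelihood_pos[OF t] evidence by eventually_elim simp
  then obtain N0 where N0: "{X\<in>space (sampling n t). \<not> ?P X} \<subseteq> N0"
      "emeasure (sampling n t) N0 = 0" "N0 \<in> sets (sampling n t)"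
    by (rule AE_E)
  define E1 where "E1 = {X\<in>space (sample_law n M). Y X \<le> - 2 * x}"
  define E2 where "E2 = {X\<in>space (sample_law n M).
      ennreal (exp (- (C + 3) * x) * likelihood p n t X) \<le> mixture n (indicator F) X}"
  \<comment> \<open>For \<open>J = 0\<close> the threshold would be 0 and the event the whole space;
    \<rho> then vanishes almost everywhere, and that case is settled separately below.\<close>
  define E3 where "E3 = (if J = 0 then {} else {X\<in>space (sample_law n M).
      ennreal (J * exp x * likelihood p n t X) \<le> mixture n (\<lambda>\<theta>. ennreal (\<rho> \<theta> powr W)) X})"
  have E_sets [measurable]: "E1 \<in> sets (sample_law n M)" "E2 \<in> sets (sample_law n M)"
      "E3 \<in> sets (sample_law n M)"
    unfolding E1_def E2_def E3_def by simp_all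
  have E1: "emeasure (sampling n t) E1 \<le> ennreal (1 / x)"
    using Y_prob by (simp add: S.emeasure_eq_measure E1_def ennreal_leI)
  have E2: "emeasure (sampling n t) E2 \<le> ennreal (3 * exp (- x))"
  proof -
    have "emeasure (sampling n t) E2 \<le> (\<integral>\<^sup>+X. ennreal (\<phi> X) \<partial>sampling n t) + ennreal (1 / exp (- (C + 3) * x)) *
        (\<integral>\<^sup>+\<theta>. indicator F \<theta> * (\<integral>\<^sup>+X. ennreal (1 - \<phi> X) \<partial>sampling n \<theta>) \<partial>\<pi>)"
      unfolding E2_def by (rule mixture_Markov[OF t _ _ \<phi>m \<phi>]) auto
    also have "\<dots> \<le> ennreal (exp (- x)) + ennreal (1 / exp (- (C + 3) * x)) * ennreal (2 * exp (- (C + 4) * x))"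
      by (intro add_mono mult_left_mono level power) auto
    also have "\<dots> = ennreal (exp (- x) + 1 / exp (- (C + 3) * x) * (2 * exp (- (C + 4) * x)))"
      by (subst ennreal_mult[symmetric]) (auto simp del: ennreal_plus simp: ennreal_plus[symmetric])
    also have "1 / exp (- (C + 3) * x) * (2 * exp (- (C + 4) * x)) = 2 * exp (- x)"
    proof -
      have "exp (- (C + 4) * x) = exp (- x) * exp (- (C + 3) * x)"
        by (simp add: exp_add[symmetric] algebra_simps)
      then show ?thesis by simp
    qed
    finally show ?thesis by simp
  qed
  have E3: "emeasure (sampling n t) E3 \<le> ennreal (exp (- x))"
  proof (cases "J = 0")
    case False
    then have J': "0 < J" using J by simp
    have "emeasure (sampling n t) E3 \<le> (\<integral>\<^sup>+X. ennreal 0 \<partial>sampling n t) + ennreal (1 / (J * exp x)) *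
        (\<integral>\<^sup>+\<theta>. ennreal (\<rho> \<theta> powr W) * (\<integral>\<^sup>+X. ennreal (1 - 0) \<partial>sampling n \<theta>) \<partial>\<pi>)"
      unfolding E3_def using False J' by (simp only: if_False) (rule mixture_Markov[OF t], auto)
    also have "(\<integral>\<^sup>+\<theta>. ennreal (\<rho> \<theta> powr W) * (\<integral>\<^sup>+X. ennreal (1 - 0) \<partial>sampling n \<theta>) \<partial>\<pi>) =
        (\<integral>\<^sup>+\<theta>. ennreal (\<rho> \<theta> powr W) \<partial>\<pi>)"
      using prob_space.emeasure_space_1[OF prob_space_sampling] by (intro nn_integral_cong) simp
    also have "\<dots> = ennreal J"
      unfolding J_def using \<rho>W by (intro nn_integral_eq_integral) auto
    also have "(\<integral>\<^sup>+X. ennreal 0 \<partial>sampling n t) + ennreal (1 / (J * exp x)) * ennreal J = ennreal (exp (- x))"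
      using J' by (simp add: ennreal_mult[symmetric] exp_minus inverse_eq_divide)
    finally show ?thesis .
  qed (simp add: E3_def)
  let ?N = "N0 \<union> E1 \<union> E2 \<union> E3"
  have "emeasure (sampling n t) ?N \<le> emeasure (sampling n t) N0 + emeasure (sampling n t) E1
      + emeasure (sampling n t) E2 + emeasure (sampling n t) E3"
    using N0(3) by (intro order.trans[OF emeasure_subadditive] add_mono order_refl) auto
  also have "\<dots> \<le> 0 + ennreal (1 / x) + ennreal (3 * exp (- x)) + ennreal (exp (- x))"
    by (intro add_mono E1 E2 E3) (simp add: N0(2))
  also have "\<dots> = ennreal (1 / x + 4 * exp (- x))"
    using x by (simp add: ennreal_plus[symmetric] del: ennreal_plus)
  finally have N: "emeasure (sampling n t) ?N \<le> ennreal (1 / x + 4 * exp (- x))" .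
  have good: "prob_space (posterior p \<pi> n X) \<and>
      (\<integral>\<^sup>+\<theta>. ennreal (\<rho> \<theta>) \<partial>posterior p \<pi> n X) \<le> ennreal (a + \<Delta> * exp (- x / 2))"
    if X: "X \<in> space (sampling n t) - ?N" for X
  proof
    let ?q = "likelihood p n t X"
    have Xs: "X \<in> space (sample_law n M)" using X by simp
    have PX: "?P X" using X N0(1) by blast
    then have q: "0 < ?q" and fin: "mixture n (\<lambda>_. 1) X < \<infinity>" by auto
    have "- 2 * x < Y X"
      using X Xs by (auto simp: E1_def)
    then have "exp (- C * x) * exp (- 2 * x) \<le> b * exp (Y X)"
      using b by (intro mult_mono) (auto intro: order.trans[OF _ b])
    then have "exp (- (C + 2) * x) \<le> b * exp (Y X)"
      by (simp add: exp_add[symmetric] algebra_simps)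
    then have "ennreal (exp (- (C + 2) * x) * ?q) \<le> ennreal (b * exp (Y X) * ?q)"
      using q by (intro ennreal_leI mult_right_mono) auto
    also have "\<dots> \<le> mixture n (\<lambda>_. 1) X"
      using PX by simp
    finally have ev: "ennreal (exp (- (C + 2) * x) * ?q) \<le> mixture n (\<lambda>_. 1) X" .
    have "0 < ennreal (exp (- (C + 2) * x) * ?q)"
      using q by simp
    then have Zpos: "0 < mixture n (\<lambda>_. 1) X"
      using ev by (rule less_le_trans)
    then show "prob_space (posterior p \<pi> n X)"
      by (intro prob_space_posterior[OF Xs] fin)
    show "(\<integral>\<^sup>+\<theta>. ennreal (\<rho> \<theta>) \<partial>posterior p \<pi> n X) \<le> ennreal (a + \<Delta> * exp (- x / 2))"
    proof (cases "J = 0")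
      case True
      then have "AE \<theta> in \<pi>. \<rho> \<theta> powr W = 0"
        using integral_nonneg_eq_0_iff_AE[OF \<rho>W] by (simp add: J_def)
      then have "AE \<theta> in \<pi>. \<rho> \<theta> = 0"
        by eventually_elim simp
      then have "mixture n (\<lambda>\<theta>. ennreal (\<rho> \<theta>)) X = (\<integral>\<^sup>+\<theta>. 0 \<partial>\<pi>)"
        unfolding mixture_def by (intro nn_integral_cong_AE) auto
      then show ?thesis
        by (subst nn_integral_posterior[OF Xs]) auto
    next
      case False
      then have "\<Delta> \<noteq> 0"
        using \<Delta>J W0 by auto
      then have \<Delta>': "0 < \<Delta>"
        using \<Delta>0 by simp
      show ?thesis
      proof (rule posterior_integral_bound[OF Xs \<rho>m F \<rho> near a \<Delta>' _ C W q fin ev])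
        show "0 \<le> x" using x by simp
        show "mixture n (indicator F) X \<le> ennreal (exp (- (C + 3) * x) * ?q)"
          using X Xs by (auto simp: E2_def)
        show "mixture n (\<lambda>\<theta>. ennreal (\<rho> \<theta> powr W)) X \<le> ennreal (\<Delta> powr W * exp x * ?q)"
          using X Xs False unfolding \<Delta>J by (auto simp: E3_def)
      qed
    qed
  qed
  have "?N \<in> sets (sampling n t)"
    using N0(3) by simp
  with N good show ?thesis
    by blast
qed

text \<open>Continuity from above: the events that the posterior integral exceeds \<open>K\<close>
  decrease to a null set. No rate is claimed.\<close>

lemma posterior_tail:
  fixes \<rho> :: "'a \<Rightarrow> real"
  assumes t: "t \<in> space \<pi>"
    and \<rho>m [measurable]: "\<rho> \<in> borel_measurable \<pi>"
    and \<rho>1: "(\<integral>\<^sup>+\<theta>. ennreal (\<rho> \<theta>) \<partial>\<pi>) < \<infinity>"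
    and pos: "AE X in sampling n t. 0 < mixture n (\<lambda>_. 1) X"
    and \<eta>: "0 < \<eta>"
  shows "\<exists>K. \<exists>N\<in>sets (sampling n t). emeasure (sampling n t) N \<le> \<eta> \<and>
    (\<forall>X\<in>space (sampling n t) - N. prob_space (posterior p \<pi> n X) \<and>
      (\<integral>\<^sup>+\<theta>. ennreal (\<rho> \<theta>) \<partial>posterior p \<pi> n X) \<le> ennreal (real K))"
proof -
  interpret S: prob_space "sampling n t"
    by (rule prob_space_sampling[OF t])
  define T where "T X = mixture n (\<lambda>\<theta>. ennreal (\<rho> \<theta>)) X / mixture n (\<lambda>_. 1) X" for X
  have [measurable]: "T \<in> borel_measurable (sample_law n M)"
    unfolding T_def[abs_def] by measurable
  let ?P = "\<lambda>X. 0 < mixture n (\<lambda>_. 1) X \<and> mixture n (\<lambda>_. 1) X < \<infinity> \<and> T X < \<infinity>"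
  have "AE X in sampling n t. mixture n (\<lambda>_. 1) X < \<infinity>"
    by (rule AE_sampling_mixture_finite[OF t borel_measurable_const]) (simp add: prior.emeasure_space_1)
  moreover have "AE X in sampling n t. mixture n (\<lambda>\<theta>. ennreal (\<rho> \<theta>)) X < \<infinity>"
    by (rule AE_sampling_mixture_finite[OF t _ \<rho>1]) simp
  ultimately have ae: "AE X in sampling n t. ?P X"
    using pos by eventually_elim (auto simp: T_def less_top[symmetric] ennreal_divide_eq_top_iff)
  then obtain N0 where N0: "{X\<in>space (sampling n t). \<not> ?P X} \<subseteq> N0"
      "emeasure (sampling n t) N0 = 0" "N0 \<in> sets (sampling n t)"
    by (rule AE_E)
  define A where "A K = {X\<in>space (sampling n t). ennreal (real K) < T X}" for K
  have A [measurable]: "A K \<in> sets (sampling n t)" for K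
    unfolding A_def by measurable
  have "(\<lambda>K. emeasure (sampling n t) (A K)) \<longlonglongrightarrow> emeasure (sampling n t) (\<Inter>K. A K)"
  proof (rule Lim_emeasure_decseq)
    show "decseq A"
    proof (rule decseq_SucI, rule subsetI)
      fix K X assume "X \<in> A (Suc K)"
      moreover have "ennreal (real K) \<le> ennreal (real (Suc K))"
        by (rule ennreal_leI) simp
      ultimately show "X \<in> A K"
        unfolding A_def by (blast intro: le_less_trans)
    qed
  qed (use A in auto)
  moreover have "emeasure (sampling n t) (\<Inter>K. A K) = 0"
  proof -
    have "(\<Inter>K. A K) \<subseteq> N0"
    proof
      fix X assume XA: "X \<in> (\<Inter>K. A K)"
      then have Xs: "X \<in> space (sampling n t)"
        by (auto simp: A_def)
      have "\<not> T X < \<infinity>"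
      proof
        assume "T X < \<infinity>"
        then obtain K :: nat where "T X < of_nat K"
          using ennreal_Ex_less_of_nat by auto
        moreover have "of_nat K < T X"
          using XA by (auto simp: A_def ennreal_of_nat_eq_real_of_nat)
        ultimately show False
          by simp
      qed
      then show "X \<in> N0"
        using N0(1) Xs by blast
    qed
    then have "emeasure (sampling n t) (\<Inter>K. A K) \<le> emeasure (sampling n t) N0"
      by (rule emeasure_mono[OF _ N0(3)])
    then show ?thesis
      using N0(2) by simp
  qed
  ultimately have "eventually (\<lambda>K. emeasure (sampling n t) (A K) < \<eta>) sequentially"
    using \<eta> by (intro order_tendstoD(2)) auto
  then obtain K where K: "emeasure (sampling n t) (A K) < \<eta>"
    by (auto simp: eventually_sequentially)
  have "emeasure (sampling n t) (N0 \<union> A K) \<le> emeasure (sampling n t) N0 + emeasure (sampling n t) (A K)"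
    by (rule emeasure_subadditive[OF N0(3) A])
  then have N: "emeasure (sampling n t) (N0 \<union> A K) \<le> \<eta>"
    using K N0(2) by simp
  have good: "prob_space (posterior p \<pi> n X) \<and>
      (\<integral>\<^sup>+\<theta>. ennreal (\<rho> \<theta>) \<partial>posterior p \<pi> n X) \<le> ennreal (real K)"
    if X: "X \<in> space (sampling n t) - (N0 \<union> A K)" for X
  proof -
    have Xs: "X \<in> space (sample_law n M)" using X by simp
    have "?P X" using X N0(1) by blast
    then have "prob_space (posterior p \<pi> n X)"
      by (intro prob_space_posterior[OF Xs]) auto
    moreover have "T X \<le> ennreal (real K)"
      using X by (auto simp: A_def)
    moreover have "(\<integral>\<^sup>+\<theta>. ennreal (\<rho> \<theta>) \<partial>posterior p \<pi> n X) = T X"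
      unfolding T_def by (intro nn_integral_posterior[OF Xs]) measurable
    ultimately show ?thesis
      by simp
  qed
  have "N0 \<union> A K \<in> sets (sampling n t)"
    by (rule sets.Un[OF N0(3) A])
  with N good show ?thesis
    by blast
qed

end

section \<open>The contraction rate\<close>

text \<open>The choice of \<open>d\<close> enters only through \<open>tests\<close>,
  \<open>met\<close> and \<open>link\<close>, so both distances are treated at once.\<close>

locale contraction_setting =
  fixes D :: nat and \<Theta> :: "'a set" and p \<theta>\<^sub>0 k H ip d and \<gamma> Ct \<kappa> C r W :: real and \<pi>
  assumes model: "statistical_model D \<Theta> p" and \<theta>\<^sub>0: "\<theta>\<^sub>0 \<in> \<Theta>"
    and kernel: "characteristic_kernel (param_borel D \<Theta> p) k H ip"
    and tests: "separation_tests \<kappa> (1/10) (leb D) \<Theta> p d" and met: "Metric_space \<Theta> d"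
    and \<kappa>: "0 < \<kappa>" and \<gamma>: "0 < \<gamma>" and Ct: "0 < Ct" and C: "0 < C"
    and link: "\<And>\<theta>. \<theta> \<in> \<Theta> \<Longrightarrow> d \<theta> \<theta>\<^sub>0 \<le> r \<Longrightarrow>
      Ct * kernel_distance \<Theta> k ip \<theta> \<theta>\<^sub>0 powr \<gamma> \<le> d \<theta> \<theta>\<^sub>0"
    and prior: "prior (param_borel D \<Theta> p) \<pi>"
    and W: "2 * C + 8 \<le> W"
    and \<rho>W: "integrable \<pi> (\<lambda>\<theta>. kernel_distance \<Theta> k ip \<theta> \<theta>\<^sub>0 powr W)"
begin

abbreviation "\<rho> \<theta> \<equiv> kernel_distance \<Theta> k ip \<theta> \<theta>\<^sub>0"

abbreviation "dev \<equiv> deviation_prob D \<Theta> p \<theta>\<^sub>0 (unit_ball H ip) \<pi>"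

lemma space_param_borel: "space (param_borel D \<Theta> p) = \<Theta>"
  by (simp add: param_borel_def space_measure_of_conv)

lemma sets_prior: "sets \<pi> = sets (param_borel D \<Theta> p)"
  using prior by (simp add: prior_def)

lemma space_prior: "space \<pi> = \<Theta>"
  using sets_eq_imp_space_eq[OF sets_prior] space_param_borel by simp

sublocale dominated_model "leb D" \<pi> p
proof -
  have "sigma_finite_measure (leb D)"
    unfolding leb_def
    by (intro product_sigma_finite.sigma_finite product_sigma_finite_const sigma_finite_lborel) simp
  moreover have "prob_space \<pi>"
    using prior by (simp add: prior_def)
  moreover have "(\<lambda>(\<theta>, x). p \<theta> x) \<in> borel_measurable (\<pi> \<Otimes>\<^sub>M leb D)"
    using model unfolding statistical_model_def
    by (simp add: measurable_cong_sets[OF sets_pair_measure_cong[OF sets_prior refl] refl])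
  moreover have "0 \<le> p \<theta> x" if "\<theta> \<in> space \<pi>" "x \<in> space (leb D)" for \<theta> x
    using model that unfolding statistical_model_def space_prior by blast
  moreover have "prob_space (density (leb D) (\<lambda>x. ennreal (p \<theta> x)))" if "\<theta> \<in> space \<pi>" for \<theta>
    using model that unfolding statistical_model_def space_prior law_def by blast
  ultimately show "dominated_model (leb D) \<pi> p"
    by (intro dominated_model.intro dominated_model_axioms.intro) auto
qed

lemma rkhs: "is_rkhs \<Theta> k H ip"
  using kernel by (simp add: characteristic_kernel_def space_param_borel)

lemma sections: "\<theta> \<in> \<Theta> \<Longrightarrow> (\<lambda>x. k x \<theta>) \<in> borel_measurable (param_borel D \<Theta> p)"
  using kernel by (simp add: characteristic_kernel_def space_param_borel)

lemma \<rho>_nonneg: "\<theta> \<in> space \<pi> \<Longrightarrow> 0 \<le> \<rho> \<theta>"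
  using kernel_distance_nonneg[OF rkhs _ \<theta>\<^sub>0] by (simp add: space_prior)

text \<open>Read off the moment assumption: integrability of the W-th power includes its
  measurability, and \<rho> is the W-th root of that power since it is nonnegative.\<close>

lemma \<rho>_measurable: "\<rho> \<in> borel_measurable \<pi>"
proof -
  have [measurable]: "(\<lambda>\<theta>. \<rho> \<theta> powr W) \<in> borel_measurable \<pi>"
    using \<rho>W by auto
  have "(\<lambda>\<theta>. (\<rho> \<theta> powr W) powr (1 / W)) \<in> borel_measurable \<pi>"
    by measurable
  then show ?thesis
    by (rule measurable_cong[THEN iffD1, rotated]) (use \<rho>_nonneg W C in \<open>simp add: powr_powr\<close>)
qed

lemma nn_integral_\<rho>: "(\<integral>\<^sup>+\<theta>. ennreal (\<rho> \<theta>) \<partial>\<pi>) < \<infinity>"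
proof -
  have "(\<integral>\<^sup>+\<theta>. ennreal (\<rho> \<theta>) \<partial>\<pi>) \<le> (\<integral>\<^sup>+\<theta>. ennreal (1 + \<rho> \<theta> powr W) \<partial>\<pi>)"
  proof (intro nn_integral_mono ennreal_leI)
    fix \<theta> assume "\<theta> \<in> space \<pi>"
    then have "0 \<le> \<rho> \<theta>"
      by (rule \<rho>_nonneg)
    moreover have "\<rho> \<theta> powr 1 \<le> \<rho> \<theta> powr W" if "1 \<le> \<rho> \<theta>"
      using that W C by (intro powr_mono) auto
    ultimately show "\<rho> \<theta> \<le> 1 + \<rho> \<theta> powr W"
      by (cases "1 \<le> \<rho> \<theta>") (auto intro: add_increasing2)
  qed
  also have "\<dots> = ennreal (\<integral>\<theta>. 1 + \<rho> \<theta> powr W \<partial>\<pi>)"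
    using \<rho>W by (intro nn_integral_eq_integral) auto
  also have "\<dots> < \<infinity>"
    by simp
  finally show ?thesis .
qed

lemma sampling_eq: "sampling n \<theta> = sample_law n (law D p \<theta>)"
  by (simp add: sampling_def law_def)

text \<open>The deviation event is covered by the measurable set \<open>N\<close>, never shown
  measurable itself. The strict \<open>c < b\<close> answers the non-strict inequality that defines
  the event.\<close>

lemma deviation_le:
  assumes N: "N \<in> sets (sampling n \<theta>\<^sub>0)" "emeasure (sampling n \<theta>\<^sub>0) N \<le> \<eta>"
    and good: "\<And>X. X \<in> space (sampling n \<theta>\<^sub>0) - N \<Longrightarrow> prob_space (posterior p \<pi> n X) \<and>
      (\<integral>\<^sup>+\<theta>. ennreal (\<rho> \<theta>) \<partial>posterior p \<pi> n X) \<le> ennreal c"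
    and c: "0 \<le> c" "c < b"
  shows "dev n b \<le> \<eta>"
proof -
  let ?B = "param_borel D \<Theta> p"
  let ?A = "{X\<in>space (sampling n \<theta>\<^sub>0). ennreal b \<le> ipm (unit_ball H ip) (return ?B \<theta>\<^sub>0) (posterior p \<pi> n X)}"
  have "?A \<subseteq> N"
  proof (rule subsetI, rule ccontr)
    fix X assume X: "X \<in> ?A" "X \<notin> N"
    then have g: "prob_space (posterior p \<pi> n X)"
        "(\<integral>\<^sup>+\<theta>. ennreal (\<rho> \<theta>) \<partial>posterior p \<pi> n X) \<le> ennreal c"
      using good by auto
    have "sets (posterior p \<pi> n X) = sets ?B"
      by (simp add: posterior_def sets_prior)
    then have "ipm (unit_ball H ip) (return ?B \<theta>\<^sub>0) (posterior p \<pi> n X) \<le> ennreal c"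
      using ipm_return_le[OF rkhs space_param_borel sections \<theta>\<^sub>0 g(1)] g(2) by (meson order.trans)
    moreover have "ennreal c < ennreal b"
      using c by (intro ennreal_lessI) auto
    ultimately show False
      using X by auto
  qed
  then have "outer_measure_of (sampling n \<theta>\<^sub>0) ?A \<le> outer_measure_of (sampling n \<theta>\<^sub>0) N"
    by (rule outer_measure_of_mono)
  also have "\<dots> \<le> \<eta>"
    using N by simp
  finally show ?thesis
    by (simp add: deviation_prob_def sampling_eq[symmetric] Let_def)
qed

lemma deviation_antimono: "b \<le> b' \<Longrightarrow> dev n b' \<le> dev n b"
  unfolding deviation_prob_def Let_def
  by (intro outer_measure_of_mono) (auto intro: order.trans[OF ennreal_leI])

lemma evidence:
  assumes rate: "rate_conditions C D \<Theta> p \<theta>\<^sub>0 d \<pi> n e Y" and n: "1 \<le> n"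
  shows "\<exists>Y\<in>borel_measurable (sample_law n (leb D)). \<exists>b\<ge>exp (- C * (real n * e\<^sup>2)).
    measure (sampling n \<theta>\<^sub>0) {X\<in>space (sample_law n (leb D)). Y X \<le> - 2 * (real n * e\<^sup>2)} \<le> 1 / (real n * e\<^sup>2) \<and>
    (AE X in sampling n \<theta>\<^sub>0. ennreal (b * exp (Y X) * likelihood p n \<theta>\<^sub>0 X) \<le> mixture n (\<lambda>_. 1) X)"
proof -
  let ?B = "kl_neighbourhood D \<Theta> p \<theta>\<^sub>0 e"
  have e: "0 < e" and mB: "exp (- C * real n * e\<^sup>2) \<le> measure \<pi> ?B"
    using rate by (auto simp: rate_conditions_def)
  then have mB0: "0 < measure \<pi> ?B"
    by (meson exp_gt_zero less_le_trans)
  \<comment> \<open>Measurability comes for free: a non-measurable set has measure 0 by default,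
    which the prior mass condition excludes.\<close>
  then have B: "?B \<in> sets \<pi>"
    by (metis less_irrefl measure_notin_sets)
  have "\<exists>Y\<in>borel_measurable (sample_law n (leb D)).
    measure (sampling n \<theta>\<^sub>0) {X\<in>space (sample_law n (leb D)). Y X \<le> - 2 * real n * e\<^sup>2} \<le> 1 / (real n * e\<^sup>2) \<and>
    (AE X in sampling n \<theta>\<^sub>0.
       ennreal (measure \<pi> ?B * exp (Y X) * likelihood p n \<theta>\<^sub>0 X) \<le> mixture n (\<lambda>_. 1) X)"
  proof (rule evidence_lower_bound[OF _ B mB0])
    fix \<theta> assume "\<theta> \<in> ?B"
    then show "AE x in density (leb D) (\<lambda>x. ennreal (p \<theta>\<^sub>0 x)). 0 < p \<theta> x"
      "integrable (density (leb D) (\<lambda>x. ennreal (p \<theta>\<^sub>0 x))) (\<lambda>x. (ln (p \<theta> x / p \<theta>\<^sub>0 x))\<^sup>2)"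
      "- (\<integral>x. ln (p \<theta> x / p \<theta>\<^sub>0 x) \<partial>density (leb D) (\<lambda>x. ennreal (p \<theta>\<^sub>0 x))) \<le> e\<^sup>2"
      "(\<integral>x. (ln (p \<theta> x / p \<theta>\<^sub>0 x))\<^sup>2 \<partial>density (leb D) (\<lambda>x. ennreal (p \<theta>\<^sub>0 x))) \<le> e\<^sup>2"
      unfolding kl_neighbourhood_def law_def by blast+
  qed (use e n \<theta>\<^sub>0 in \<open>auto simp: space_prior\<close>)
  then show ?thesis
    using mB by (auto simp: mult.assoc)
qed

lemma rate_bound:
  assumes rate: "rate_conditions C D \<Theta> p \<theta>\<^sub>0 d \<pi> n e Y" and n: "1 \<le> n"
    and R1: "22 \<le> R1" "C + 4 \<le> \<kappa> * (R1 - 2)\<^sup>2" and R: "R1 \<le> R" "(R1 / Ct) powr (1 / \<gamma>) < R"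
    and r: "R * e \<le> r"
  shows "dev n (R * e powr (1 / \<gamma>) +
      (\<integral>\<theta>. \<rho> \<theta> powr W \<partial>\<pi>) powr (1 / W) * exp (- (real n * e\<^sup>2) / 2))
    \<le> ennreal (1 / (real n * e\<^sup>2) + 4 * exp (- (real n * e\<^sup>2)))"
proof -
  let ?x = "real n * e\<^sup>2"
  define \<Delta> where "\<Delta> = (\<integral>\<theta>. \<rho> \<theta> powr W \<partial>\<pi>) powr (1 / W)"
  \<comment> \<open>The \<rho>-radius that the link assigns to \<open>d\<close>-distance
    \<open>R1 * e\<close>.\<close>
  define a where "a = (R1 * e / Ct) powr (1 / \<gamma>)"
  have e: "0 < e" and Ys: "Y \<in> sets \<pi>" and fin: "packing_number e Y d \<noteq> \<infinity>"
    and entropy: "ln (real (the_enat (packing_number e Y d))) \<le> ?x"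
    and sieve: "measure \<pi> (\<Theta> - Y) \<le> exp (- (C + 4) * ?x)"
    using rate by (auto simp: rate_conditions_def algebra_simps)
  have x: "0 < ?x"
    using e n by simp
  have t: "\<theta>\<^sub>0 \<in> space \<pi>"
    by (simp add: space_prior \<theta>\<^sub>0)
  have YsubT: "Y \<subseteq> space \<pi>"
    using sets.sets_into_space[OF Ys] .
  obtain \<phi> where \<phi>m [measurable]: "\<phi> \<in> borel_measurable (sample_law n (leb D))"
    and \<phi>: "\<And>X. X \<in> space (sample_law n (leb D)) \<Longrightarrow> 0 \<le> \<phi> X \<and> \<phi> X \<le> 1"
    and level: "(\<integral>\<^sup>+X. ennreal (\<phi> X) \<partial>sampling n \<theta>\<^sub>0) \<le> ennreal (exp ((1 - (C + 4)) * ?x))"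
    and far: "\<And>\<theta>. \<theta> \<in> Y \<Longrightarrow> R1 * e \<le> d \<theta> \<theta>\<^sub>0 \<Longrightarrow>
       (\<integral>\<^sup>+X. ennreal (1 - \<phi> X) \<partial>sampling n \<theta>) \<le> ennreal (exp (- (C + 4) * ?x))"
    using combined_test[OF tests[folded space_prior] met[folded space_prior] t YsubT e \<kappa> fin entropy R1]
    by blast
  have [measurable]: "(\<lambda>\<theta>. \<integral>\<^sup>+X. ennreal (1 - \<phi> X) \<partial>sampling n \<theta>) \<in> borel_measurable \<pi>"
    by (rule nn_integral_sampling_measurable) measurable
  \<comment> \<open>\<open>G\<close> stands in for \<open>{\<theta>. R1 * e \<le> d \<theta> \<theta>\<^sub>0}\<close>, which need not be measurable: the Euclidean
    distance is not related to the Hellinger Borel sets.\<close>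
  define G where "G = {\<theta>\<in>space \<pi>. (\<integral>\<^sup>+X. ennreal (1 - \<phi> X) \<partial>sampling n \<theta>) \<le> ennreal (exp (- (C + 4) * ?x))}"
  define U where "U = space \<pi> - Y"
  have [measurable]: "G \<in> sets \<pi>" "U \<in> sets \<pi>"
    unfolding G_def U_def using Ys by measurable
  have near: "\<rho> \<theta> \<le> a" if \<theta>: "\<theta> \<in> space \<pi>" "\<theta> \<notin> G \<union> U" for \<theta>
  proof -
    have "\<theta> \<in> Y"
      using \<theta> by (auto simp: U_def)
    then have d: "d \<theta> \<theta>\<^sub>0 < R1 * e"
      using far[of \<theta>] \<theta> by (force simp: G_def)
    also have "\<dots> \<le> R * e"
      using R e by (intro mult_right_mono) auto
    finally have "Ct * \<rho> \<theta> powr \<gamma> \<le> d \<theta> \<theta>\<^sub>0"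
      using r \<theta> by (intro link) (auto simp: space_prior)
    then have "\<rho> \<theta> powr \<gamma> \<le> R1 * e / Ct"
      using d Ct by (simp add: field_simps)
    then have "(\<rho> \<theta> powr \<gamma>) powr (1 / \<gamma>) \<le> a"
      unfolding a_def using \<gamma> by (intro powr_mono2) auto
    then show ?thesis
      using \<rho>_nonneg[OF \<theta>(1)] \<gamma> by (simp add: powr_powr)
  qed
  \<comment> \<open>On \<open>G\<close> the test is good by definition; on \<open>U\<close> its
    error is bounded by 1 and the sieve condition pays. Each contributes one of the two
    terms.\<close>
  have power: "(\<integral>\<^sup>+\<theta>. indicator (G \<union> U) \<theta> * (\<integral>\<^sup>+X. ennreal (1 - \<phi> X) \<partial>sampling n \<theta>) \<partial>\<pi>)
      \<le> ennreal (2 * exp (- (C + 4) * ?x))"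
  proof -
    have "(\<integral>\<^sup>+\<theta>. indicator (G \<union> U) \<theta> * (\<integral>\<^sup>+X. ennreal (1 - \<phi> X) \<partial>sampling n \<theta>) \<partial>\<pi>) \<le>
        (\<integral>\<^sup>+\<theta>. ennreal (exp (- (C + 4) * ?x)) + indicator U \<theta> \<partial>\<pi>)"
    proof (rule nn_integral_mono)
      fix \<theta> assume \<theta>: "\<theta> \<in> space \<pi>"
      have "(\<integral>\<^sup>+X. ennreal (1 - \<phi> X) \<partial>sampling n \<theta>) \<le> (\<integral>\<^sup>+X. 1 \<partial>sampling n \<theta>)"
        using \<phi> by (intro nn_integral_mono) (auto simp: ennreal_le_1)
      also have "\<dots> = 1"
        using prob_space.emeasure_space_1[OF prob_space_sampling[OF \<theta>]] by simp
      finally have "(\<integral>\<^sup>+X. ennreal (1 - \<phi> X) \<partial>sampling n \<theta>) \<le> 1" .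
      then show "indicator (G \<union> U) \<theta> * (\<integral>\<^sup>+X. ennreal (1 - \<phi> X) \<partial>sampling n \<theta>) \<le>
          ennreal (exp (- (C + 4) * ?x)) + indicator U \<theta>"
        by (cases "\<theta> \<in> U"; cases "\<theta> \<in> G") (auto simp: G_def intro: add_increasing add_increasing2)
    qed
    also have "\<dots> = ennreal (exp (- (C + 4) * ?x)) + ennreal (measure \<pi> U)"
      by (subst nn_integral_add) (auto simp: prior.emeasure_space_1 prior.emeasure_eq_measure prior.prob_space)
    also have "\<dots> \<le> ennreal (exp (- (C + 4) * ?x)) + ennreal (exp (- (C + 4) * ?x))"
      using sieve by (intro add_left_mono ennreal_leI) (simp add: U_def space_prior)
    also have "\<dots> = ennreal (2 * exp (- (C + 4) * ?x))"
      by (simp add: ennreal_plus[symmetric] del: ennreal_plus)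
    finally show ?thesis .
  qed
  obtain Z b where Z: "Z \<in> borel_measurable (sample_law n (leb D))" "exp (- C * ?x) \<le> b"
    "measure (sampling n \<theta>\<^sub>0) {X\<in>space (sample_law n (leb D)). Z X \<le> - 2 * ?x} \<le> 1 / ?x"
    "AE X in sampling n \<theta>\<^sub>0. ennreal (b * exp (Z X) * likelihood p n \<theta>\<^sub>0 X) \<le> mixture n (\<lambda>_. 1) X"
    using evidence[OF rate n] by blast
  have level': "(\<integral>\<^sup>+X. ennreal (\<phi> X) \<partial>sampling n \<theta>\<^sub>0) \<le> ennreal (exp (- ?x))"
  proof (rule order.trans[OF level], rule ennreal_leI)
    have "(1 - (C + 4)) * ?x \<le> (- 1) * ?x"
      using x C by (intro mult_right_mono) auto
    then show "exp ((1 - (C + 4)) * ?x) \<le> exp (- ?x)"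
      by simp
  qed
  have a0: "0 \<le> a" and C0: "0 \<le> C" and GU: "G \<union> U \<in> sets \<pi>"
    using C by (auto simp: a_def)
  obtain N where N: "N \<in> sets (sampling n \<theta>\<^sub>0)"
    "emeasure (sampling n \<theta>\<^sub>0) N \<le> ennreal (1 / ?x + 4 * exp (- ?x))"
    "\<And>X. X \<in> space (sampling n \<theta>\<^sub>0) - N \<Longrightarrow> prob_space (posterior p \<pi> n X) \<and>
      (\<integral>\<^sup>+\<theta>. ennreal (\<rho> \<theta>) \<partial>posterior p \<pi> n X) \<le> ennreal (a + \<Delta> * exp (- ?x / 2))"
    using posterior_concentration[OF t \<rho>_measurable \<rho>_nonneg \<rho>W \<Delta>_def GU near a0 x C0 W
        Z(1,3,2,4) \<phi>m \<phi> level' power] by blast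
  have "a = (R1 / Ct) powr (1 / \<gamma>) * e powr (1 / \<gamma>)"
    unfolding a_def using R1 Ct e by (simp add: powr_mult[symmetric])
  also have "\<dots> < R * e powr (1 / \<gamma>)"
    using R(2) e by (intro mult_strict_right_mono) auto
  finally have "a + \<Delta> * exp (- ?x / 2) < R * e powr (1 / \<gamma>) + \<Delta> * exp (- ?x / 2)"
    by simp
  moreover have "0 \<le> a + \<Delta> * exp (- ?x / 2)"
    using a0 by (simp add: \<Delta>_def)
  ultimately show ?thesis
    unfolding \<Delta>_def[symmetric] by (intro deviation_le[OF N]) auto
qed

text \<open>For a single sample size whose \<epsilon> is too large for the local link. The allowed
  probability \<eta> is positive, so almost sure finiteness suffices once \<open>R\<close> may
  depend on the sample size.\<close>

lemma tail_bound:
  assumes rate: "rate_conditions C D \<Theta> p \<theta>\<^sub>0 d \<pi> n e Y" and n: "1 \<le> n" and \<eta>: "0 < \<eta>" and \<Delta>: "0 \<le> \<Delta>"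
  shows "\<exists>R'. \<forall>R\<ge>R'. dev n (R * e powr (1 / \<gamma>) + \<Delta>) \<le> \<eta>"
proof -
  have e: "0 < e"
    using rate by (simp add: rate_conditions_def)
  have t: "\<theta>\<^sub>0 \<in> space \<pi>"
    by (simp add: space_prior \<theta>\<^sub>0)
  obtain Z b where b: "exp (- C * (real n * e\<^sup>2)) \<le> b"
    and Z: "AE X in sampling n \<theta>\<^sub>0. ennreal (b * exp (Z X) * likelihood p n \<theta>\<^sub>0 X) \<le> mixture n (\<lambda>_. 1) X"
    using evidence[OF rate n] by blast
  have "0 < b"
    using b by (meson exp_gt_zero less_le_trans)
  have "AE X in sampling n \<theta>\<^sub>0. 0 < mixture n (\<lambda>_. 1) X"
    using AE_sampling_likelihood_pos[OF t, of n] Z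
  proof eventually_elim
    case (elim X)
    have "0 < ennreal (b * exp (Z X) * likelihood p n \<theta>\<^sub>0 X)"
      using elim(1) \<open>0 < b\<close> by simp
    then show ?case
      using elim(2) by (rule less_le_trans)
  qed
  from posterior_tail[OF t \<rho>_measurable nn_integral_\<rho> this \<eta>]
  obtain K N where N: "N \<in> sets (sampling n \<theta>\<^sub>0)" "emeasure (sampling n \<theta>\<^sub>0) N \<le> \<eta>"
    "\<And>X. X \<in> space (sampling n \<theta>\<^sub>0) - N \<Longrightarrow> prob_space (posterior p \<pi> n X) \<and>
      (\<integral>\<^sup>+\<theta>. ennreal (\<rho> \<theta>) \<partial>posterior p \<pi> n X) \<le> ennreal (real K)"
    by blast
  show ?thesis
  proof (intro exI allI impI)
    fix R assume "(real K + 1) / e powr (1 / \<gamma>) \<le> R"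
    then have "real K < R * e powr (1 / \<gamma>) + \<Delta>"
      using e \<Delta> by (simp add: field_simps)
    then show "dev n (R * e powr (1 / \<gamma>) + \<Delta>) \<le> \<eta>"
      by (intro deviation_le[OF N]) auto
  qed
qed

end

section \<open>Both distances under one testing condition, and the choice of constants\<close>

lemma separation_tests_of_distance:
  assumes model: "statistical_model D \<Theta> p"
    and d: "d = hellinger D p \<or>
      (\<exists>q c. euclidean_coords q \<Theta> c \<and> d = euclidean_distance q c \<and> test_condition K D \<Theta> p d)"
  shows "separation_tests (min K (1/10)) (1/10) (leb D) \<Theta> p d \<and> Metric_space \<Theta> d"
  using d
proof
  assume d: "d = hellinger D p"
  have met: "Metric_space \<Theta> d"
    using model d by (simp add: statistical_model_def)
  have M: "sigma_finite_measure (leb D)"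
    unfolding leb_def
    by (intro product_sigma_finite.sigma_finite product_sigma_finite_const sigma_finite_lborel) simp
  have "separation_tests (1/10) (1/10) (leb D) \<Theta> p d"
    unfolding d hellinger_def[abs_def]
    by (rule hellinger_separation_tests[OF M])
      (use model in \<open>auto simp: statistical_model_def law_def\<close>)
  then have "separation_tests (min K (1/10)) (1/10) (leb D) \<Theta> p d"
    by (rule separation_tests_mono) simp
  with met show ?thesis
    by blast
next
  assume "\<exists>q c. euclidean_coords q \<Theta> c \<and> d = euclidean_distance q c \<and> test_condition K D \<Theta> p d"
  then obtain q c where c: "euclidean_coords q \<Theta> c" "d = euclidean_distance q c" "test_condition K D \<Theta> p d"
    by blast
  have met: "Metric_space \<Theta> d"
    using euclidean_Metric_space c by simp
  then show ?thesis
    using separation_tests_mono[OF test_condition_imp_separation_tests[OF c(3)], of "1/10" "min K (1/10)"]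
    by (auto simp: Metric_space.nonneg)
qed

text \<open>Enlarging \<open>R\<close> shrinks the deviation event and leaves the right side
  unchanged, so finitely many exceptional sample sizes can share one constant. The factor 1 in the
  exponents is the value of \<open>Kt\<close>, kept to match the theorem.\<close>

lemma contraction_rates:
  fixes D :: nat and \<Theta> :: "'a set" and \<epsilon> :: "nat \<Rightarrow> real" and \<Theta>\<^sub>s :: "nat \<Rightarrow> 'a set"
  assumes setting: "contraction_setting D \<Theta> p \<theta>\<^sub>0 k H ip d \<gamma> Ct \<kappa> C r W \<pi>" and r: "0 < r"
    and R1: "22 \<le> R1" "C + 4 \<le> \<kappa> * (R1 - 2)\<^sup>2" and R: "R1 \<le> R" "(R1 / Ct) powr (1 / \<gamma>) < R"
  defines "bound \<equiv> \<lambda>R l. deviation_prob D \<Theta> p \<theta>\<^sub>0 (unit_ball H ip) \<pi> l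
      (R * \<epsilon> l powr (1 / \<gamma>) + (\<integral>\<theta>. kernel_distance \<Theta> k ip \<theta> \<theta>\<^sub>0 powr W \<partial>\<pi>) powr (1 / W) *
        exp (- 1 * real l * (\<epsilon> l)\<^sup>2 / 2))
    \<le> ennreal (1 / (real l * (\<epsilon> l)\<^sup>2) + 4 * exp (- 1 * real l * (\<epsilon> l)\<^sup>2))"
  shows "\<forall>l\<ge>1. rate_conditions C D \<Theta> p \<theta>\<^sub>0 d \<pi> l (\<epsilon> l) (\<Theta>\<^sub>s l) \<and> R * \<epsilon> l \<le> r \<longrightarrow> bound R l"
    and "\<epsilon> \<longlonglongrightarrow> 0 \<Longrightarrow>
      \<exists>R'>0. \<forall>l\<ge>1. rate_conditions C D \<Theta> p \<theta>\<^sub>0 d \<pi> l (\<epsilon> l) (\<Theta>\<^sub>s l) \<longrightarrow> bound R' l"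
proof -
  interpret contraction_setting D \<Theta> p \<theta>\<^sub>0 k H ip d \<gamma> Ct \<kappa> C r W \<pi>
    by fact
  let ?rate = "\<lambda>l. rate_conditions C D \<Theta> p \<theta>\<^sub>0 d \<pi> l (\<epsilon> l) (\<Theta>\<^sub>s l)"
  have mono: "bound R' l" if "bound R l" "R \<le> R'" for R R' l
    unfolding bound_def
    by (rule order.trans[OF deviation_antimono that(1)[unfolded bound_def]])
      (intro add_right_mono mult_right_mono that(2) powr_ge_zero)
  have main: "bound R l" if "1 \<le> l" "?rate l" "R * \<epsilon> l \<le> r" for l
    using rate_bound[OF that(2,1) R1 R that(3)] by (simp add: bound_def)
  then show "\<forall>l\<ge>1. ?rate l \<and> R * \<epsilon> l \<le> r \<longrightarrow> bound R l"
    by blast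
  assume "\<epsilon> \<longlonglongrightarrow> 0"
  then have "(\<lambda>l. R * \<epsilon> l) \<longlonglongrightarrow> 0"
    by (rule tendsto_mult_right_zero)
  then have "eventually (\<lambda>l. R * \<epsilon> l < r) sequentially"
    using r by (rule order_tendstoD(2))
  then obtain L where L: "\<And>l. L \<le> l \<Longrightarrow> R * \<epsilon> l \<le> r"
    by (auto simp: eventually_sequentially intro: less_imp_le)
  have "\<exists>R'. 1 \<le> l \<longrightarrow> ?rate l \<longrightarrow> bound R' l" for l
  proof (cases "1 \<le> l \<and> ?rate l")
    case True
    then have "0 < \<epsilon> l" "1 \<le> l" "?rate l"
      by (auto simp: rate_conditions_def)
    then have "0 < ennreal (1 / (real l * (\<epsilon> l)\<^sup>2) + 4 * exp (- 1 * real l * (\<epsilon> l)\<^sup>2))"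
      by (auto intro!: add_pos_pos)
    from tail_bound[OF \<open>?rate l\<close> \<open>1 \<le> l\<close> this] show ?thesis
      unfolding bound_def by (meson exp_ge_zero mult_nonneg_nonneg order_refl powr_ge_zero)
  qed blast
  then obtain f where f: "\<And>l. 1 \<le> l \<Longrightarrow> ?rate l \<Longrightarrow> bound (f l) l"
    by metis
  \<comment> \<open>The sum replaces a maximum: it dominates \<open>R\<close> and every
    \<open>f l\<close> with \<open>l < L\<close>.\<close>
  define R' where "R' = R + (\<Sum>l<L. \<bar>f l\<bar>)"
  have "bound R' l" if "1 \<le> l" "?rate l" for l
  proof (cases "l < L")
    case True
    have "f l \<le> \<bar>f l\<bar>" by simp
    also have "\<dots> \<le> (\<Sum>l<L. \<bar>f l\<bar>)"
      using True by (intro member_le_sum) auto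
    also have "\<dots> \<le> R'"
      using R R1 by (simp add: R'_def)
    finally show ?thesis
      by (rule mono[OF f[OF that]])
  next
    case False
    then have "bound R l"
      by (intro main that L) simp
    then show ?thesis
      by (rule mono) (simp add: R'_def sum_nonneg)
  qed
  moreover have "0 < R'"
    using R R1 by (auto simp: R'_def intro!: add_pos_nonneg sum_nonneg)
  ultimately show "\<exists>R'>0. \<forall>l\<ge>1. ?rate l \<longrightarrow> bound R' l"
    by blast
qed

text \<open>\<open>R\<close> is fixed before the radius \<open>r\<close>, the prior,
  \<open>W\<close> and the sequence \<epsilon>, which is why the first claim asks for
  \<open>R * \<epsilon> l \<le> r\<close>. In the second claim \<open>R'\<close> may depend on all
  of these but still serves every \<open>l\<close>.\<close>

theorem theorem3p8:
  fixes K :: real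
  assumes "K > 0"
  shows "\<exists>Kt>0. \<forall>C>0. \<exists>W\<^sub>0>0.
    \<forall>D (\<Theta> :: 'a set) p \<theta>\<^sub>0 k H ip d \<gamma> Ct.
      statistical_model D \<Theta> p \<and> \<theta>\<^sub>0 \<in> \<Theta> \<and>
      characteristic_kernel (param_borel D \<Theta> p) k H ip \<and>
      (d = hellinger D p \<or>
       (\<exists>q c. euclidean_coords q \<Theta> c \<and> d = euclidean_distance q c \<and> test_condition K D \<Theta> p d)) \<and>
      \<gamma> > 0 \<and> Ct > 0 \<longrightarrow>
      (\<exists>R>0. \<forall>r \<pi> W (\<epsilon> :: nat \<Rightarrow> real) (\<Theta>\<^sub>s :: nat \<Rightarrow> 'a set).
        r > 0 \<and>
        (\<forall>\<theta>\<in>\<Theta>. d \<theta> \<theta>\<^sub>0 \<le> r \<longrightarrow> d \<theta> \<theta>\<^sub>0 \<ge> Ct * kernel_distance \<Theta> k ip \<theta> \<theta>\<^sub>0 powr \<gamma>) \<and>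
        prior (param_borel D \<Theta> p) \<pi> \<and>
        W \<ge> W\<^sub>0 \<and> integrable \<pi> (\<lambda>\<theta>. kernel_distance \<Theta> k ip \<theta> \<theta>\<^sub>0 powr W) \<longrightarrow>
        (let D\<^sub>k = (\<integral>\<theta>. kernel_distance \<Theta> k ip \<theta> \<theta>\<^sub>0 powr W \<partial>\<pi>) powr (1 / W);
             bound = (\<lambda>R l.
               deviation_prob D \<Theta> p \<theta>\<^sub>0 (unit_ball H ip) \<pi> l
                 (R * \<epsilon> l powr (1 / \<gamma>) + D\<^sub>k * exp (- Kt * real l * (\<epsilon> l)\<^sup>2 / 2))
               \<le> ennreal (1 / (real l * (\<epsilon> l)\<^sup>2) + 4 * exp (- Kt * real l * (\<epsilon> l)\<^sup>2)))
         in (\<forall>l\<ge>1. rate_conditions C D \<Theta> p \<theta>\<^sub>0 d \<pi> l (\<epsilon> l) (\<Theta>\<^sub>s l) \<and> R * \<epsilon> l \<le> r \<longrightarrow> bound R l) \<and>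
            (\<epsilon> \<longlonglongrightarrow> 0 \<longrightarrow>
              (\<exists>R'>0. \<forall>l\<ge>1. rate_conditions C D \<Theta> p \<theta>\<^sub>0 d \<pi> l (\<epsilon> l) (\<Theta>\<^sub>s l) \<longrightarrow> bound R' l))))"
proof (rule exI[of _ "1 :: real"], rule conjI, simp, intro allI impI, goal_cases)
  case C: (1 C)
  define \<kappa> where "\<kappa> = min K (1/10)"
  have \<kappa>: "0 < \<kappa>"
    using assms by (simp add: \<kappa>_def)
  \<comment> \<open>The 22 fits the relative radius 1/10 of the tests; the root makes \<kappa> (R1 -
    2)^2 at least C + 4, the exponent required of the errors of the second kind.\<close>
  define R1 where "R1 = 22 + sqrt ((C + 4) / \<kappa>)"
  have "0 \<le> sqrt ((C + 4) / \<kappa>)"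
    using C \<kappa> by simp
  moreover have "\<kappa> * (sqrt ((C + 4) / \<kappa>))\<^sup>2 = C + 4"
    using C \<kappa> by simp
  moreover have "\<kappa> * (sqrt ((C + 4) / \<kappa>))\<^sup>2 \<le> \<kappa> * (R1 - 2)\<^sup>2"
    using \<kappa> calculation(1) by (intro mult_left_mono power_mono) (auto simp: R1_def)
  ultimately have R1: "22 \<le> R1" "C + 4 \<le> \<kappa> * (R1 - 2)\<^sup>2"
    by (auto simp: R1_def)
  show ?case
  proof (rule exI[of _ "2 * C + 8"], rule conjI, use C in simp, intro allI impI, goal_cases)
    case hyp: (1 D \<Theta> p \<theta>\<^sub>0 k H ip d \<gamma> Ct)
    \<comment> \<open>\<open>R1\<close> keeps the near set within the range of the link when
      \<open>R * \<epsilon> l \<le> r\<close>; the power is the constant left by inverting the link,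
      and \<open>R1 > 0\<close> makes the comparison strict.\<close>
    define R where "R = R1 + (R1 / Ct) powr (1 / \<gamma>)"
    have R: "0 < R" "R1 \<le> R" "(R1 / Ct) powr (1 / \<gamma>) < R"
      using R1 by (auto simp: R_def intro: add_pos_nonneg)
    have tests: "separation_tests \<kappa> (1/10) (leb D) \<Theta> p d" "Metric_space \<Theta> d"
      unfolding \<kappa>_def using hyp separation_tests_of_distance[of D \<Theta> p d K] by blast+
    show ?case
    proof (rule exI[of _ R], rule conjI, rule R(1), intro allI impI, goal_cases)
      case prems: (1 r \<pi> W \<epsilon> \<Theta>\<^sub>s)
      have "contraction_setting D \<Theta> p \<theta>\<^sub>0 k H ip d \<gamma> Ct \<kappa> C r W \<pi>"
        by (rule contraction_setting.intro) (use hyp prems tests \<kappa> C in blast)+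
      from contraction_rates[OF this _ R1 R(2,3)] show ?case
        using prems unfolding Let_def by blast
    qed
  qed
qed

end
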